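(* Let $m>1$, $\alpha\in(0,1)$, let $\mathbf X$ be an $\alpha$-rough path (over $\mathbb R^d$) and let $\sigma\in C^N(\mathbb R^k,\mathbb R^{k\times d})$, $y_0\in\mathbb R^k$. Let $\mathbf Y$ be a solution on $[0,1]$ of $$dY(t)=-|Y(t)|^{m-1}Y(t)\,dt+\sigma(Y(t))\,dX(t),\qquad Y(0)=y_0,$$ in the sense defined in the context, and let $Y(t)=\langle \mathbf 1,\mathbf Y_t\rangle\in\mathbb R^k$. (1) Let $\sigma$ satisfy the bounded-coefficients assumption, and for $\epsilon_1=\epsilon_1(m)>0$ and $\epsilon_2=\epsilon_2(\alpha,d,k,C_\sigma)>0$ small enough set $$T_1=\epsilon_1\frac1{\langle y_0\rangle^{m-1}},\qquad T_2=\epsilon_2\min\Big\{\frac1{[\mathbf X:h]^{\frac1{|h|\alpha}}}:h\in\mathring{\mathcal T}_{\le N}\Big\}.$$ Then $\langle Y(t)\rangle\le 2\langle y_0\rangle$ for all $t\in[0,1]$ with $t\le\min\{T_1,T_2\}$. (2) Let $\sigma$ satisfy the polynomial-growth assumption with an exponent $\gamma$ such that $1\le\gamma<(m-1)\alpha+1$, let $T_1=\epsilon_1\langle y_0\rangle^{-(m-1)}$ with $\epsilon_1=\epsilon_1(m)>0$ small enough, as in (1), and for $\epsilon_2=\epsilon_2(\alpha,d,k,C_\sigma)>0$ small enough set $$T_2=\epsilon_2\Big(\frac1{\langle y_0\rangle}\Big)^{\frac{\gamma-1}{\alpha}}\min\Big\{\frac1{[\mathbf X:h]^{\frac1{|h|\alpha}}}:h\in\mathring{\mathcal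 T}_{\le N}\Big\}.$$ Then $\langle Y(t)\rangle\le 2\langle y_0\rangle$ for all $t\in[0,1]$ with $t\le\min\{T_1,T_2\}$.
   Context: Fix integers $d,k\ge 1$ and $\alpha\in(0,1)$; $N$ is the unique natural number with $N\alpha\le 1<(N+1)\alpha$. $[d]=\{1,\dots,d\}$, $\langle x\rangle=(1+|x|^2)^{1/2}$ for $x\in\mathbb R^k$. The columns of $\sigma$ are $\sigma_\mu:\mathbb R^k\to\mathbb R^k$, $\mu\in[d]$. Convention: $1/0=+\infty$. The notation $\epsilon_1=\epsilon_1(m)$, $\epsilon_2=\epsilon_2(\alpha,d,k,C_\sigma)$ indicates the quantities on which these constants depend. Bounded-coefficients assumption: $\sup_{x\in\mathbb R^k}|\partial^\beta\sigma(x)|\le C_\sigma$ for every multi-index $\beta\in\mathbb N^k$ with $|\beta|\le N$, for some constant $C_\sigma<\infty$. Polynomial-growth assumption with exponent $\gamma>0$: $|\partial^\beta\sigma(x)|\le C_\sigma\langle x\rangle^{\gamma-|\beta|}$ for all $x\in\mathbb R^k$ and all $|\beta|\le N$, for some constant $C_\sigma<\infty$. Trees and forests. Consider finite rooted trees (non-planar) with vertices decorated by elements of $[d]$. A forest is a finite, possibly empty, multiset of such trees, written as a commutative product; $\mathbf 1$ is the empty forest. For a forest $f$ and $\mu\in[d]$, $[f]_\mu$ is the tree obtained by joining the roots of all trees of $f$ to a new root decorated by $\mu$; every tree is uniquely of this form. $|f|$ is the number of vertices. $\mathring{\mathcal T}_{\le j}$ is the set of trees $h$ with $|h|\le j$,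 $\mathcal T_{\le j}=\mathring{\mathcal T}_{\le j}\cup\{\mathbf 1\}$, $\mathcal F$ is the set of forests all of whose trees lie in $\mathring{\mathcal T}_{\le N}$, and $\mathcal F_{\le j}=\{f\in\mathcal F:|f|\le j\}$. $\mathrm{Span}(\mathcal F)$ is the free real vector space on $\mathcal F$, a commutative unital algebra under the forest product; $\langle\cdot,\cdot\rangle$ denotes the inner product making forests orthonormal, its tensor version, and duality pairings. $P_{\le n}$ is the linear projection annihilating forests $f$ with $|f|>n$ and fixing the others. Coproduct. $\Delta$ is the multiplicative linear map with $\Delta\mathbf 1=\mathbf 1\otimes\mathbf 1$ and $\Delta[f]_\mu=[f]_\mu\otimes\mathbf 1+(\mathrm{id}\otimes[\,\cdot\,]_\mu)\Delta f$. Rough paths. An $\alpha$-rough path is a map $\mathbf X:[0,1]^2\to\mathrm{Char}$, $(s,t)\mapsto\mathbf X_{s,t}$, where $\mathrm{Char}$ is the set of unital algebra homomorphisms $\mathrm{Span}(\mathcal F)\to\mathbb R$, such that $\langle\mathbf X_{s,u}\otimes\mathbf X_{u,t},\Delta h\rangle=\langle\mathbf X_{s,t},h\rangle$ for all $s,u,t\in[0,1]$, $h\in\mathcal T_{\le N}$, and $[\mathbf X:h]<\infty$ for all $h\in\mathring{\mathcal T}_{\le N}$, where for $f\in\mathcal F$ $$[\mathbf X:f]=\sup_{s\ne t\in[0,1]}\frac{|\langle\mathbf X_{s,t},f\rangle|}{|s-t|^{\alpha|f|}}.$$ Controlled paths. A tree path (resp. forest path) is a map $\mathbf Y:[0,1]\to\mathrm{Span}(\mathcal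 T_{\le N-1})^k$ (resp. $\mathrm{Span}(\mathcal F_{\le N-1})^k$); operations act componentwise. Write $Y_s=\langle\mathbf 1,\mathbf Y_s\rangle\in\mathbb R^k$ and $\mathbf Y_s=Y_s\mathbf 1+\delta\mathbf Y_s$. For $f\in\mathcal F_{\le N-1}$ let $R^{\mathbf Y,f}_{s,t}=\langle f,\mathbf Y_t\rangle-\langle\mathbf X_{s,t}\otimes f,\Delta\mathbf Y_s\rangle\in\mathbb R^k$. $\mathbf Y$ is $\mathbf X$-controlled if for all $f\in\mathcal F_{\le N-1}$ $$\sup_{s,t\in[0,1],\,0<|s-t|<1}\frac{|R^{\mathbf Y,f}_{s,t}|}{|t-s|^{(N-|f|)\alpha}}<\infty.$$ For a tree path $\mathbf Y$ and $g:\mathbb R^k\to\mathbb R^k$ of class $C^{N-1}$, $g(\mathbf Y)$ is the forest path $$g(\mathbf Y)_s=g(Y_s)\mathbf 1+P_{\le N-1}\sum_{p=1}^{N-1}\frac1{p!}\sum_{h_1,\dots,h_p\in\mathring{\mathcal T}_{\le N-1}}D^pg(Y_s)[\langle\mathbf Y_s,h_1\rangle,\dots,\langle\mathbf Y_s,h_p\rangle]\;h_1\cdots h_p .$$ Integration and solutions. For an $\mathbf X$-controlled forest path $\mathbf U$ and $\mu\in[d]$, $\int_s^t\mathbf U_r\,d\mathbf X^{(\mu)}_r\in\mathbb R^k$ is the limit, as the mesh of partitions of $[s,t]$ tends to $0$, of $\sum_n\Xi_{s_n,s_{n+1}}$, where $\Xi_{s,t}=\sum_{f\in\mathcal F_{\le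 N-1}}\langle f,\mathbf U_s\rangle\langle\mathbf X_{s,t},[f]_\mu\rangle$. A solution of the equation is an $\mathbf X$-controlled tree path $\mathbf Y$ such that for all $s\in[0,1]$ $$\mathbf Y_s=y_0\mathbf 1-\Big(\int_0^s|Y_r|^{m-1}Y_r\,dr\Big)\mathbf 1+\mathbf Z_s,\qquad \mathbf Z_s=\sum_{\mu\in[d]}\Big(\int_0^s\sigma_\mu(\mathbf Y)_r\,d\mathbf X^{(\mu)}_r\Big)\mathbf 1+\sum_{\mu\in[d]}\sum_{f\in\mathcal F_{\le N-2}}\langle f,\sigma_\mu(\mathbf Y)_s\rangle[f]_\mu .$$
   Formalization: In part (2) the constant ε₂ is allowed to depend on the growth exponent γ as well as on α, d, k, C_σ; with C_σ fixed, no ε₂ independent of γ works for all γ (e.g. σ(x)=1−1/γ+⟨x⟩^γ/γ, y₀=0, γ large). *)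

theory Defs
  imports "HOL-Analysis.Analysis" "HOL-Library.Multiset" "HOL-Library.Poly_Mapping"
begin

(* Dimensions are natural numbers rather than types, so that constants can be asserted to be
   independent of them. The space R^k is the carrier of the library's Euclidean_space k: sequences
   nat => real whose coordinates vanish from index k on; the coordinates are 0, ..., k - 1. *)

abbreviation Rn :: "nat \<Rightarrow> (nat \<Rightarrow> real) set" where
  "Rn k \<equiv> topspace (Euclidean_space k)"

definition vnorm :: "nat \<Rightarrow> (nat \<Rightarrow> real) \<Rightarrow> real" where
  "vnorm k x = L2_set x {..<k}"

definition bracket :: "nat \<Rightarrow> (nat \<Rightarrow> real) \<Rightarrow> real" where
  "bracket k x = sqrt (1 + (vnorm k x)\<^sup>2)"


section \<open>Differential calculus on $\mathbb{R}^k$\<close>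

definition partial :: "nat \<Rightarrow> ((nat \<Rightarrow> real) \<Rightarrow> real) \<Rightarrow> (nat \<Rightarrow> real) \<Rightarrow> real" where
  "partial i f x = deriv (\<lambda>t. f (x(i := t))) (x i)"

primrec C_diff :: "nat \<Rightarrow> nat \<Rightarrow> ((nat \<Rightarrow> real) \<Rightarrow> real) \<Rightarrow> bool" where
  "C_diff k 0 f \<longleftrightarrow> continuous_map (Euclidean_space k) euclideanreal f"
| "C_diff k (Suc n) f \<longleftrightarrow>
     continuous_map (Euclidean_space k) euclideanreal f \<and>
     (\<forall>i<k. (\<forall>x\<in>Rn k. (\<lambda>t. f (x(i := t))) field_differentiable at (x i)) \<and>
            C_diff k n (partial i f))"

definition mi_order :: "nat \<Rightarrow> (nat \<Rightarrow> nat) \<Rightarrow> nat" where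
  "mi_order k \<beta> = (\<Sum>i<k. \<beta> i)"

definition mi_partial ::
  "nat \<Rightarrow> (nat \<Rightarrow> nat) \<Rightarrow> ((nat \<Rightarrow> real) \<Rightarrow> real) \<Rightarrow> (nat \<Rightarrow> real) \<Rightarrow> real" where
  "mi_partial k \<beta> f = foldr (\<lambda>i. partial i ^^ \<beta> i) [0..<k] f"

(* D^p g(y)[v_1, ..., v_p] in coordinates, where p is the length of the list of directions. *)
definition multi_deriv ::
  "nat \<Rightarrow> ((nat \<Rightarrow> real) \<Rightarrow> real) \<Rightarrow> (nat \<Rightarrow> real) \<Rightarrow> (nat \<Rightarrow> real) list \<Rightarrow> real" where
  "multi_deriv k g y vs =
     (\<Sum>is\<in>{is. length is = length vs \<and> set is \<subseteq> {..<k}}.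
        foldr partial is g y * (\<Prod>j<length vs. (vs ! j) (is ! j)))"

(* A matrix field sigma is given by its columns: sigma mu x i is the entry (i, mu), with
   mu in {1..d} and i < k. *)

definition coeff_C :: "nat \<Rightarrow> nat \<Rightarrow> nat \<Rightarrow> (nat \<Rightarrow> (nat \<Rightarrow> real) \<Rightarrow> nat \<Rightarrow> real) \<Rightarrow> bool" where
  "coeff_C d k n \<sigma> \<longleftrightarrow>
     (\<forall>\<mu>\<in>{1..d}. (\<forall>x\<in>Rn k. \<sigma> \<mu> x \<in> Rn k) \<and> (\<forall>i<k. C_diff k n (\<lambda>x. \<sigma> \<mu> x i)))"

definition coeff_deriv_norm ::
  "nat \<Rightarrow> nat \<Rightarrow> (nat \<Rightarrow> (nat \<Rightarrow> real) \<Rightarrow> nat \<Rightarrow> real) \<Rightarrow> (nat \<Rightarrow> nat) \<Rightarrow> (nat \<Rightarrow> real) \<Rightarrow> real" where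
  "coeff_deriv_norm d k \<sigma> \<beta> x =
     L2_set (\<lambda>(i, \<mu>). mi_partial k \<beta> (\<lambda>y. \<sigma> \<mu> y i) x) ({..<k} \<times> {1..d})"

definition bounded_coeff ::
  "nat \<Rightarrow> nat \<Rightarrow> nat \<Rightarrow> (nat \<Rightarrow> (nat \<Rightarrow> real) \<Rightarrow> nat \<Rightarrow> real) \<Rightarrow> real \<Rightarrow> bool" where
  "bounded_coeff d k N \<sigma> C \<longleftrightarrow>
     (\<forall>\<beta>. mi_order k \<beta> \<le> N \<longrightarrow> (\<forall>x\<in>Rn k. coeff_deriv_norm d k \<sigma> \<beta> x \<le> C))"

definition poly_growth ::
  "nat \<Rightarrow> nat \<Rightarrow> nat \<Rightarrow> (nat \<Rightarrow> (nat \<Rightarrow> real) \<Rightarrow> nat \<Rightarrow> real) \<Rightarrow> real \<Rightarrow> real \<Rightarrow> bool" where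
  "poly_growth d k N \<sigma> \<gamma> C \<longleftrightarrow>
     (\<forall>\<beta>. mi_order k \<beta> \<le> N \<longrightarrow>
        (\<forall>x\<in>Rn k. coeff_deriv_norm d k \<sigma> \<beta> x \<le> C * bracket k x powr (\<gamma> - real (mi_order k \<beta>))))"


section \<open>Trees, forests and the coproduct\<close>

datatype 'a rtree = Node 'a "'a rtree multiset"

type_synonym forest = "nat rtree multiset"

(* Multisets form a commutative monoid under union, so finitely supported functions on forests
   with the convolution product of Poly_Mapping are the free vector space on forests with the
   forest product; the empty forest is the unit. The tensor square is spanned by pairs. *)
type_synonym fspan = "forest \<Rightarrow>\<^sub>0 real"
type_synonym fspan2 = "forest \<times> forest \<Rightarrow>\<^sub>0 real"

primrec verts :: "'a rtree \<Rightarrow> nat" where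
  "verts (Node \<mu> f) = Suc (sum_mset (image_mset verts f))"

definition fverts :: "'a rtree multiset \<Rightarrow> nat" where
  "fverts f = (\<Sum>t\<in>#f. verts t)"

definition trees :: "nat \<Rightarrow> nat \<Rightarrow> nat rtree set" where
  "trees d j = {h. set_rtree h \<subseteq> {1..d} \<and> verts h \<le> j}"

definition trees1 :: "nat \<Rightarrow> nat \<Rightarrow> forest set" where
  "trees1 d j = insert {#} ((\<lambda>h. {#h#}) ` trees d j)"

definition forests :: "nat \<Rightarrow> nat \<Rightarrow> forest set" where
  "forests d N = {f. set_mset f \<subseteq> trees d N}"

definition forests_le :: "nat \<Rightarrow> nat \<Rightarrow> nat \<Rightarrow> forest set" where
  "forests_le d N j = {f \<in> forests d N. fverts f \<le> j}"

lemma size_le_fverts: "size f \<le> fverts f"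
proof -
  have pos: "1 \<le> verts h" for h :: "'a rtree" by (cases h) simp
  show ?thesis
  proof (induction f)
    case (add t f)
    then show ?case using pos[of t] by (simp add: fverts_def)
  qed simp
qed

lemma finite_msets_bounded:
  assumes "finite A"
  shows "finite {f. set_mset f \<subseteq> A \<and> size f \<le> n}"
proof (rule finite_subset)
  show "{f. set_mset f \<subseteq> A \<and> size f \<le> n} \<subseteq> mset ` {xs. set xs \<subseteq> A \<and> length xs \<le> n}"
  proof
    fix f assume f: "f \<in> {f. set_mset f \<subseteq> A \<and> size f \<le> n}"
    obtain xs where "mset xs = f" by (metis ex_mset)
    then have "set xs \<subseteq> A" "length xs \<le> n" using f by auto
    then show "f \<in> mset ` {xs. set xs \<subseteq> A \<and> length xs \<le> n}" using \<open>mset xs = f\<close> by blast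
  qed
qed (simp add: finite_lists_length_le assms)

lemma finite_trees: "finite (trees d j)"
proof (induction j)
  case 0
  have "\<not> verts h \<le> 0" for h :: "nat rtree" by (cases h) simp
  then have "trees d 0 = {}" unfolding trees_def by blast
  then show ?case by simp
next
  case (Suc j)
  let ?M = "{f. set_mset f \<subseteq> trees d j \<and> size f \<le> j}"
  have "trees d (Suc j) \<subseteq> (\<lambda>(\<mu>, f). Node \<mu> f) ` ({1..d} \<times> ?M)"
  proof
    fix h assume h: "h \<in> trees d (Suc j)"
    obtain \<mu> f where Node: "h = Node \<mu> f" by (cases h)
    have sum: "fverts f \<le> j" and dec: "\<mu> \<in> {1..d}" "\<forall>t\<in>#f. set_rtree t \<subseteq> {1..d}"
      using h Node by (auto simp: trees_def fverts_def)
    have "verts t \<le> j" if t: "t \<in># f" for t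
    proof -
      obtain g where "f = add_mset t g" using t by (metis multi_member_split)
      then show ?thesis using sum by (simp add: fverts_def)
    qed
    moreover have "size f \<le> j" using size_le_fverts[of f] sum by simp
    ultimately have "f \<in> ?M" using dec unfolding trees_def by blast
    then show "h \<in> (\<lambda>(\<mu>, f). Node \<mu> f) ` ({1..d} \<times> ?M)" unfolding Node using dec by (intro image_eqI[of _ _ "(\<mu>, f)"]) simp_all
  qed
  moreover have "finite ((\<lambda>(\<mu>, f). Node \<mu> f) ` ({1..d} \<times> ?M))"
    using finite_msets_bounded[OF Suc.IH] by blast
  ultimately show ?case by (rule finite_subset)
qed

lemma finite_forests_le: "finite (forests_le d N j)"
proof (rule finite_subset)
  show "forests_le d N j \<subseteq> {f. set_mset f \<subseteq> trees d N \<and> size f \<le> j}"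
    unfolding forests_le_def forests_def by (auto intro: order_trans[OF size_le_fverts])
qed (rule finite_msets_bounded[OF finite_trees])

definition basis :: "'b \<Rightarrow> 'b \<Rightarrow>\<^sub>0 real" where
  "basis f = Poly_Mapping.single f 1"

definition fscale :: "real \<Rightarrow> ('b \<Rightarrow>\<^sub>0 real) \<Rightarrow> ('b \<Rightarrow>\<^sub>0 real)" where
  "fscale c p = Poly_Mapping.map ((*) c) p"

definition fspace :: "forest set \<Rightarrow> fspan set" where
  "fspace A = {p. Poly_Mapping.keys p \<subseteq> A}"

definition trunc :: "nat \<Rightarrow> fspan \<Rightarrow> fspan" where
  "trunc n p = (\<Sum>f\<in>{f \<in> Poly_Mapping.keys p. fverts f \<le> n}. fscale (Poly_Mapping.lookup p f) (basis f))"

definition graft_right :: "'a \<Rightarrow> ('a rtree multiset \<times> 'a rtree multiset \<Rightarrow>\<^sub>0 real)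
    \<Rightarrow> ('a rtree multiset \<times> 'a rtree multiset \<Rightarrow>\<^sub>0 real)" where
  "graft_right \<mu> z = (\<Sum>(f, g)\<in>Poly_Mapping.keys z. fscale (Poly_Mapping.lookup z (f, g)) (basis (f, {#Node \<mu> g#})))"

primrec coprod_tree :: "'a rtree \<Rightarrow> ('a rtree multiset \<times> 'a rtree multiset \<Rightarrow>\<^sub>0 real)" where
  "coprod_tree (Node \<mu> f) =
     basis ({#Node \<mu> f#}, {#}) + graft_right \<mu> (prod_mset (image_mset coprod_tree f))"

definition coprod :: "fspan \<Rightarrow> fspan2" where
  "coprod p = (\<Sum>f\<in>Poly_Mapping.keys p. fscale (Poly_Mapping.lookup p f) (\<Prod>t\<in>#f. coprod_tree t))"

(* The pairing of a tensor product of two functionals, given by their values on forests. *)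
definition tensor_pair :: "(forest \<Rightarrow> real) \<Rightarrow> (forest \<Rightarrow> real) \<Rightarrow> fspan2 \<Rightarrow> real" where
  "tensor_pair a b z = (\<Sum>(f, g)\<in>Poly_Mapping.keys z. Poly_Mapping.lookup z (f, g) * a f * b g)"


section \<open>Rough paths\<close>

definition is_char :: "nat \<Rightarrow> nat \<Rightarrow> (fspan \<Rightarrow> real) \<Rightarrow> bool" where
  "is_char d N \<phi> \<longleftrightarrow>
     \<phi> 1 = 1 \<and>
     (\<forall>p\<in>fspace (forests d N). \<forall>q\<in>fspace (forests d N).
        \<phi> (p + q) = \<phi> p + \<phi> q \<and> \<phi> (p * q) = \<phi> p * \<phi> q) \<and>
     (\<forall>c. \<forall>p\<in>fspace (forests d N). \<phi> (fscale c p) = c * \<phi> p)"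

definition hoelder ::
  "real \<Rightarrow> (real \<Rightarrow> real \<Rightarrow> fspan \<Rightarrow> real) \<Rightarrow> forest \<Rightarrow> ennreal" where
  "hoelder \<alpha> X f =
     (SUP (s, t)\<in>{(s, t). s \<in> {0..1} \<and> t \<in> {0..1} \<and> s \<noteq> t}.
        ennreal (\<bar>X s t (basis f)\<bar> / \<bar>s - t\<bar> powr (\<alpha> * real (fverts f))))"

definition rough_path ::
  "real \<Rightarrow> nat \<Rightarrow> nat \<Rightarrow> (real \<Rightarrow> real \<Rightarrow> fspan \<Rightarrow> real) \<Rightarrow> bool" where
  "rough_path \<alpha> d N X \<longleftrightarrow>
     (\<forall>s\<in>{0..1}. \<forall>t\<in>{0..1}. is_char d N (X s t)) \<and>
     (\<forall>s\<in>{0..1}. \<forall>u\<in>{0..1}. \<forall>t\<in>{0..1}. \<forall>h\<in>trees1 d N.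
        tensor_pair (\<lambda>f. X s u (basis f)) (\<lambda>g. X u t (basis g)) (coprod (basis h))
          = X s t (basis h)) \<and>
     (\<forall>h\<in>trees d N. hoelder \<alpha> X {#h#} < \<infinity>)"

(* min over h of [X:h]^(-1/(|h| alpha)). In ennreal 1 / 0 is infinity; the seminorms are finite
   for a rough path, so nothing is lost by enn2real. *)
definition min_inv_hoelder ::
  "real \<Rightarrow> nat \<Rightarrow> nat \<Rightarrow> (real \<Rightarrow> real \<Rightarrow> fspan \<Rightarrow> real) \<Rightarrow> ennreal" where
  "min_inv_hoelder \<alpha> d N X =
     Min ((\<lambda>h. 1 / ennreal (enn2real (hoelder \<alpha> X {#h#}) powr (1 / (real (verts h) * \<alpha>))))
          ` trees d N)"


section \<open>Controlled paths, integration and solutions\<close>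

(* Paths with values in Span(A)^k: Y s i is the i-th component, zero for i >= k. *)

definition is_path :: "forest set \<Rightarrow> nat \<Rightarrow> (real \<Rightarrow> nat \<Rightarrow> fspan) \<Rightarrow> bool" where
  "is_path A k Y \<longleftrightarrow> (\<forall>s\<in>{0..1}. (\<forall>i<k. Y s i \<in> fspace A) \<and> (\<forall>i\<ge>k. Y s i = 0))"

definition tree_path :: "nat \<Rightarrow> nat \<Rightarrow> nat \<Rightarrow> (real \<Rightarrow> nat \<Rightarrow> fspan) \<Rightarrow> bool" where
  "tree_path d N k Y \<longleftrightarrow> is_path (trees1 d (N - 1)) k Y"

definition fcoeff :: "forest \<Rightarrow> (nat \<Rightarrow> fspan) \<Rightarrow> nat \<Rightarrow> real" where
  "fcoeff f p i = Poly_Mapping.lookup (p i) f"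

definition remainder :: "(real \<Rightarrow> real \<Rightarrow> fspan \<Rightarrow> real) \<Rightarrow> (real \<Rightarrow> nat \<Rightarrow> fspan)
    \<Rightarrow> forest \<Rightarrow> real \<Rightarrow> real \<Rightarrow> nat \<Rightarrow> real" where
  "remainder X Y f s t i =
     fcoeff f (Y t) i
       - tensor_pair (\<lambda>g. X s t (basis g)) (\<lambda>g. if g = f then 1 else 0) (coprod (Y s i))"

definition controlled :: "real \<Rightarrow> nat \<Rightarrow> nat \<Rightarrow> nat \<Rightarrow> (real \<Rightarrow> real \<Rightarrow> fspan \<Rightarrow> real)
    \<Rightarrow> (real \<Rightarrow> nat \<Rightarrow> fspan) \<Rightarrow> bool" where
  "controlled \<alpha> d N k X Y \<longleftrightarrow>
     (\<forall>f\<in>forests_le d N (N - 1).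
        bdd_above ((\<lambda>(s, t). vnorm k (remainder X Y f s t)
                              / \<bar>t - s\<bar> powr ((real N - real (fverts f)) * \<alpha>))
          ` {(s, t). s \<in> {0..1} \<and> t \<in> {0..1} \<and> 0 < \<bar>s - t\<bar> \<and> \<bar>s - t\<bar> < 1}))"

(* The forest path g(Y); the inner sum runs over tuples (h_1, ..., h_p), given as lists. *)
definition compose :: "nat \<Rightarrow> nat \<Rightarrow> nat \<Rightarrow> ((nat \<Rightarrow> real) \<Rightarrow> nat \<Rightarrow> real)
    \<Rightarrow> (real \<Rightarrow> nat \<Rightarrow> fspan) \<Rightarrow> real \<Rightarrow> nat \<Rightarrow> fspan" where
  "compose d N k g Y s i =
     fscale (g (fcoeff {#} (Y s)) i) 1 +
     trunc (N - 1)
       (\<Sum>p=1..N - 1. fscale (1 / fact p)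
         (\<Sum>hs\<in>{hs. length hs = p \<and> set hs \<subseteq> trees d (N - 1)}.
            fscale (multi_deriv k (\<lambda>x. g x i) (fcoeff {#} (Y s))
                      (map (\<lambda>h. fcoeff {#h#} (Y s)) hs))
              (basis (mset hs))))"

(* One component of the germ Xi and of the integral. *)

definition germ :: "nat \<Rightarrow> nat \<Rightarrow> (real \<Rightarrow> real \<Rightarrow> fspan \<Rightarrow> real) \<Rightarrow> (real \<Rightarrow> fspan) \<Rightarrow> nat
    \<Rightarrow> real \<Rightarrow> real \<Rightarrow> real" where
  "germ d N X U \<mu> s t =
     (\<Sum>f\<in>forests_le d N (N - 1). Poly_Mapping.lookup (U s) f * X s t (basis {#Node \<mu> f#}))"

definition has_rough_integral :: "nat \<Rightarrow> nat \<Rightarrow> (real \<Rightarrow> real \<Rightarrow> fspan \<Rightarrow> real)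
    \<Rightarrow> (real \<Rightarrow> fspan) \<Rightarrow> nat \<Rightarrow> real \<Rightarrow> real \<Rightarrow> real \<Rightarrow> bool" where
  "has_rough_integral d N X U \<mu> s t J \<longleftrightarrow>
     (\<forall>e>0. \<exists>\<delta>>0. \<forall>n p.
        p 0 = s \<and> p n = t \<and> (\<forall>j<n. p j < p (Suc j) \<and> p (Suc j) - p j < \<delta>) \<longrightarrow>
        \<bar>(\<Sum>j<n. germ d N X U \<mu> (p j) (p (Suc j))) - J\<bar> < e)"

(* J mu s i is the i-th component of the integral of sigma_mu(Y) over [0, s] against the mu-th
   driver. The index set of the last sum is written with |f| + 2 <= N since it has to be empty
   for N = 1. *)
definition is_solution :: "real \<Rightarrow> real \<Rightarrow> nat \<Rightarrow> nat \<Rightarrow> nat \<Rightarrow> (real \<Rightarrow> real \<Rightarrow> fspan \<Rightarrow> real)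
    \<Rightarrow> (nat \<Rightarrow> (nat \<Rightarrow> real) \<Rightarrow> nat \<Rightarrow> real) \<Rightarrow> (nat \<Rightarrow> real) \<Rightarrow> (real \<Rightarrow> nat \<Rightarrow> fspan) \<Rightarrow> bool" where
  "is_solution m \<alpha> d N k X \<sigma> y0 Y \<longleftrightarrow>
     tree_path d N k Y \<and> controlled \<alpha> d N k X Y \<and>
     (\<exists>J. (\<forall>s\<in>{0..1}. \<forall>\<mu>\<in>{1..d}. \<forall>i<k.
             has_rough_integral d N X (\<lambda>r. compose d N k (\<sigma> \<mu>) Y r i) \<mu> 0 s (J \<mu> s i)) \<and>
          (\<forall>s\<in>{0..1}. \<forall>i<k.
             Y s i =
               fscale (y0 i) 1
               - fscale (integral {0..s} (\<lambda>r. vnorm k (fcoeff {#} (Y r)) powr (m - 1)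
                                               * fcoeff {#} (Y r) i)) 1
               + ((\<Sum>\<mu>\<in>{1..d}. fscale (J \<mu> s i) 1)
                  + (\<Sum>\<mu>\<in>{1..d}. \<Sum>f\<in>{f \<in> forests d N. fverts f + 2 \<le> N}.
                       fscale (fcoeff f (compose d N k (\<sigma> \<mu>) Y s) i) (basis {#Node \<mu> f#})))))"

end

(*
  A solution is determined by its underlying path y: its tree coefficients are elementary
  differentials of sigma at y. For a weight w put nrm w a = sum of |a_f| w^|f|, a submultiplicative
  norm on Span(F). If the rough path increment over [s, u] satisfies |<X, f>| <= (theta l)^|f| with
  l = (|u - s| / tau)^alpha, then f |-> (X (x) id) Delta f is an algebra homomorphism gamma bounded
  in these norms, and the whole family of remainder estimates becomes the single statement that
  R = Y_u - gamma Y_s has norm O(l^N) in the weight theta l. Since gamma is multiplicative,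
  g(Y)_u - gamma g(Y)_s compares two Taylor polynomials of g with coefficients in the algebra, based
  at y_u and y_s; along the segment joining them the derivative telescopes, so the comparison is
  linear in R. The defect of the germ of the rough integral is theta times such a comparison, and
  sewing bounds (integral - germ) by C theta (1 + the same quantity): the a priori finite constant
  is absorbed for small theta. All bounds are linear in the drift, which is therefore only required
  to be small compared with <y0>. A continuity argument in time, on the region
  |y - y0| <= <y0> / 2 where <y> is comparable with <y0>, concludes: with derivative bounds A B^p on
  this region, both cases reduce to A B theta small, with B = 1 in case (1) and B = 1 / <y0> in
  case (2).
*)
theory Submission
  imports Defs
begin

section \<open>Calculus on coordinate space\<close>

text \<open>The doubled weight is the price of \<open>gamma\<close>, which maps weight 2 w boundedly
  to weight w: bounds on coefficients at a single time are therefore proved in weight 2 \<theta>,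
  comparisons of two times in weight \<theta> l. Truncation at N - 1 vertices does not commute with
  \<open>gamma\<close>, so untruncated Taylor polynomials are compared, and the cut-off part is
  small by itself, having many vertices. The constants must not depend on the solution, whereas
  control provides only some finite bound. Apart from the sewing error, the coefficients of
  \<open>v\<close> (by continuity in the weight) and \<open>R\<close> (by a maximum over the k
  components) are also bounded in terms of themselves with a factor that is a multiple of A B
  \<theta>. A and B are kept apart because in case (2) A is of order <y0> ^ \<gamma>, while the
  factor in T2 makes \<theta> of order <y0> ^ (1 - \<gamma>), so that A B \<theta> no longer sees
  <y0>. The drift is of order 1 \<ge> N \<alpha> in time, hence belongs to the remainder; there it
  need not be small in absolute terms, since its size \<beta> enters only through 1 + B
  \<beta>.\<close>

lemma Rn_iff: "x \<in> Rn k \<longleftrightarrow> (\<forall>i\<ge>k. x i = 0)"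
  by (simp add: topspace_Euclidean_space)

lemma Rn_upd: "x \<in> Rn k \<Longrightarrow> i < k \<Longrightarrow> x(i := t) \<in> Rn k"
  by (simp add: Rn_iff)

lemma C_diff_continuous_on: "C_diff k n f \<Longrightarrow> continuous_on (Rn k) f"
  by (cases n) (simp_all add: continuous_map_Euclidean_space_iff)

lemma C_diff_partial: "C_diff k (Suc n) f \<Longrightarrow> i < k \<Longrightarrow> C_diff k n (partial i f)"
  by simp

lemma C_diff_foldr:
  "C_diff k n f \<Longrightarrow> set is \<subseteq> {..<k} \<Longrightarrow> length is \<le> n \<Longrightarrow> C_diff k (n - length is) (foldr partial is f)"
proof (induction "is" arbitrary: n f)
  case (Cons i "is")
  have "C_diff k (n - length is) (foldr partial is f)" using Cons by auto
  moreover have "n - length is = Suc (n - length (i # is))" using Cons.prems by simp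
  ultimately show ?case using Cons.prems by simp
qed simp

lemma partial_has_derivative:
  assumes "C_diff k (Suc n) f" "x \<in> Rn k" "i < k"
  shows "((\<lambda>u. f (x(i := u))) has_real_derivative partial i f (x(i := t))) (at t)"
proof -
  have "(\<lambda>u. f ((x(i := t))(i := u))) field_differentiable at ((x(i:=t)) i)"
    using assms Rn_upd[OF assms(2,3), of t] unfolding C_diff.simps by blast
  then have "(\<lambda>u. f (x(i := u))) field_differentiable at t" by simp
  then have "((\<lambda>u. f (x(i := u))) has_real_derivative deriv (\<lambda>u. f (x(i := u))) t) (at t)"
    by (simp add: DERIV_deriv_iff_field_differentiable)
  then show ?thesis by (simp add: partial_def)
qed

text \<open>The topology on \<open>Rn k\<close> is induced by the product topology, so convergence
  of the single coordinates suffices.\<close>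

lemma tendsto_continuous_on_Rn:
  fixes f :: "(nat \<Rightarrow> real) \<Rightarrow> real"
  assumes "continuous_on (Rn k) f" "l \<in> Rn k" "\<forall>\<^sub>F t in F. p t \<in> Rn k"
    and "\<And>i. ((\<lambda>t. p t i) \<longlongrightarrow> l i) F"
  shows "((\<lambda>t. f (p t)) \<longlongrightarrow> f l) F"
proof -
  have "limitin (product_topology (\<lambda>i. euclidean) UNIV) p l F"
    using assms(4) by (subst limitin_componentwise) auto
  then have "(p \<longlongrightarrow> l) F"
    by (simp add: euclidean_product_topology)
  then show ?thesis
    by (rule continuous_on_tendsto_compose[OF assms(1) _ assms(2) assms(3)])
qed

text \<open>Form of the mean value theorem without an order on the end points, since the increments
  in \<open>C_diff_chain\<close> have either sign.\<close>

lemma MVT_abs: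
  fixes f :: "real \<Rightarrow> real"
  assumes "\<And>t. (f has_real_derivative f' t) (at t)"
  obtains z where "f b - f a = (b - a) * f' z" "\<bar>z - a\<bar> \<le> \<bar>b - a\<bar>"
proof (cases a b rule: linorder_cases)
  case less
  from MVT2[OF less, of f f'] assms obtain z where "a < z" "z < b" "f b - f a = (b - a) * f' z" by blast
  with that[of z] show ?thesis by auto
next
  case greater
  from MVT2[OF greater, of f f'] assms obtain z where "b < z" "z < a" "f a - f b = (a - b) * f' z" by blast
  then have "f b - f a = (b - a) * f' z" by (simp add: algebra_simps)
  with that[of z] \<open>b < z\<close> \<open>z < a\<close> show ?thesis by auto
qed (use that[of a] in auto)

text \<open>\<open>C_diff\<close> provides partial derivatives only, so the increment of f along the
  line is telescoped over the coordinates. Each summand changes one coordinate and is treated by the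
  mean value theorem; continuity of that partial derivative at the base point gives the
  limit.\<close>

lemma C_diff_chain:
  assumes f: "C_diff k (Suc n) f" and x: "x \<in> Rn k" and y: "y \<in> Rn k"
  shows "((\<lambda>t. f (\<lambda>i. x i + t * y i)) has_real_derivative
            (\<Sum>i<k. y i * partial i f (\<lambda>i. x i + s * y i))) (at s)"
proof -
  \<comment> \<open>Coordinates below j have moved to time t, the others still sit at time s:
    \<open>z 0\<close> does not depend on t, and \<open>z k\<close> is the line itself.\<close>
  define z where "z j t = (\<lambda>i. if i < j then x i + t * y i else x i + s * y i)" for j t
  define l where "l = (\<lambda>i. x i + s * y i)"
  have l: "l \<in> Rn k" using x y by (simp add: Rn_iff l_def)
  have z: "z j t \<in> Rn k" for j t using x y by (simp add: Rn_iff z_def)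
  have step: "((\<lambda>t. f (z (Suc j) t) - f (z j t)) has_real_derivative y j * partial j f l) (at s)"
    if j: "j < k" for j
  proof -
    have "\<forall>t. \<exists>c. f (z (Suc j) t) - f (z j t) = (t - s) * (y j * partial j f ((z j t)(j := c)))
              \<and> \<bar>c - l j\<bar> \<le> \<bar>t - s\<bar> * \<bar>y j\<bar>" (is "\<forall>t. \<exists>c. ?P t c")
    proof
      fix t
      have "((\<lambda>u. f ((z j t)(j := u))) has_real_derivative partial j f ((z j t)(j := u))) (at u)" for u
        by (rule partial_has_derivative[OF f z j])
      then obtain c where c: "f ((z j t)(j := x j + t * y j)) - f ((z j t)(j := l j))
            = ((x j + t * y j) - l j) * partial j f ((z j t)(j := c))"
            "\<bar>c - l j\<bar> \<le> \<bar>(x j + t * y j) - l j\<bar>"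
        by (rule MVT_abs)
      have 1: "(x j + t * y j) - l j = (t - s) * y j" by (simp add: l_def algebra_simps)
      have 2: "(z j t)(j := x j + t * y j) = z (Suc j) t" by (auto simp: z_def fun_eq_iff less_Suc_eq)
      have 3: "(z j t)(j := l j) = z j t" by (simp add: z_def l_def fun_eq_iff)
      have "?P t c" using c unfolding 1 2 3 by (simp only: abs_mult mult.assoc)
      then show "\<exists>c. ?P t c" ..
    qed
    then obtain c where "\<forall>t. ?P t (c t)" by (rule choice[THEN exE])
    then have c: "\<And>t. f (z (Suc j) t) - f (z j t) = (t - s) * (y j * partial j f ((z j t)(j := c t)))"
      "\<And>t. \<bar>c t - l j\<bar> \<le> \<bar>t - s\<bar> * \<bar>y j\<bar>" by auto
    have "((\<lambda>t. \<bar>t - s\<bar> * \<bar>y j\<bar>) \<longlongrightarrow> \<bar>s - s\<bar> * \<bar>y j\<bar>) (at s)" by (intro tendsto_intros)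
    then have "((\<lambda>t. \<bar>t - s\<bar> * \<bar>y j\<bar>) \<longlongrightarrow> 0) (at s)" by simp
    moreover have "\<forall>\<^sub>F t in at s. norm (c t - l j) \<le> \<bar>t - s\<bar> * \<bar>y j\<bar>"
      by (intro always_eventually allI) (simp add: c(2))
    ultimately have "((\<lambda>t. c t - l j) \<longlongrightarrow> 0) (at s)" by (rule Lim_null_comparison[rotated])
    then have cl: "(c \<longlongrightarrow> l j) (at s)" using Lim_null by blast
    have "((\<lambda>t. partial j f ((z j t)(j := c t))) \<longlongrightarrow> partial j f l) (at s)"
    proof (rule tendsto_continuous_on_Rn[OF _ l])
      show "continuous_on (Rn k) (partial j f)" using f j by (intro C_diff_continuous_on) auto
      show "\<forall>\<^sub>F t in at s. (z j t)(j := c t) \<in> Rn k" using Rn_upd[OF z j] by simp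
      show "((\<lambda>t. ((z j t)(j := c t)) i) \<longlongrightarrow> l i) (at s)" for i
      proof (cases "i = j")
        case False
        have "((\<lambda>t. x i + t * y i) \<longlongrightarrow> x i + s * y i) (at s)" by (intro tendsto_intros)
        then show ?thesis using False by (cases "i < j") (simp_all add: z_def l_def)
      qed (use cl in simp)
    qed
    then have "((\<lambda>t. y j * partial j f ((z j t)(j := c t))) \<longlongrightarrow> y j * partial j f l) (at s)"
      by (intro tendsto_intros)
    moreover have "\<forall>\<^sub>F t in at s. y j * partial j f ((z j t)(j := c t))
        = (f (z (Suc j) t) - f (z j t) - (f (z (Suc j) s) - f (z j s))) / (t - s)"
    proof -
      have "y j * partial j f ((z j t)(j := c t))
        = (f (z (Suc j) t) - f (z j t) - (f (z (Suc j) s) - f (z j s))) / (t - s)" if "t \<noteq> s" for t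
        unfolding c(1) using that by simp
      then show ?thesis unfolding eventually_at_filter by (intro always_eventually) blast
    qed
    ultimately show ?thesis
      unfolding has_field_derivative_iff by (rule Lim_transform_eventually)
  qed
  have "((\<lambda>t. f (z j t)) has_real_derivative (\<Sum>i<j. y i * partial i f l)) (at s)" if "j \<le> k" for j
    using that
  proof (induction j)
    case 0
    then show ?case by (simp add: z_def)
  next
    case (Suc j)
    have "((\<lambda>t. f (z j t) + (f (z (Suc j) t) - f (z j t))) has_real_derivative
         (\<Sum>i<j. y i * partial i f l) + y j * partial j f l) (at s)"
      using Suc step[of j] by (intro DERIV_add) auto
    then show ?case by simp
  qed
  from this[of k] have "((\<lambda>t. f (z k t)) has_real_derivative (\<Sum>i<k. y i * partial i f l)) (at s)" by simp
  moreover have "z k t = (\<lambda>i. x i + t * y i)" for t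
    using x y by (auto simp: z_def fun_eq_iff Rn_iff)
  ultimately show ?thesis by (simp add: l_def)
qed

text \<open>The second difference over a square is an increment of an increment, so the mean value
  theorem applies once in each direction, first in i and then in j.\<close>

lemma rectangle_MVT:
  assumes f: "C_diff k (Suc (Suc n)) f" and x: "x \<in> Rn k" and ij: "i < k" "j < k" "i \<noteq> j" and h: "h > 0"
  obtains a b where "f (x(i := x i + h, j := x j + h)) - f (x(i := x i + h)) - f (x(j := x j + h)) + f x
      = h * h * partial j (partial i f) (x(i := x i + a, j := x j + b))" "0 < a" "a < h" "0 < b" "b < h"
proof -
  have f1: "C_diff k (Suc n) (partial i f)" using C_diff_partial[OF f ij(1)] .
  let ?p = "\<lambda>u. f (x(j := x j + h, i := u)) - f (x(i := u))"
  have "(?p has_real_derivative partial i f (x(j := x j + h, i := u)) - partial i f (x(i := u))) (at u)" for u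
    by (intro DERIV_diff partial_has_derivative[OF f] Rn_upd x ij)
  then obtain u where u: "x i < u" "u < x i + h" "?p (x i + h) - ?p (x i)
     = h * (partial i f (x(j := x j + h, i := u)) - partial i f (x(i := u)))"
    using MVT2[of "x i" "x i + h" ?p "\<lambda>u. partial i f (x(j := x j + h, i := u)) - partial i f (x(i := u))"] h
    by auto
  let ?q = "\<lambda>v. partial i f (x(i := u, j := v))"
  have "(?q has_real_derivative partial j (partial i f) (x(i := u, j := v))) (at v)" for v
    by (intro partial_has_derivative[OF f1] Rn_upd x ij)
  then obtain v where v: "x j < v" "v < x j + h" "?q (x j + h) - ?q (x j)
     = h * partial j (partial i f) (x(i := u, j := v))"
    using MVT2[of "x j" "x j + h" ?q "\<lambda>v. partial j (partial i f) (x(i := u, j := v))"] h by auto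
  have e: "x(j := x j + h, i := w) = x(i := w, j := x j + h)" "x(i := w, j := x j) = x(i := w)"
      "x(j := x j + h, i := x i) = x(j := x j + h)" for w
    using ij by (auto simp: fun_eq_iff)
  have "?p (x i + h) - ?p (x i) = h * h * partial j (partial i f) (x(i := u, j := v))"
    using u(3) v(3) by (simp add: e)
  then show ?thesis
    using that[of "u - x i" "v - x j"] u v ij by (simp add: e)
qed

text \<open>The second difference is symmetric in i and j. Hence it yields equal values of the two
  mixed derivatives at points within h of x, and continuity lets h tend to 0.\<close>

lemma partial_commute:
  assumes f: "C_diff k (Suc (Suc n)) f" and x: "x \<in> Rn k" and ij: "i < k" "j < k"
  shows "partial i (partial j f) x = partial j (partial i f) x"
proof (cases "i = j")
  case False
  have "\<exists>p q. partial j (partial i f) p = partial i (partial j f) q \<and> p \<in> Rn k \<and> q \<in> Rn k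
      \<and> (\<forall>l. \<bar>p l - x l\<bar> \<le> h \<and> \<bar>q l - x l\<bar> \<le> h)" if h: "h > 0" for h
  proof -
    obtain a b where ab: "f (x(i := x i + h, j := x j + h)) - f (x(i := x i + h)) - f (x(j := x j + h)) + f x
      = h * h * partial j (partial i f) (x(i := x i + a, j := x j + b))" "0 < a" "a < h" "0 < b" "b < h"
      by (rule rectangle_MVT[OF f x ij False h])
    obtain a' b' where ab': "f (x(j := x j + h, i := x i + h)) - f (x(j := x j + h)) - f (x(i := x i + h)) + f x
      = h * h * partial i (partial j f) (x(j := x j + a', i := x i + b'))" "0 < a'" "a' < h" "0 < b'" "b' < h"
      by (rule rectangle_MVT[OF f x ij(2,1) False[symmetric] h])
    have "h * h * partial j (partial i f) (x(i := x i + a, j := x j + b))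
       = h * h * partial i (partial j f) (x(j := x j + a', i := x i + b'))"
      using ab(1) ab'(1) unfolding fun_upd_twist[OF False, of x "x i + h" "x j + h"] by linarith
    then have "partial j (partial i f) (x(i := x i + a, j := x j + b))
       = partial i (partial j f) (x(j := x j + a', i := x i + b'))" using h by simp
    then show ?thesis using ab ab' x ij False
      by (intro exI[of _ "x(i := x i + a, j := x j + b)"] exI[of _ "x(j := x j + a', i := x i + b')"])
        (auto simp: Rn_upd)
  qed
  then have "\<forall>m. \<exists>p q. partial j (partial i f) p = partial i (partial j f) q \<and> p \<in> Rn k \<and> q \<in> Rn k
      \<and> (\<forall>l. \<bar>p l - x l\<bar> \<le> inverse (real (Suc m)) \<and> \<bar>q l - x l\<bar> \<le> inverse (real (Suc m)))"
    by simp
  then obtain p q where pq: "\<And>m. partial j (partial i f) (p m) = partial i (partial j f) (q m)"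
      "\<And>m. p m \<in> Rn k" "\<And>m. q m \<in> Rn k"
      "\<And>m l. \<bar>p m l - x l\<bar> \<le> inverse (real (Suc m))" "\<And>m l. \<bar>q m l - x l\<bar> \<le> inverse (real (Suc m))"
    by metis
  have lim: "(\<lambda>m. r m l) \<longlonglongrightarrow> x l" if "\<And>m. \<bar>r m l - x l\<bar> \<le> inverse (real (Suc m))" for r :: "nat \<Rightarrow> nat \<Rightarrow> real" and l
  proof -
    have "(\<lambda>m. r m l - x l) \<longlonglongrightarrow> 0"
      by (rule Lim_null_comparison[OF _ LIMSEQ_inverse_real_of_nat]) (use that in auto)
    then show ?thesis using Lim_null by blast
  qed
  have cont: "continuous_on (Rn k) (partial a (partial b f))" if "a < k" "b < k" for a b
    using f that by (intro C_diff_continuous_on[of _ n]) simp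
  have "(\<lambda>m. partial j (partial i f) (p m)) \<longlonglongrightarrow> partial j (partial i f) x"
    by (rule tendsto_continuous_on_Rn[OF cont[OF ij(2,1)] x always_eventually lim]) (use pq(2,4) in blast)+
  moreover have "(\<lambda>m. partial i (partial j f) (q m)) \<longlonglongrightarrow> partial i (partial j f) x"
    by (rule tendsto_continuous_on_Rn[OF cont[OF ij] x always_eventually lim]) (use pq(3,5) in blast)+
  ultimately show ?thesis unfolding pq(1) by (metis LIMSEQ_unique)
qed simp

lemma partial_cong_Rn:
  assumes "\<And>x. x \<in> Rn k \<Longrightarrow> f x = g x" "x \<in> Rn k" "i < k"
  shows "partial i f x = partial i g x"
  using assms Rn_upd[OF assms(2,3)] by (simp add: partial_def)

text \<open>Repeated transposition of neighbours; the bound on the lengths leaves two orders of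
  differentiability for every transposition.\<close>

lemma foldr_partial_insert:
  assumes "C_diff k n f" "set is \<subseteq> {..<k}" "set js \<subseteq> {..<k}" "i < k" "length is + length js < n" "x \<in> Rn k"
  shows "foldr partial (is @ i # js) f x = foldr partial (i # is @ js) f x"
  using assms
proof (induction "is" arbitrary: x)
  case (Cons a "is")
  have len: "length (is @ js) \<le> n" and sub: "set (is @ js) \<subseteq> {..<k}" using Cons.prems by auto
  have "n - length (is @ js) = Suc (Suc (n - length (is @ js) - 2))" using Cons.prems by simp
  then have C: "C_diff k (Suc (Suc (n - length (is @ js) - 2))) (foldr partial (is @ js) f)"
    using C_diff_foldr[OF Cons.prems(1) sub len] by simp
  have "foldr partial ((a # is) @ i # js) f x = partial a (foldr partial (i # is @ js) f) x"
    unfolding append_Cons foldr.simps comp_def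
    using Cons.prems by (intro partial_cong_Rn[of k] Cons.IH[unfolded foldr.simps comp_def]) auto
  also have "\<dots> = partial i (partial a (foldr partial (is @ js) f)) x"
    using partial_commute[OF C Cons.prems(6), of a i] Cons.prems by auto
  finally show ?case by simp
qed simp

lemma foldr_partial_perm:
  assumes "C_diff k n f" "mset is = mset js" "set is \<subseteq> {..<k}" "length is \<le> n" "x \<in> Rn k"
  shows "foldr partial is f x = foldr partial js f x"
  using assms
proof (induction "is" arbitrary: js x)
  case (Cons i "is")
  have "i \<in> set js" by (metis Cons.prems(2) list.set_intros(1) set_mset_mset)
  then obtain as bs where js: "js = as @ i # bs" by (meson split_list)
  have m: "mset is = mset (as @ bs)" using Cons.prems(2) js by simp
  have s: "set (as @ bs) \<subseteq> {..<k}" "length as + length bs < n"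
    using m Cons.prems(3,4) mset_eq_setD[OF m] mset_eq_length[OF m] by auto
  have "foldr partial (i # is) f x = partial i (foldr partial (as @ bs) f) x"
    unfolding foldr.simps comp_def using Cons.prems m
    by (intro partial_cong_Rn[of k] Cons.IH) auto
  also have "\<dots> = foldr partial js f x"
    using foldr_partial_insert[OF Cons.prems(1), of as bs i x] s Cons.prems js by auto
  finally show ?case .
qed simp

lemma foldr_funpow_replicate: "foldr (\<lambda>i. g i ^^ \<beta> i) xs = foldr g (concat (map (\<lambda>i. replicate (\<beta> i) i) xs))"
proof -
  have "foldr g (replicate n i) = g i ^^ n" for n i
    by (induction n) auto
  then show ?thesis by (induction xs) (auto simp: fun_eq_iff)
qed

text \<open>The assumptions on \<sigma> speak of multi-indices, the Taylor polynomials of lists of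
  directions. The multi-index counts the occurrences in the list, and a single entry is dominated by
  the Frobenius norm.\<close>

lemma coeff_deriv_foldr_le:
  assumes "C_diff k N (\<lambda>x. \<sigma> \<mu> x i)" "\<mu> \<in> {1..d}" "i < k" "set is \<subseteq> {..<k}" "length is \<le> N" "x \<in> Rn k"
  obtains \<beta> where "mi_order k \<beta> = length is"
    "\<bar>foldr partial is (\<lambda>x. \<sigma> \<mu> x i) x\<bar> \<le> coeff_deriv_norm d k \<sigma> \<beta> x"
proof
  define \<beta> where "\<beta> j = count_list is j" for j
  show "mi_order k \<beta> = length is"
    unfolding mi_order_def \<beta>_def using assms(4) sum_count_set[of "is" "{..<k}"] by simp
  let ?js = "concat (map (\<lambda>i. replicate (\<beta> i) i) [0..<k])"
  have "count (mset ?js) a = count (mset is) a" for a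
  proof -
    have "count (mset (concat (map (\<lambda>i. replicate (\<beta> i) i) [0..<n]))) a = (if a < n then \<beta> a else 0)" for n
      by (induction n) (auto simp: less_Suc_eq)
    moreover have "\<beta> a = 0" if "\<not> a < k" using that assms(4) by (auto simp: \<beta>_def count_list_0_iff)
    ultimately show ?thesis by (simp add: \<beta>_def count_mset)
  qed
  then have "mset is = mset ?js" by (simp add: multiset_eq_iff)
  then have "foldr partial is (\<lambda>x. \<sigma> \<mu> x i) x = mi_partial k \<beta> (\<lambda>x. \<sigma> \<mu> x i) x"
    unfolding mi_partial_def foldr_funpow_replicate using assms by (intro foldr_partial_perm) auto
  then show "\<bar>foldr partial is (\<lambda>x. \<sigma> \<mu> x i) x\<bar> \<le> coeff_deriv_norm d k \<sigma> \<beta> x"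
  proof -
    have "\<bar>mi_partial k \<beta> (\<lambda>x. \<sigma> \<mu> x i) x\<bar>\<^sup>2 \<le> (\<Sum>p\<in>{..<k} \<times> {1..d}. (case p of (i, \<mu>) \<Rightarrow> mi_partial k \<beta> (\<lambda>y. \<sigma> \<mu> y i) x)\<^sup>2)"
      using assms member_le_sum[of "(i, \<mu>)" "{..<k} \<times> {1..d}" "\<lambda>p. (case p of (i, \<mu>) \<Rightarrow> mi_partial k \<beta> (\<lambda>y. \<sigma> \<mu> y i) x)\<^sup>2"]
      by auto
    then show ?thesis unfolding \<open>foldr partial is _ x = _\<close> coeff_deriv_norm_def L2_set_def
      by (intro real_le_rsqrt) auto
  qed
qed

section \<open>Forests: linear extension, weighted norms and the action of characters\<close>

lemma lookup_fscale [simp]: "Poly_Mapping.lookup (fscale c p) x = c * Poly_Mapping.lookup p x"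
  unfolding fscale_def by transfer (simp add: when_def)

lemma fscale_simps [simp]:
  "fscale 0 p = 0" "fscale c 0 = 0" "fscale 1 p = p" "fscale b (fscale c p) = fscale (b * c) p"
  by (rule poly_mapping_eqI; simp)+

lemma fscale_distribs:
  "fscale (b + c) p = fscale b p + fscale c p" "fscale c (p + q) = fscale c p + fscale c q"
  "fscale (b - c) p = fscale b p - fscale c p" "fscale c (p - q) = fscale c p - fscale c q"
  "fscale (- c) p = - fscale c p"
  by (rule poly_mapping_eqI; simp add: lookup_add lookup_minus algebra_simps)+

lemma fscale_sum: "fscale c (\<Sum>i\<in>I. p i) = (\<Sum>i\<in>I. fscale c (p i))"
  by (rule poly_mapping_eqI) (simp add: lookup_sum sum_distrib_left)

lemma fscale_sum_left: "fscale (\<Sum>i\<in>I. c i) p = (\<Sum>i\<in>I. fscale (c i) p)"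
  by (rule poly_mapping_eqI) (simp add: lookup_sum sum_distrib_right)

lemma fscale_conv_mult: "fscale c p = Poly_Mapping.single 0 c * p"
  unfolding fscale_def by (rule mult_map_scale_conv_mult)

lemma fscale_mult_left: "fscale c p * q = fscale c (p * q)"
  by (simp add: fscale_conv_mult mult.assoc)

lemma fscale_mult_right:
  fixes p q :: "'a::comm_monoid_add \<Rightarrow>\<^sub>0 real"
  shows "p * fscale c q = fscale c (p * q)"
  by (simp add: fscale_conv_mult mult_ac)

lemma basis_mult: "basis x * basis y = basis (x + y)"
  by (simp add: basis_def mult_single)

lemma basis_zero: "basis 0 = 1"
  by (simp add: basis_def)

lemma basis_empty: "basis {#} = 1"
  using basis_zero[where ?'a = "'a multiset"] by simp

lemma keys_basis [simp]: "Poly_Mapping.keys (basis x) = {x}"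
  by (simp add: basis_def)

lemma lookup_basis: "Poly_Mapping.lookup (basis x) y = (if x = y then 1 else 0)"
  by (simp add: basis_def lookup_single when_def)

lemma keys_fscale: "Poly_Mapping.keys (fscale c p) \<subseteq> Poly_Mapping.keys p"
  by (auto simp: in_keys_iff)

definition pairing :: "('a \<Rightarrow> real) \<Rightarrow> ('a \<Rightarrow>\<^sub>0 real) \<Rightarrow> real" where
  "pairing b a = (\<Sum>x\<in>Poly_Mapping.keys a. Poly_Mapping.lookup a x * b x)"

definition linext :: "('a \<Rightarrow> 'b \<Rightarrow>\<^sub>0 real) \<Rightarrow> ('a \<Rightarrow>\<^sub>0 real) \<Rightarrow> 'b \<Rightarrow>\<^sub>0 real" where
  "linext F a = (\<Sum>x\<in>Poly_Mapping.keys a. fscale (Poly_Mapping.lookup a x) (F x))"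

lemma pairing_superset:
  assumes "finite S" "Poly_Mapping.keys a \<subseteq> S"
  shows "pairing b a = (\<Sum>x\<in>S. Poly_Mapping.lookup a x * b x)"
  unfolding pairing_def using assms
  by (intro sum.mono_neutral_left) (auto simp: in_keys_iff)

lemma pairing_add: "pairing b (p + q) = pairing b p + pairing b q"
proof -
  let ?S = "Poly_Mapping.keys p \<union> Poly_Mapping.keys q"
  have "finite ?S" "Poly_Mapping.keys (p + q) \<subseteq> ?S" by (auto simp: keys_add)
  then show ?thesis
    by (simp add: pairing_superset[of ?S] lookup_add algebra_simps sum.distrib)
qed

lemma pairing_zero [simp]: "pairing b 0 = 0"
  by (simp add: pairing_def)

lemma pairing_fscale: "pairing b (fscale c p) = c * pairing b p"
  by (subst pairing_superset[OF finite_keys keys_fscale]) (simp add: pairing_def sum_distrib_left mult_ac)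

lemma pairing_diff: "pairing b (p - q) = pairing b p - pairing b q"
  using pairing_add[of b "p - q" q] by simp

lemma pairing_sum: "pairing b (\<Sum>i\<in>I. p i) = (\<Sum>i\<in>I. pairing b (p i))"
  by (induction I rule: infinite_finite_induct) (simp_all add: pairing_add)

lemma pairing_basis [simp]: "pairing b (basis x) = b x"
  by (simp add: pairing_def lookup_basis)

lemma pairing_cong: "(\<And>x. x \<in> Poly_Mapping.keys a \<Longrightarrow> b x = c x) \<Longrightarrow> pairing b a = pairing c a"
  by (simp add: pairing_def)

lemma pairing_linext: "pairing b (linext F a) = pairing (\<lambda>x. pairing b (F x)) a"
  by (simp add: linext_def pairing_sum pairing_fscale) (simp add: pairing_def)

lemma lookup_conv_pairing: "Poly_Mapping.lookup a x = pairing (\<lambda>y. if y = x then 1 else 0) a"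
proof -
  have "pairing (\<lambda>y. if y = x then 1 else 0) a = (\<Sum>y\<in>insert x (Poly_Mapping.keys a). Poly_Mapping.lookup a y * (if y = x then 1 else 0))"
    by (rule pairing_superset) auto
  also have "\<dots> = Poly_Mapping.lookup a x"
    by (simp add: if_distrib cong: if_cong)
  finally show ?thesis by simp
qed

lemma lookup_linext: "Poly_Mapping.lookup (linext F a) y = pairing (\<lambda>x. Poly_Mapping.lookup (F x) y) a"
  by (simp add: linext_def lookup_sum pairing_def)

lemma linext_add: "linext F (p + q) = linext F p + linext F q"
  by (rule poly_mapping_eqI) (simp add: lookup_linext lookup_add pairing_add)

lemma linext_diff: "linext F (p - q) = linext F p - linext F q"
  by (rule poly_mapping_eqI) (simp add: lookup_linext lookup_minus pairing_diff)

lemma linext_fscale: "linext F (fscale c p) = fscale c (linext F p)"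
  by (rule poly_mapping_eqI) (simp add: lookup_linext pairing_fscale)

lemma linext_sum: "linext F (\<Sum>i\<in>I. p i) = (\<Sum>i\<in>I. linext F (p i))"
  by (rule poly_mapping_eqI) (simp add: lookup_linext lookup_sum pairing_sum)

lemma linext_basis [simp]: "linext F (basis x) = F x"
  by (rule poly_mapping_eqI) (simp add: lookup_linext)

lemma linext_cong: "(\<And>x. x \<in> Poly_Mapping.keys a \<Longrightarrow> F x = G x) \<Longrightarrow> linext F a = linext G a"
  by (simp add: linext_def)

lemma linext_linext: "linext F (linext G a) = linext (\<lambda>x. linext F (G x)) a"
  by (simp add: linext_def[of G] linext_sum linext_fscale) (simp add: linext_def)

lemma linext_basis_id: "linext basis a = a"
  by (rule poly_mapping_eqI) (simp add: lookup_linext lookup_conv_pairing[of a] lookup_basis)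

lemma mult_expand:
  "p * q = (\<Sum>x\<in>Poly_Mapping.keys p. \<Sum>y\<in>Poly_Mapping.keys q.
      fscale (Poly_Mapping.lookup p x * Poly_Mapping.lookup q y) (basis (x + y)))"
  for p q :: "'a::comm_monoid_add \<Rightarrow>\<^sub>0 real"
proof -
  have "p * q = linext basis p * linext basis q" by (simp add: linext_basis_id)
  also have "\<dots> = (\<Sum>x\<in>Poly_Mapping.keys p. \<Sum>y\<in>Poly_Mapping.keys q.
      fscale (Poly_Mapping.lookup p x * Poly_Mapping.lookup q y) (basis (x + y)))"
    by (simp add: linext_def sum_product fscale_mult_left fscale_mult_right basis_mult mult.commute)
  finally show ?thesis .
qed

text \<open>Universal property of the monoid algebra: a multiplicative map on the monoid extends to
  a multiplicative linear map.\<close>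

lemma linext_mult:
  fixes p q :: "'a::comm_monoid_add \<Rightarrow>\<^sub>0 real" and F :: "'a \<Rightarrow> 'b::comm_monoid_add \<Rightarrow>\<^sub>0 real"
  assumes "\<And>x y. F (x + y) = F x * F y"
  shows "linext F (p * q) = linext F p * linext F q"
  by (simp add: mult_expand[of p q] linext_sum linext_fscale)
    (simp add: linext_def sum_product fscale_mult_left fscale_mult_right assms mult.commute)

lemma linext_one:
  fixes F :: "'a::comm_monoid_add \<Rightarrow> 'b::comm_monoid_add \<Rightarrow>\<^sub>0 real"
  assumes "F 0 = 1" shows "linext F 1 = 1"
  using assms by (simp flip: basis_zero)

lemma linext_prod_mset:
  fixes F :: "'a::comm_monoid_add \<Rightarrow> 'b::comm_monoid_add \<Rightarrow>\<^sub>0 real"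
  assumes "F 0 = 1" "\<And>x y. F (x + y) = F x * F y"
  shows "linext F (\<Prod>t\<in>#f. p t) = (\<Prod>t\<in>#f. linext F (p t))"
  by (induction f) (simp_all add: linext_one assms linext_mult)

lemma fverts_simps [simp]:
  "fverts {#} = 0" "fverts (f + g) = fverts f + fverts g" "fverts (add_mset t f) = verts t + fverts f"
  by (simp_all add: fverts_def)

lemma verts_Node: "verts (Node \<mu> f) = Suc (fverts f)"
  by (simp add: fverts_def)

declare verts.simps [simp del] verts_Node [simp]

lemma verts_le_fverts: "t \<in># f \<Longrightarrow> verts t \<le> fverts f"
  by (metis fverts_simps(3) le_add1 multi_member_split)

section \<open>The weighted norm and coordinate projections\<close>

definition nrm :: "real \<Rightarrow> ('a rtree multiset \<Rightarrow>\<^sub>0 real) \<Rightarrow> real" where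
  "nrm w a = (\<Sum>x\<in>Poly_Mapping.keys a. \<bar>Poly_Mapping.lookup a x\<bar> * w ^ fverts x)"

lemma nrm_superset:
  assumes "finite S" "Poly_Mapping.keys a \<subseteq> S"
  shows "nrm w a = (\<Sum>x\<in>S. \<bar>Poly_Mapping.lookup a x\<bar> * w ^ fverts x)"
  unfolding nrm_def using assms
  by (intro sum.mono_neutral_left) (auto simp: in_keys_iff)

lemma nrm_nonneg: "0 \<le> w \<Longrightarrow> 0 \<le> nrm w a"
  by (simp add: nrm_def sum_nonneg)

lemma nrm_zero [simp]: "nrm w 0 = 0"
  by (simp add: nrm_def)

lemma nrm_triangle:
  assumes "0 \<le> w" shows "nrm w (p + q) \<le> nrm w p + nrm w q"
proof -
  let ?S = "Poly_Mapping.keys p \<union> Poly_Mapping.keys q"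
  have "finite ?S" "Poly_Mapping.keys (p + q) \<subseteq> ?S" by (auto simp: keys_add)
  then show ?thesis using assms
    by (simp add: nrm_superset[of ?S] lookup_add flip: sum.distrib distrib_right)
      (intro sum_mono mult_right_mono, auto)
qed

lemma nrm_fscale: "nrm w (fscale c p) = \<bar>c\<bar> * nrm w p"
  by (subst nrm_superset[OF finite_keys keys_fscale]) (simp add: nrm_def abs_mult sum_distrib_left mult_ac)

lemma nrm_diff:
  assumes "0 \<le> w" shows "nrm w (p - q) \<le> nrm w p + nrm w q"
  using nrm_triangle[OF assms, of p "fscale (-1) q"] nrm_fscale[of w "-1" q] by (simp add: fscale_distribs)

lemma nrm_sum: "0 \<le> w \<Longrightarrow> nrm w (\<Sum>i\<in>I. p i) \<le> (\<Sum>i\<in>I. nrm w (p i))"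
  by (induction I rule: infinite_finite_induct) (auto intro: order_trans[OF nrm_triangle])

lemma nrm_sum_le:
  assumes "0 \<le> w" "\<And>i. i \<in> I \<Longrightarrow> nrm w (p i) \<le> K"
  shows "nrm w (\<Sum>i\<in>I. p i) \<le> real (card I) * K"
  using nrm_sum[OF assms(1), of p I] sum_bounded_above[of I "\<lambda>i. nrm w (p i)" K] assms(2) by force

lemma nrm_basis [simp]: "nrm w (basis x) = w ^ fverts x"
  by (simp add: nrm_def lookup_basis)

lemma nrm_one [simp]: "nrm w 1 = 1"
  unfolding basis_empty[symmetric] nrm_basis by simp

lemma nrm_linext:
  assumes "0 \<le> w" "\<And>x. x \<in> Poly_Mapping.keys a \<Longrightarrow> nrm w (F x) \<le> K * v ^ fverts x"
  shows "nrm w (linext F a) \<le> K * nrm v a"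
proof -
  have "nrm w (linext F a) \<le> (\<Sum>x\<in>Poly_Mapping.keys a. nrm w (fscale (Poly_Mapping.lookup a x) (F x)))"
    unfolding linext_def by (rule nrm_sum[OF assms(1)])
  also have "\<dots> \<le> (\<Sum>x\<in>Poly_Mapping.keys a. \<bar>Poly_Mapping.lookup a x\<bar> * (K * v ^ fverts x))"
    by (intro sum_mono) (simp add: nrm_fscale assms(2) mult_left_mono)
  also have "\<dots> = K * nrm v a" by (simp add: nrm_def sum_distrib_left mult_ac)
  finally show ?thesis .
qed

lemma nrm_mult:
  assumes "0 \<le> w" shows "nrm w (p * q) \<le> nrm w p * nrm w q"
proof -
  have "nrm w (p * q) \<le> (\<Sum>x\<in>Poly_Mapping.keys p. \<Sum>y\<in>Poly_Mapping.keys q.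
      nrm w (fscale (Poly_Mapping.lookup p x * Poly_Mapping.lookup q y) (basis (x + y))))"
    unfolding mult_expand[of p q]
    by (intro order_trans[OF nrm_sum[OF assms]] sum_mono order_refl)
  also have "\<dots> = nrm w p * nrm w q"
    by (simp add: nrm_fscale abs_mult power_add) (simp add: nrm_def sum_product mult_ac)
  finally show ?thesis .
qed

lemma nrm_prod_mset:
  assumes "0 \<le> w" "\<And>t. t \<in># f \<Longrightarrow> nrm w (p t) \<le> v ^ verts t" "0 \<le> v"
  shows "nrm w (\<Prod>t\<in>#f. p t) \<le> v ^ fverts f"
  using assms(2)
proof (induction f)
  case (add t f)
  have "nrm w (p t * (\<Prod>t\<in>#f. p t)) \<le> v ^ verts t * v ^ fverts f"
    using add assms by (intro order_trans[OF nrm_mult] mult_mono) (auto intro: nrm_nonneg)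
  then show ?case by (simp add: power_add)
qed simp

lemma pairing_le:
  assumes "\<And>x. x \<in> Poly_Mapping.keys a \<Longrightarrow> \<bar>b x\<bar> \<le> K * w ^ fverts x"
  shows "\<bar>pairing b a\<bar> \<le> K * nrm w a"
proof -
  have "\<bar>pairing b a\<bar> \<le> (\<Sum>x\<in>Poly_Mapping.keys a. \<bar>Poly_Mapping.lookup a x * b x\<bar>)"
    unfolding pairing_def by (rule sum_abs)
  also have "\<dots> \<le> (\<Sum>x\<in>Poly_Mapping.keys a. \<bar>Poly_Mapping.lookup a x\<bar> * (K * w ^ fverts x))"
    by (intro sum_mono) (simp add: abs_mult assms mult_left_mono)
  also have "\<dots> = K * nrm w a" by (simp add: nrm_def sum_distrib_left mult_ac)
  finally show ?thesis .
qed

lemma nrm_mono: "0 \<le> w \<Longrightarrow> w \<le> v \<Longrightarrow> nrm w a \<le> nrm v a"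
  unfolding nrm_def by (intro sum_mono mult_left_mono power_mono) auto

text \<open>Source of the powers of the time increment: without forests of fewer than n vertices,
  shrinking the weight by l gains at least l ^ n.\<close>

lemma nrm_scale:
  assumes "0 \<le> l" "l \<le> 1" "0 \<le> w" "\<And>x. x \<in> Poly_Mapping.keys a \<Longrightarrow> n \<le> fverts x"
  shows "nrm (l * w) a \<le> l ^ n * nrm w a"
proof -
  have "nrm (l * w) a \<le> (\<Sum>x\<in>Poly_Mapping.keys a. l ^ n * (\<bar>Poly_Mapping.lookup a x\<bar> * w ^ fverts x))"
    unfolding nrm_def
  proof (intro sum_mono)
    fix x assume "x \<in> Poly_Mapping.keys a"
    then have "l ^ fverts x \<le> l ^ n" using assms by (intro power_decreasing) auto
    then have "\<bar>Poly_Mapping.lookup a x\<bar> * w ^ fverts x * l ^ fverts x \<le> \<bar>Poly_Mapping.lookup a x\<bar> * w ^ fverts x * l ^ n"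
      using assms by (intro mult_left_mono) auto
    then show "\<bar>Poly_Mapping.lookup a x\<bar> * (l * w) ^ fverts x \<le> l ^ n * (\<bar>Poly_Mapping.lookup a x\<bar> * w ^ fverts x)"
      by (simp add: power_mult_distrib mult_ac)
  qed
  then show ?thesis by (simp add: nrm_def sum_distrib_left)
qed

lemma lookup_le_nrm: "0 \<le> w \<Longrightarrow> \<bar>Poly_Mapping.lookup a {#}\<bar> \<le> nrm w a"
proof -
  assume w: "0 \<le> w"
  have "\<bar>Poly_Mapping.lookup a {#}\<bar> * w ^ fverts ({#} :: 'a rtree multiset)
     \<le> (\<Sum>x\<in>insert {#} (Poly_Mapping.keys a). \<bar>Poly_Mapping.lookup a x\<bar> * w ^ fverts x)"
    using w by (intro member_le_sum) auto
  also have "\<dots> = nrm w a" by (rule nrm_superset[symmetric]) auto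
  finally show ?thesis by simp
qed

definition restr :: "('a \<Rightarrow> bool) \<Rightarrow> ('a \<Rightarrow>\<^sub>0 real) \<Rightarrow> 'a \<Rightarrow>\<^sub>0 real" where
  "restr P a = linext (\<lambda>x. if P x then basis x else 0) a"

lemma lookup_restr: "Poly_Mapping.lookup (restr P a) x = (if P x then Poly_Mapping.lookup a x else 0)"
proof -
  have "Poly_Mapping.lookup (restr P a) x = pairing (\<lambda>y. (if y = x then 1 else 0) * (if P x then 1 else 0)) a"
    unfolding restr_def lookup_linext by (rule pairing_cong) (auto simp: lookup_basis)
  also have "\<dots> = (if P x then 1 else 0) * pairing (\<lambda>y. if y = x then 1 else 0) a"
    unfolding pairing_def sum_distrib_left by (intro sum.cong) auto
  finally show ?thesis by (simp add: lookup_conv_pairing[symmetric])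
qed

lemma keys_restr: "Poly_Mapping.keys (restr P a) = {x \<in> Poly_Mapping.keys a. P x}"
  by (auto simp: in_keys_iff lookup_restr split: if_splits)

lemma nrm_restr: "0 \<le> w \<Longrightarrow> nrm w (restr P a) \<le> nrm w a"
  unfolding nrm_def keys_restr
  by (rule order_trans[OF _ sum_mono2[of _ "{x \<in> Poly_Mapping.keys a. P x}"]])
    (auto simp: lookup_restr)

lemma nrm_diff_restr: "0 \<le> w \<Longrightarrow> nrm w (a - restr P a) \<le> nrm w a"
proof -
  have "a - restr P a = restr (\<lambda>x. \<not> P x) a"
    by (rule poly_mapping_eqI) (simp add: lookup_minus lookup_restr)
  then show "0 \<le> w \<Longrightarrow> nrm w (a - restr P a) \<le> nrm w a" by (simp add: nrm_restr)
qed

lemma trunc_conv_restr: "trunc n p = restr (\<lambda>f. fverts f \<le> n) p"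
proof -
  have "trunc n p = (\<Sum>f\<in>Poly_Mapping.keys p. if fverts f \<le> n then fscale (Poly_Mapping.lookup p f) (basis f) else 0)"
    unfolding trunc_def by (simp add: sum.inter_filter)
  also have "\<dots> = restr (\<lambda>f. fverts f \<le> n) p"
    unfolding restr_def linext_def by (intro sum.cong) auto
  finally show ?thesis .
qed

section \<open>Grafting and the algebra homomorphism \<open>gamma\<close>\<close>

definition graft :: "'a \<Rightarrow> ('a rtree multiset \<Rightarrow>\<^sub>0 real) \<Rightarrow> 'a rtree multiset \<Rightarrow>\<^sub>0 real" where
  "graft \<mu> = linext (\<lambda>f. basis {#Node \<mu> f#})"

lemma nrm_graft: "0 \<le> w \<Longrightarrow> nrm w (graft \<mu> a) \<le> w * nrm w a"
  unfolding graft_def by (rule nrm_linext) auto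

lemma lookup_graft_empty [simp]: "Poly_Mapping.lookup (graft \<mu> a) {#} = 0"
  by (simp add: graft_def lookup_linext lookup_basis pairing_def)

text \<open>The recursion of the coproduct of a tree with \<xi> already applied to the left factor,
  so that no norm on a tensor product is needed.\<close>

primrec gamma_tree :: "('a rtree multiset \<Rightarrow> real) \<Rightarrow> 'a rtree \<Rightarrow> 'a rtree multiset \<Rightarrow>\<^sub>0 real" where
  "gamma_tree \<xi> (Node \<mu> f) = fscale (\<xi> {#Node \<mu> f#}) 1 + graft \<mu> (prod_mset (image_mset (gamma_tree \<xi>) f))"

definition gamma :: "('a rtree multiset \<Rightarrow> real) \<Rightarrow> ('a rtree multiset \<Rightarrow>\<^sub>0 real) \<Rightarrow> 'a rtree multiset \<Rightarrow>\<^sub>0 real" where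
  "gamma \<xi> = linext (\<lambda>f. \<Prod>t\<in>#f. gamma_tree \<xi> t)"

lemma gamma_mult: "gamma \<xi> (p * q) = gamma \<xi> p * gamma \<xi> q"
  unfolding gamma_def by (rule linext_mult) simp

lemma gamma_one [simp]: "gamma \<xi> 1 = 1"
  unfolding gamma_def by (rule linext_one) simp

lemmas gamma_add = linext_add[of "\<lambda>f. \<Prod>t\<in>#f. gamma_tree \<xi> t" for \<xi>, folded gamma_def]
lemmas gamma_diff = linext_diff[of "\<lambda>f. \<Prod>t\<in>#f. gamma_tree \<xi> t" for \<xi>, folded gamma_def]
lemmas gamma_sum = linext_sum[of "\<lambda>f. \<Prod>t\<in>#f. gamma_tree \<xi> t" for \<xi>, folded gamma_def]
lemmas gamma_fscale = linext_fscale[of "\<lambda>f. \<Prod>t\<in>#f. gamma_tree \<xi> t" for \<xi>, folded gamma_def]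

lemmas graft_diff = linext_diff[of "\<lambda>f. basis {#Node \<mu> f#}" for \<mu>, folded graft_def]

text \<open>Linear form of the cocycle identity of the coproduct: either the whole tree is cut off,
  or the root is kept.\<close>

lemma gamma_graft:
  "gamma \<xi> (graft \<mu> a) = fscale (pairing (\<lambda>f. \<xi> {#Node \<mu> f#}) a) 1 + graft \<mu> (gamma \<xi> a)"
proof -
  have "gamma \<xi> (graft \<mu> a) = linext (\<lambda>f. gamma_tree \<xi> (Node \<mu> f)) a"
    by (simp add: gamma_def graft_def linext_linext)
  also have "\<dots> = linext (\<lambda>f. fscale (\<xi> {#Node \<mu> f#}) 1) a + graft \<mu> (gamma \<xi> a)"
    by (simp add: linext_def fscale_distribs sum.distrib)
      (simp add: gamma_def linext_linext graft_def, simp add: linext_def)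
  also have "linext (\<lambda>f. fscale (\<xi> {#Node \<mu> f#}) 1) a = fscale (pairing (\<lambda>f. \<xi> {#Node \<mu> f#}) a) 1"
    by (simp add: linext_def pairing_def fscale_sum_left)
  finally show ?thesis .
qed

text \<open>The factor 2 per vertex pays for the number of cuts: for a tree with n + 1 vertices the
  recursion gives (1 + 2 ^ n) w ^ (n + 1), and 1 + 2 ^ n \<le> 2 ^ (n + 1).\<close>

lemma nrm_gamma_tree:
  assumes w: "0 \<le> w" and \<xi>: "\<And>f. \<bar>\<xi> f\<bar> \<le> w ^ fverts f"
  shows "nrm w (gamma_tree \<xi> t) \<le> (2 * w) ^ verts t"
proof (induction t)
  case (Node \<mu> f)
  have "nrm w (gamma_tree \<xi> (Node \<mu> f)) \<le> w ^ Suc (fverts f) + w * (2 * w) ^ fverts f"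
    unfolding gamma_tree.simps
    using \<xi>[of "{#Node \<mu> f#}"] Node w
    by (intro order_trans[OF nrm_triangle] add_mono order_trans[OF nrm_graft] mult_left_mono nrm_prod_mset)
      (simp_all add: nrm_fscale)
  also have "\<dots> = (1 + 2 ^ fverts f) * w ^ Suc (fverts f)"
    by (simp add: power_mult_distrib algebra_simps)
  also have "\<dots> \<le> 2 ^ Suc (fverts f) * w ^ Suc (fverts f)"
    using w by (intro mult_right_mono) auto
  finally show ?case by (simp add: power_mult_distrib mult_ac)
qed

lemma nrm_gamma:
  assumes "0 \<le> w" "\<And>f. \<bar>\<xi> f\<bar> \<le> w ^ fverts f"
  shows "nrm w (gamma \<xi> a) \<le> nrm (2 * w) a"
proof -
  have "nrm w (gamma \<xi> a) \<le> 1 * nrm (2 * w) a"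
    unfolding gamma_def using nrm_prod_mset[of w _ "gamma_tree \<xi>" "2 * w"] nrm_gamma_tree[OF assms] assms(1)
    by (intro nrm_linext) auto
  then show ?thesis by simp
qed

definition contr :: "('a \<Rightarrow> real) \<Rightarrow> ('a \<times> 'b \<Rightarrow>\<^sub>0 real) \<Rightarrow> 'b \<Rightarrow>\<^sub>0 real" where
  "contr \<xi> = linext (\<lambda>(f, g). fscale (\<xi> f) (basis g))"

lemma tensor_pair_conv_contr: "tensor_pair a b z = pairing b (contr a z)"
proof -
  have "tensor_pair a b z = pairing (\<lambda>(f, g). a f * b g) z"
    unfolding tensor_pair_def pairing_def by (intro sum.cong) auto
  also have "\<dots> = pairing b (contr a z)"
    unfolding contr_def pairing_linext by (intro pairing_cong) (auto simp: pairing_fscale)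
  finally show ?thesis .
qed

text \<open>Multiplicativity of \<xi> makes \<open>contr \<xi>\<close> an algebra homomorphism, so
  that it passes through the product over the subtrees.\<close>

lemma contr_coprod_tree:
  fixes \<xi> :: "'a rtree multiset \<Rightarrow> real"
  assumes "\<xi> {#} = 1" "\<And>f g. \<xi> (f + g) = \<xi> f * \<xi> g"
  shows "contr \<xi> (coprod_tree t) = gamma_tree \<xi> t"
proof (induction t)
  case (Node \<mu> f)
  have gr: "graft_right \<mu> z = linext (\<lambda>(f, g). basis (f, {#Node \<mu> g#})) z" for \<mu> :: 'a and z
    unfolding graft_right_def linext_def by (intro sum.cong) auto
  have "contr \<xi> (graft_right \<mu> z) = graft \<mu> (contr \<xi> z)" for z
    unfolding gr contr_def graft_def linext_linext
    by (intro linext_cong) (auto simp: linext_fscale)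
  moreover have "contr \<xi> (prod_mset (image_mset coprod_tree f)) = prod_mset (image_mset (gamma_tree \<xi>) f)"
  proof -
    have "contr \<xi> (prod_mset (image_mset coprod_tree f)) = (\<Prod>t\<in>#f. contr \<xi> (coprod_tree t))"
      unfolding contr_def using assms
      by (intro linext_prod_mset)
        (auto simp: fscale_mult_left fscale_mult_right basis_mult mult_ac zero_prod_def basis_empty)
    also have "\<dots> = prod_mset (image_mset (gamma_tree \<xi>) f)"
      using Node by (intro arg_cong[of _ _ prod_mset] image_mset_cong) auto
    finally show ?thesis .
  qed
  moreover have "contr \<xi> (basis ({#Node \<mu> f#}, {#})) = fscale (\<xi> {#Node \<mu> f#}) 1"
    by (simp add: contr_def basis_empty)
  ultimately show ?case by (simp add: contr_def linext_add)
qed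

lemma contr_coprod:
  assumes "\<xi> {#} = 1" "\<And>f g. \<xi> (f + g) = \<xi> f * \<xi> g"
  shows "contr \<xi> (coprod p) = gamma \<xi> p"
proof -
  have "contr \<xi> (\<Prod>t\<in>#f. coprod_tree t) = (\<Prod>t\<in>#f. gamma_tree \<xi> t)" for f
    unfolding contr_coprod_tree[OF assms, symmetric] contr_def using assms
    by (intro linext_prod_mset)
      (auto simp: fscale_mult_left fscale_mult_right basis_mult mult_ac zero_prod_def basis_empty)
  moreover have "coprod p = linext (\<lambda>f. \<Prod>t\<in>#f. coprod_tree t) p"
    by (simp add: coprod_def linext_def)
  ultimately show ?thesis
    by (simp add: contr_def linext_linext gamma_def)
qed

section \<open>Characters of the truncated algebra and Chen's relation\<close>

lemma forests_add: "f \<in> forests d N \<Longrightarrow> g \<in> forests d N \<Longrightarrow> f + g \<in> forests d N"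
  by (auto simp: forests_def)

lemma empty_in_forests [simp]: "{#} \<in> forests d N"
  by (simp add: forests_def)

lemma single_in_forests [simp]: "{#t#} \<in> forests d N \<longleftrightarrow> t \<in> trees d N"
  by (simp add: forests_def)

lemma Node_in_trees:
  "Node \<mu> f \<in> trees d N \<longleftrightarrow> \<mu> \<in> {1..d} \<and> f \<in> forests d N \<and> Suc (fverts f) \<le> N"
  using verts_le_fverts[of _ f] by (fastforce simp: trees_def forests_def)

text \<open>Guarantees that only values of X on \<open>forests d N\<close> enter the pairings with a
  coproduct; elsewhere nothing is known about X.\<close>

lemma keys_coprod_tree:
  assumes "t \<in> trees d N" "p \<in> Poly_Mapping.keys (coprod_tree t)"
  shows "fst p \<in> forests d N \<and> snd p \<in> forests d N \<and> fverts (fst p) + fverts (snd p) = verts t"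
  using assms
proof (induction t arbitrary: p)
  case (Node \<mu> f)
  have f: "f \<in> forests d N" "Suc (fverts f) \<le> N" "\<mu> \<in> {1..d}" using Node.prems(1) by (auto simp: Node_in_trees)
  \<comment> \<open>Stated for sub-multisets of f, so that the induction over the product can use
    the outer hypothesis for each member.\<close>
  have prod: "fst p \<in> forests d N \<and> snd p \<in> forests d N \<and> fverts (fst p) + fverts (snd p) = fverts g"
    if "g \<subseteq># f" "p \<in> Poly_Mapping.keys (\<Prod>t\<in>#g. coprod_tree t)" for p g
    using that
  proof (induction g arbitrary: p)
    case empty
    then show ?case by (simp add: zero_prod_def)
  next
    case (add t g)
    have tf: "t \<in># f" "g \<subseteq># f" using add.prems(1) by (auto dest: mset_subset_eq_insertD)
    obtain a b where ab: "p = a + b" "a \<in> Poly_Mapping.keys (coprod_tree t)" "b \<in> Poly_Mapping.keys (\<Prod>t\<in>#g. coprod_tree t)"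
      using add.prems(2) keys_mult[of "coprod_tree t" "\<Prod>t\<in>#g. coprod_tree t"] by auto
    have "t \<in> trees d N" using tf f by (auto simp: forests_def)
    then show ?case using Node.IH[OF tf(1) _ ab(2)] add.IH[OF tf(2) ab(3)] ab(1) by (auto simp: forests_add)
  qed
  have "p \<in> Poly_Mapping.keys (basis ({#Node \<mu> f#}, {#})) \<union> Poly_Mapping.keys (graft_right \<mu> (\<Prod>t\<in>#f. coprod_tree t))"
    using Node.prems(2) keys_add by (fastforce simp: keys_add)
  then consider "p = ({#Node \<mu> f#}, {#})" | "p \<in> Poly_Mapping.keys (graft_right \<mu> (\<Prod>t\<in>#f. coprod_tree t))" by auto
  then show ?case
  proof cases
    case 1
    then show ?thesis using Node.prems(1) by simp
  next
    case 2
    then obtain q where q: "q \<in> Poly_Mapping.keys (\<Prod>t\<in>#f. coprod_tree t)" "p = (fst q, {#Node \<mu> (snd q)#})"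
      unfolding graft_right_def using keys_sum keys_fscale
      by (fastforce simp: case_prod_unfold dest!: subsetD[OF keys_sum] subsetD[OF keys_fscale])
    show ?thesis using prod[OF subset_mset.order_refl q(1)] q(2) f by (simp add: Node_in_trees)
  qed
qed

(* Setting the character to 0 on trees outside trees d N makes it multiplicative and bounded on all
   forests; the values of X there are arbitrary. *)
definition charf :: "nat \<Rightarrow> nat \<Rightarrow> (fspan \<Rightarrow> real) \<Rightarrow> forest \<Rightarrow> real" where
  "charf d N \<phi> f = (\<Prod>t\<in>#f. if t \<in> trees d N then \<phi> (basis {#t#}) else 0)"

lemma charf_empty [simp]: "charf d N \<phi> {#} = 1"
  and charf_add [simp]: "charf d N \<phi> (f + g) = charf d N \<phi> f * charf d N \<phi> g"
  by (simp_all add: charf_def)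

lemma charf_tree: "t \<in> trees d N \<Longrightarrow> charf d N \<phi> {#t#} = \<phi> (basis {#t#})"
  and charf_not_tree: "t \<notin> trees d N \<Longrightarrow> charf d N \<phi> {#t#} = 0"
  by (simp_all add: charf_def)

lemma charf_eq:
  assumes "is_char d N \<phi>" "f \<in> forests d N"
  shows "charf d N \<phi> f = \<phi> (basis f)"
  using assms(2)
proof (induction f)
  case empty
  then show ?case using assms(1) by (simp add: is_char_def basis_empty)
next
  case (add t f)
  have t: "t \<in> trees d N" "f \<in> forests d N" using add.prems by (auto simp: forests_def)
  have "basis {#t#} \<in> fspace (forests d N)" "basis f \<in> fspace (forests d N)"
    using t by (auto simp: fspace_def)
  then have "\<phi> (basis {#t#} * basis f) = \<phi> (basis {#t#}) * \<phi> (basis f)"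
    using assms(1) unfolding is_char_def by blast
  then show ?case using add.IH[OF t(2)] t by (simp add: basis_mult charf_def)
qed

lemma charf_bound:
  assumes "0 \<le> w" "\<And>t. t \<in> trees d N \<Longrightarrow> \<bar>\<phi> (basis {#t#})\<bar> \<le> w ^ verts t"
  shows "\<bar>charf d N \<phi> f\<bar> \<le> w ^ fverts f"
proof (induction f)
  case (add t f)
  have "\<bar>if t \<in> trees d N then \<phi> (basis {#t#}) else 0\<bar> * \<bar>charf d N \<phi> f\<bar> \<le> w ^ verts t * w ^ fverts f"
    using add assms by (intro mult_mono) auto
  then show ?case by (simp add: charf_def power_add abs_mult)
qed simp

text \<open>Bridge from the pairings in the definitions to \<open>gamma\<close>:
  \<open>charf\<close> agrees with \<phi> on the forests that occur in the coproduct and, being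
  multiplicative on all forests, may be fed to \<open>contr_coprod\<close>.\<close>

lemma tensor_pair_char:
  assumes "is_char d N \<phi>" "p \<in> fspace (trees1 d N)"
  shows "tensor_pair (\<lambda>f. \<phi> (basis f)) b (coprod p) = pairing b (gamma (charf d N \<phi>) p)"
    and "x \<in> Poly_Mapping.keys (coprod p) \<Longrightarrow> snd x \<in> forests d N"
proof -
  have keys: "fst x \<in> forests d N \<and> snd x \<in> forests d N" if x: "x \<in> Poly_Mapping.keys (coprod p)" for x
  proof -
    obtain f where f: "f \<in> Poly_Mapping.keys p" "x \<in> Poly_Mapping.keys (\<Prod>t\<in>#f. coprod_tree t)"
      using x unfolding coprod_def by (fastforce dest!: subsetD[OF keys_sum] subsetD[OF keys_fscale])
    have "f \<in> trees1 d N" using f(1) assms(2) by (auto simp: fspace_def)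
    then consider "f = {#}" | t where "f = {#t#}" "t \<in> trees d N" by (auto simp: trees1_def)
    then show ?thesis
      by cases (use f keys_coprod_tree in \<open>auto simp: zero_prod_def\<close>)
  qed
  then show "x \<in> Poly_Mapping.keys (coprod p) \<Longrightarrow> snd x \<in> forests d N" by simp
  have "tensor_pair (\<lambda>f. \<phi> (basis f)) b (coprod p) = tensor_pair (charf d N \<phi>) b (coprod p)"
    unfolding tensor_pair_def using keys charf_eq[OF assms(1)] by (intro sum.cong) fastforce+
  also have "\<dots> = pairing b (gamma (charf d N \<phi>) p)"
    by (simp add: tensor_pair_conv_contr contr_coprod)
  finally show "tensor_pair (\<lambda>f. \<phi> (basis f)) b (coprod p) = pairing b (gamma (charf d N \<phi>) p)" .
qed

text \<open>In the coproduct of a tree, the term with the whole tree on the left is the value over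
  [s, u], which is moved to the left-hand side. In all other terms the root stays on the right,
  grafted onto \<open>gamma\<close> of the forest below it.\<close>

lemma chen:
  assumes X: "rough_path \<alpha> d N X" and I: "s \<in> {0..1}" "u \<in> {0..1}" "t \<in> {0..1}"
    and \<mu>: "\<mu> \<in> {1..d}" and a: "Poly_Mapping.keys a \<subseteq> {f \<in> forests d N. Suc (fverts f) \<le> N}"
  shows "pairing (\<lambda>f. charf d N (X s t) {#Node \<mu> f#}) a - pairing (\<lambda>f. charf d N (X s u) {#Node \<mu> f#}) a
     = pairing (\<lambda>f. charf d N (X u t) {#Node \<mu> f#}) (gamma (charf d N (X s u)) a)"
proof -
  have ch: "is_char d N (X s t)" "is_char d N (X s u)" "is_char d N (X u t)"
    using X I by (auto simp: rough_path_def)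
  have *: "charf d N (X s t) {#Node \<mu> f#} - charf d N (X s u) {#Node \<mu> f#}
     = pairing (\<lambda>f. charf d N (X u t) {#Node \<mu> f#}) (\<Prod>t\<in>#f. gamma_tree (charf d N (X s u)) t)"
    if f: "f \<in> Poly_Mapping.keys a" for f
  proof -
    let ?h = "Node \<mu> f"
    have h: "?h \<in> trees d N" using f a \<mu> by (auto simp: Node_in_trees)
    have hb: "basis {#?h#} \<in> fspace (trees1 d N)" using h by (auto simp: fspace_def trees1_def)
    have "charf d N (X s t) {#?h#} = X s t (basis {#?h#})" using h by (simp add: charf_tree)
    also have "\<dots> = tensor_pair (\<lambda>f. X s u (basis f)) (\<lambda>g. X u t (basis g)) (coprod (basis {#?h#}))"
      using X I h unfolding rough_path_def trees1_def by auto
    also have "\<dots> = tensor_pair (\<lambda>f. X s u (basis f)) (charf d N (X u t)) (coprod (basis {#?h#}))"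
      unfolding tensor_pair_def using tensor_pair_char(2)[OF ch(2) hb] charf_eq[OF ch(3)]
      by (intro sum.cong) fastforce+
    also have "\<dots> = pairing (charf d N (X u t)) (gamma (charf d N (X s u)) (basis {#?h#}))"
      by (rule tensor_pair_char(1)[OF ch(2) hb])
    also have "gamma (charf d N (X s u)) (basis {#?h#}) = fscale (charf d N (X s u) {#?h#}) 1
        + graft \<mu> (\<Prod>t\<in>#f. gamma_tree (charf d N (X s u)) t)"
      by (simp add: gamma_def)
    also have "pairing (charf d N (X u t)) \<dots> = charf d N (X s u) {#?h#}
       + pairing (\<lambda>f. charf d N (X u t) {#Node \<mu> f#}) (\<Prod>t\<in>#f. gamma_tree (charf d N (X s u)) t)"
      using pairing_basis[of "charf d N (X u t)" "{#}", unfolded basis_empty]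
      by (simp add: pairing_add pairing_fscale graft_def pairing_linext)
    finally show ?thesis by simp
  qed
  show ?thesis
    unfolding gamma_def pairing_linext
    by (simp add: pairing_def[of _ a] flip: sum_subtractf right_diff_distrib)
      (intro sum.cong, auto simp: *)
qed

section \<open>Composition with smooth functions\<close>

lemma finite_submultisets: "finite {g. g \<subseteq># (f :: 'a multiset)}"
  by (rule finite_subset[OF _ finite_msets_bounded[of "set_mset f" "size f"]])
    (auto dest: set_mset_mono size_mset_mono)

text \<open>The index set does not depend on the factors, so a product of curves can be
  differentiated coefficient by coefficient.\<close>

lemma lookup_mult_multiset:
  fixes p q :: "'a multiset \<Rightarrow>\<^sub>0 real"
  shows "Poly_Mapping.lookup (p * q) f = (\<Sum>g\<in>{g. g \<subseteq># f}. Poly_Mapping.lookup p g * Poly_Mapping.lookup q (f - g))"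
proof -
  have 1: "pairing (\<lambda>y. if x + y = f then 1 else 0) q = (if x \<subseteq># f then Poly_Mapping.lookup q (f - x) else 0)" for x
  proof (cases "x \<subseteq># f")
    case True
    then have "x + y = f \<longleftrightarrow> y = f - x" for y by auto
    then show ?thesis using True by (simp add: lookup_conv_pairing[of q])
  next
    case False
    then have "x + y \<noteq> f" for y by auto
    then show ?thesis using False by (simp add: pairing_def)
  qed
  have "p * q = linext (\<lambda>x. linext (\<lambda>y. basis (x + y)) q) p"
    unfolding mult_expand[of p q] linext_def by (simp add: fscale_sum)
  then have "Poly_Mapping.lookup (p * q) f = pairing (\<lambda>x. pairing (\<lambda>y. if x + y = f then 1 else 0) q) p"
    by (simp add: lookup_linext lookup_basis)
  also have "\<dots> = (\<Sum>x\<in>Poly_Mapping.keys p \<union> {g. g \<subseteq># f}. Poly_Mapping.lookup p x * (if x \<subseteq># f then Poly_Mapping.lookup q (f - x) else 0))"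
    unfolding 1 by (rule pairing_superset) (auto simp: finite_submultisets)
  also have "\<dots> = (\<Sum>x\<in>{g. g \<subseteq># f}. Poly_Mapping.lookup p x * (if x \<subseteq># f then Poly_Mapping.lookup q (f - x) else 0))"
    by (rule sum.mono_neutral_right) (auto simp: finite_submultisets)
  finally show ?thesis by simp
qed

text \<open>Coefficientwise, so that no topology on the algebra is needed; \<open>nrm_MVT\<close>
  makes the link to the norm.\<close>

definition has_cderiv :: "(real \<Rightarrow> 'a \<Rightarrow>\<^sub>0 real) \<Rightarrow> ('a \<Rightarrow>\<^sub>0 real) \<Rightarrow> real \<Rightarrow> bool" where
  "has_cderiv h h' t \<longleftrightarrow> (\<forall>x. ((\<lambda>t. Poly_Mapping.lookup (h t) x) has_real_derivative Poly_Mapping.lookup h' x) (at t))"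

lemma has_cderiv_add: "has_cderiv h h' t \<Longrightarrow> has_cderiv g g' t \<Longrightarrow> has_cderiv (\<lambda>t. h t + g t) (h' + g') t"
  by (auto simp: has_cderiv_def lookup_add intro!: DERIV_add)

lemma has_cderiv_const: "has_cderiv (\<lambda>_. a) 0 t"
  by (simp add: has_cderiv_def)

lemma has_cderiv_sum:
  "(\<And>i. i \<in> I \<Longrightarrow> has_cderiv (h i) (h' i) t) \<Longrightarrow> has_cderiv (\<lambda>t. \<Sum>i\<in>I. h i t) (\<Sum>i\<in>I. h' i) t"
  by (auto simp: has_cderiv_def lookup_sum intro!: DERIV_sum)

lemma has_cderiv_fscale_fun: "(c has_real_derivative c') (at t) \<Longrightarrow> has_cderiv (\<lambda>t. fscale (c t) a) (fscale c' a) t"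
  by (auto simp: has_cderiv_def intro!: DERIV_cmult_right)

lemma has_cderiv_fscale: "has_cderiv h h' t \<Longrightarrow> has_cderiv (\<lambda>t. fscale c (h t)) (fscale c h') t"
  by (auto simp: has_cderiv_def intro!: DERIV_cmult)

lemma has_cderiv_mult:
  fixes h g :: "real \<Rightarrow> 'a multiset \<Rightarrow>\<^sub>0 real"
  assumes "has_cderiv h h' t" "has_cderiv g g' t"
  shows "has_cderiv (\<lambda>t. h t * g t) (h' * g t + h t * g') t"
  unfolding has_cderiv_def lookup_add lookup_mult_multiset sum.distrib[symmetric]
proof (intro allI DERIV_sum)
  fix f x
  have "((\<lambda>t. Poly_Mapping.lookup (h t) x * Poly_Mapping.lookup (g t) (f - x)) has_real_derivative
    Poly_Mapping.lookup h' x * Poly_Mapping.lookup (g t) (f - x) + Poly_Mapping.lookup g' (f - x) * Poly_Mapping.lookup (h t) x) (at t)"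
    using assms unfolding has_cderiv_def by (intro DERIV_mult) auto
  then show "((\<lambda>t. Poly_Mapping.lookup (h t) x * Poly_Mapping.lookup (g t) (f - x)) has_real_derivative
    Poly_Mapping.lookup h' x * Poly_Mapping.lookup (g t) (f - x) + Poly_Mapping.lookup (h t) x * Poly_Mapping.lookup g' (f - x)) (at t)"
    by (simp add: mult.commute)
qed

(* Apply the scalar mean value theorem to a functional realising the norm of h 1 - h 0. *)
lemma nrm_MVT:
  assumes "\<And>t. has_cderiv h (h' t) t" "\<And>t. 0 < t \<Longrightarrow> t < 1 \<Longrightarrow> nrm w (h' t) \<le> K" "0 \<le> w"
  shows "nrm w (h 1 - h 0) \<le> K"
proof -
  let ?S = "Poly_Mapping.keys (h 1 - h 0)" and ?l = Poly_Mapping.lookup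
  define c where "c x = sgn (?l (h 1 - h 0) x) * w ^ fverts x" for x
  have "((\<lambda>t. \<Sum>x\<in>?S. c x * ?l (h t) x) has_real_derivative (\<Sum>x\<in>?S. c x * ?l (h' t) x)) (at t)" for t
    using assms(1) unfolding has_cderiv_def by (intro DERIV_sum DERIV_cmult) auto
  then obtain z where z: "0 < z" "z < 1"
    "(\<Sum>x\<in>?S. c x * ?l (h 1) x) - (\<Sum>x\<in>?S. c x * ?l (h 0) x) = (1 - 0) * (\<Sum>x\<in>?S. c x * ?l (h' z) x)"
    using MVT2[of 0 1 "\<lambda>t. \<Sum>x\<in>?S. c x * ?l (h t) x" "\<lambda>t. \<Sum>x\<in>?S. c x * ?l (h' t) x"] by auto
  have "nrm w (h 1 - h 0) = (\<Sum>x\<in>?S. c x * ?l (h 1 - h 0) x)"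
    unfolding nrm_def c_def by (intro sum.cong) (auto simp: abs_sgn mult_ac)
  also have "\<dots> = (\<Sum>x\<in>?S. c x * ?l (h' z) x)"
    using z(3) by (simp add: lookup_minus right_diff_distrib sum_subtractf)
  also have "\<dots> \<le> (\<Sum>x\<in>?S. \<bar>?l (h' z) x\<bar> * w ^ fverts x)"
  proof (rule sum_mono)
    fix x
    have "c x * ?l (h' z) x \<le> \<bar>c x\<bar> * \<bar>?l (h' z) x\<bar>" by (metis abs_ge_self abs_mult)
    also have "\<dots> \<le> w ^ fverts x * \<bar>?l (h' z) x\<bar>"
      using assms(3) by (intro mult_right_mono) (auto simp: c_def abs_mult sgn_if)
    finally show "c x * ?l (h' z) x \<le> \<bar>?l (h' z) x\<bar> * w ^ fverts x" by (simp add: mult.commute)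
  qed
  also have "\<dots> \<le> (\<Sum>x\<in>?S \<union> Poly_Mapping.keys (h' z). \<bar>?l (h' z) x\<bar> * w ^ fverts x)"
    using assms(3) by (intro sum_mono2) auto
  also have "\<dots> = nrm w (h' z)" by (rule nrm_superset[symmetric]) auto
  also have "\<dots> \<le> K" using assms(2) z by simp
  finally show ?thesis .
qed

text \<open>Contraction of a p-linear form with coefficients c against p copies of a vector v whose
  entries lie in the algebra. With the p-th partial derivatives of g as c this is D ^ p g
  [v, ..., v].\<close>

primrec lsum :: "nat \<Rightarrow> nat \<Rightarrow> (nat list \<Rightarrow> real) \<Rightarrow> (nat \<Rightarrow> 'a rtree multiset \<Rightarrow>\<^sub>0 real) \<Rightarrow> 'a rtree multiset \<Rightarrow>\<^sub>0 real" where
  "lsum k 0 c v = fscale (c []) 1"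
| "lsum k (Suc p) c v = (\<Sum>i<k. v i * lsum k p (\<lambda>is. c (i # is)) v)"

definition idx :: "nat \<Rightarrow> nat \<Rightarrow> nat list set" where
  "idx k p = {is. length is = p \<and> set is \<subseteq> {..<k}}"

lemma idx_Cons [simp]: "i # is \<in> idx k (Suc p) \<longleftrightarrow> i < k \<and> is \<in> idx k p"
  by (auto simp: idx_def)

lemma idx_0 [simp]: "idx k 0 = {[]}"
  by (auto simp: idx_def)

lemma lsum_cong:
  assumes "\<And>is. is \<in> idx k p \<Longrightarrow> c is = c' is" "\<And>i. i < k \<Longrightarrow> v i = v' i"
  shows "lsum k p c v = lsum k p c' v'"
  using assms(1)
proof (induction p arbitrary: c c')
  case (Suc p)
  have "lsum k p (\<lambda>is. c (i # is)) v = lsum k p (\<lambda>is. c' (i # is)) v'" if "i < k" for i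
    using that Suc.prems by (intro Suc.IH) auto
  then show ?case using assms(2) by auto
qed simp

lemma lsum_sum: "lsum k p (\<lambda>is. \<Sum>j\<in>J. a j * c j is) v = (\<Sum>j\<in>J. fscale (a j) (lsum k p (c j) v))"
proof (induction p arbitrary: c)
  case 0
  then show ?case by (simp add: fscale_sum_left)
next
  case (Suc p)
  then show ?case
    by (simp add: sum_distrib_left fscale_mult_right fscale_sum sum.swap[of _ J])
qed

lemma gamma_lsum: "gamma \<xi> (lsum k p c v) = lsum k p c (\<lambda>i. gamma \<xi> (v i))"
  by (induction p arbitrary: c) (simp_all add: gamma_fscale gamma_sum gamma_mult)

lemma nrm_sum_lessThan:
  "0 \<le> w \<Longrightarrow> (\<And>i. i < k \<Longrightarrow> nrm w (p i) \<le> K) \<Longrightarrow> nrm w (\<Sum>i<k. p i) \<le> real k * K"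
  using nrm_sum_le[of w "{..<k}" p K] by simp

lemma nrm_sum_mult_le:
  assumes "0 \<le> w" "\<And>i. i < k \<Longrightarrow> nrm w (p i) \<le> m" "\<And>i. i < k \<Longrightarrow> nrm w (q i) \<le> K" "0 \<le> m" "0 \<le> K"
  shows "nrm w (\<Sum>i<k. p i * q i) \<le> real k * m * K"
proof -
  have "nrm w (p i * q i) \<le> m * K" if "i < k" for i
    using that assms by (intro order_trans[OF nrm_mult] mult_mono) (auto intro: nrm_nonneg)
  then show ?thesis using nrm_sum_le[OF assms(1), of "{..<k}" "\<lambda>i. p i * q i" "m * K"] by (simp add: mult.assoc)
qed

lemma nrm_lsum:
  assumes "0 \<le> w" "\<And>i. i < k \<Longrightarrow> nrm w (v i) \<le> m" "\<And>is. is \<in> idx k p \<Longrightarrow> \<bar>c is\<bar> \<le> K" "0 \<le> m" "0 \<le> K"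
  shows "nrm w (lsum k p c v) \<le> K * (real k * m) ^ p"
  using assms(3)
proof (induction p arbitrary: c)
  case 0
  then show ?case by (simp add: nrm_fscale)
next
  case (Suc p)
  have "nrm w (lsum k p (\<lambda>is. c (i # is)) v) \<le> K * (real k * m) ^ p" if "i < k" for i
    using that by (intro Suc.IH Suc.prems) simp
  then have "nrm w (lsum k (Suc p) c v) \<le> real k * m * (K * (real k * m) ^ p)"
    unfolding lsum.simps using assms by (intro nrm_sum_mult_le) auto
  then show ?case by (simp add: mult_ac)
qed

text \<open>Leibniz rule: symmetry of the coefficients makes the p terms with one differentiated
  factor equal. For p = 0 the truncated \<open>p - 1\<close> is harmless because of the factor
  p.\<close>

lemma has_cderiv_lsum:
  assumes "\<And>is. is \<in> idx k p \<Longrightarrow> ((\<lambda>t. c t is) has_real_derivative c' is) (at t)"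
    and "\<And>i. i < k \<Longrightarrow> has_cderiv (\<lambda>t. v t i) (v' i) t"
    and "\<And>is js. is \<in> idx k p \<Longrightarrow> mset is = mset js \<Longrightarrow> c t is = c t js"
  shows "has_cderiv (\<lambda>t. lsum k p (c t) (v t))
    (lsum k p c' (v t) + fscale (real p) (\<Sum>i<k. v' i * lsum k (p - 1) (\<lambda>is. c t (i # is)) (v t))) t"
  using assms(1,3)
proof (induction p arbitrary: c c')
  case 0
  then show ?case by (simp add: has_cderiv_fscale_fun)
next
  case (Suc p)
  let ?L = "\<lambda>p i. lsum k p (\<lambda>is. c t (i # is)) (v t)"
  let ?L2 = "\<lambda>i j. lsum k (p - 1) (\<lambda>is. c t (i # j # is)) (v t)"
  have IH: "has_cderiv (\<lambda>t. lsum k p (\<lambda>is. c t (i # is)) (v t))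
     (lsum k p (\<lambda>is. c' (i # is)) (v t) + fscale (real p) (\<Sum>j<k. v' j * ?L2 i j)) t" if "i < k" for i
    using that Suc.prems by (intro Suc.IH) auto
  \<comment> \<open>The induction hypothesis differentiates a factor that stands behind v i;
    symmetry in the first two indices moves it to the front.\<close>
  have swap: "fscale (real p) (\<Sum>i<k. v t i * (\<Sum>j<k. v' j * ?L2 i j)) = fscale (real p) (\<Sum>j<k. v' j * ?L p j)"
  proof (cases p)
    case (Suc q)
    have "(\<Sum>i<k. v t i * (\<Sum>j<k. v' j * ?L2 i j)) = (\<Sum>j<k. v' j * (\<Sum>i<k. v t i * ?L2 i j))"
      unfolding sum_distrib_left by (subst sum.swap) (simp add: mult_ac)
    also have "\<dots> = (\<Sum>j<k. v' j * ?L p j)"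
    proof -
      have "?L2 i j = ?L2 j i" if "i < k" "j < k" for i j
        by (intro lsum_cong Suc.prems(2)) (use that Suc in auto)
      then show ?thesis using Suc by auto
    qed
    finally show ?thesis by simp
  qed simp
  have "has_cderiv (\<lambda>t. lsum k (Suc p) (c t) (v t))
     (\<Sum>i<k. v' i * ?L p i + v t i * (lsum k p (\<lambda>is. c' (i # is)) (v t) + fscale (real p) (\<Sum>j<k. v' j * ?L2 i j))) t"
    unfolding lsum.simps using assms(2) IH by (intro has_cderiv_sum has_cderiv_mult) auto
  also have "(\<Sum>i<k. v' i * ?L p i + v t i * (lsum k p (\<lambda>is. c' (i # is)) (v t) + fscale (real p) (\<Sum>j<k. v' j * ?L2 i j)))
     = lsum k (Suc p) c' (v t) + ((\<Sum>i<k. v' i * ?L p i) + fscale (real p) (\<Sum>i<k. v t i * (\<Sum>j<k. v' j * ?L2 i j)))"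
    by (simp add: sum.distrib distrib_left fscale_mult_right flip: fscale_sum)
  also have "\<dots> = lsum k (Suc p) c' (v t) + fscale (real (Suc p)) (\<Sum>i<k. v' i * lsum k (Suc p - 1) (\<lambda>is. c t (i # is)) (v t))"
    unfolding swap by (simp add: fscale_distribs)
  finally show ?case .
qed

text \<open>n counts the terms, so the degree is n - 1; the direction v takes its entries in the
  algebra.\<close>

definition taylor :: "nat \<Rightarrow> nat \<Rightarrow> ((nat \<Rightarrow> real) \<Rightarrow> real) \<Rightarrow> (nat \<Rightarrow> real)
    \<Rightarrow> (nat \<Rightarrow> 'a rtree multiset \<Rightarrow>\<^sub>0 real) \<Rightarrow> 'a rtree multiset \<Rightarrow>\<^sub>0 real" where
  "taylor k n g y v = (\<Sum>p<n. fscale (1 / fact p) (lsum k p (\<lambda>is. foldr partial is g y) v))"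

lemma gamma_taylor: "gamma \<xi> (taylor k n g y v) = taylor k n g y (\<lambda>i. gamma \<xi> (v i))"
  by (simp add: taylor_def gamma_sum gamma_fscale gamma_lsum)

lemma geometric_half_le: "0 \<le> x \<Longrightarrow> x \<le> 1 / 2 \<Longrightarrow> (\<Sum>p<n. x ^ p) \<le> (2::real)"
proof -
  assume x: "0 \<le> x" "x \<le> 1 / 2"
  have "(\<Sum>p<n. x ^ p) \<le> (\<Sum>p<n. (1 / 2) ^ p)" using x by (intro sum_mono power_mono) auto
  also have "\<dots> = 2 - 2 * (1 / 2) ^ n" by (induction n) auto
  also have "\<dots> \<le> 2" by simp
  finally show ?thesis .
qed

text \<open>Each further order costs a factor k B m, and a ratio of at most 1 / 2 sums the geometric
  series to at most 2.\<close>

lemma nrm_taylor: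
  assumes "0 \<le> w" "0 \<le> A" "0 \<le> B" "0 \<le> m" "real k * B * m \<le> 1 / 2"
    and "\<And>i. i < k \<Longrightarrow> nrm w (v i) \<le> m"
    and "\<And>p is. p < n \<Longrightarrow> is \<in> idx k p \<Longrightarrow> \<bar>foldr partial is g y\<bar> \<le> A * B ^ p"
  shows "nrm w (taylor k n g y v) \<le> 2 * A"
proof -
  have "nrm w (fscale (1 / fact p) (lsum k p (\<lambda>is. foldr partial is g y) v)) \<le> A * (real k * B * m) ^ p" if p: "p < n" for p
  proof -
    have "nrm w (lsum k p (\<lambda>is. foldr partial is g y) v) \<le> A * B ^ p * (real k * m) ^ p"
      using assms p by (intro nrm_lsum) auto
    also have "\<dots> = A * (real k * B * m) ^ p" by (simp add: power_mult_distrib mult_ac)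
    finally have "1 / fact p * nrm w (lsum k p (\<lambda>is. foldr partial is g y) v) \<le> 1 * (A * (real k * B * m) ^ p)"
      using assms by (intro mult_mono) (auto simp: nrm_nonneg)
    then show ?thesis by (simp add: nrm_fscale)
  qed
  then have "nrm w (taylor k n g y v) \<le> (\<Sum>p<n. A * (real k * B * m) ^ p)"
    unfolding taylor_def by (intro order_trans[OF nrm_sum[OF assms(1)]] sum_mono) auto
  also have "\<dots> \<le> A * 2"
    unfolding sum_distrib_left[symmetric] using assms by (intro mult_left_mono geometric_half_le) auto
  finally show ?thesis by simp
qed

text \<open>Base point and direction both move linearly. The derivative of the term of order p
  consists of \<open>Q p\<close>, from the base point, and of a contribution of order p - 1 from the
  direction. Writing v - w as R minus the increment of the base point makes the latter cancel
  \<open>Q (p - 1)\<close>. There remain \<open>Q n\<close>, with derivatives of order n + 1 and the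
  small factor (k B m) ^ n, and terms linear in R.\<close>

lemma nrm_taylor_diff:
  fixes v w :: "nat \<Rightarrow> 'a rtree multiset \<Rightarrow>\<^sub>0 real"
  assumes g: "C_diff k (Suc n) g" and x: "x \<in> Rn k" "x' \<in> Rn k"
    and bnd: "\<And>\<tau> p is. 0 < \<tau> \<Longrightarrow> \<tau> < 1 \<Longrightarrow> p \<le> Suc n \<Longrightarrow> is \<in> idx k p \<Longrightarrow>
        \<bar>foldr partial is g (\<lambda>i. x i + \<tau> * (x' i - x i))\<bar> \<le> A * B ^ p"
    and vw: "\<And>i. i < k \<Longrightarrow> nrm l (v i) \<le> m" "\<And>i. i < k \<Longrightarrow> nrm l (w i) \<le> m"
    and q: "\<And>i. i < k \<Longrightarrow> \<bar>x' i - x i\<bar> \<le> q"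
    and r: "\<And>i. i < k \<Longrightarrow> nrm l (v i - w i + fscale (x' i - x i) 1) \<le> r"
    and pos: "0 \<le> l" "0 \<le> A" "0 \<le> B" "0 \<le> m" "0 \<le> q" "0 \<le> r" "real k * B * m \<le> 1 / 2"
  shows "nrm l (taylor k (Suc n) g x' v - taylor k (Suc n) g x w)
      \<le> A * real k * B * q * (real k * B * m) ^ n + 2 * A * real k * B * r"
proof -
  define y where "y i = x' i - x i" for i
  have y: "y \<in> Rn k" using x by (simp add: Rn_iff y_def)
  define z where "z \<tau> = (\<lambda>i. x i + \<tau> * y i)" for \<tau>
  have z: "z \<tau> \<in> Rn k" for \<tau> using x y by (simp add: Rn_iff z_def)
  define u where "u \<tau> i = w i + fscale \<tau> (v i - w i)" for \<tau> i
  define R where "R i = v i - w i + fscale (y i) 1" for i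
  define c where "c \<tau> is = foldr partial is g (z \<tau>)" for \<tau> "is"
  define Q where "Q \<tau> p = (\<Sum>i<k. fscale (y i) (lsum k p (\<lambda>is. c \<tau> (i # is)) (u \<tau>)))" for \<tau> p
  define S where "S \<tau> p = (\<Sum>i<k. R i * lsum k p (\<lambda>is. c \<tau> (i # is)) (u \<tau>))" for \<tau> p
  define h where "h \<tau> = taylor k (Suc n) g (z \<tau>) (u \<tau>)" for \<tau>
  define h' where "h' \<tau> = fscale (1 / fact n) (Q \<tau> n) + (\<Sum>p<n. fscale (1 / fact p) (S \<tau> p))" for \<tau>
  have u: "has_cderiv (\<lambda>\<tau>. u \<tau> i) (v i - w i) \<tau>" for \<tau> i
    unfolding u_def using has_cderiv_add[OF has_cderiv_const has_cderiv_fscale_fun[OF DERIV_ident]] by simp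
  have c: "((\<lambda>\<tau>. c \<tau> is) has_real_derivative (\<Sum>i<k. y i * c \<tau> (i # is))) (at \<tau>)" if "is \<in> idx k p" "p \<le> n" for "is" p \<tau>
  proof -
    have "C_diff k (Suc n - length is) (foldr partial is g)"
      using that by (intro C_diff_foldr[OF g]) (auto simp: idx_def)
    moreover have "Suc n - length is = Suc (n - length is)" using that by (auto simp: idx_def)
    ultimately show ?thesis
      using C_diff_chain[of k "n - length is" "foldr partial is g" x y \<tau>] x y by (simp add: c_def z_def)
  qed
  have sym: "c \<tau> is = c \<tau> js" if "is \<in> idx k p" "p \<le> n" "mset is = mset js" for "is" js p \<tau>
    unfolding c_def using that z by (intro foldr_partial_perm[OF g]) (auto simp: idx_def)
  have L: "has_cderiv (\<lambda>\<tau>. lsum k p (c \<tau>) (u \<tau>)) (Q \<tau> p + fscale (real p) (S \<tau> (p - 1) - Q \<tau> (p - 1))) \<tau>" if "p \<le> n" for p \<tau>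
  proof -
    have "(\<Sum>i<k. (v i - w i) * lsum k (p - 1) (\<lambda>is. c \<tau> (i # is)) (u \<tau>)) = S \<tau> (p - 1) - Q \<tau> (p - 1)"
    proof -
      have "v i - w i = R i - fscale (y i) 1" for i by (simp add: R_def)
      then show ?thesis
        by (simp add: S_def Q_def left_diff_distrib sum_subtractf fscale_mult_left)
    qed
    moreover have "lsum k p (\<lambda>is. \<Sum>i<k. y i * c \<tau> (i # is)) (u \<tau>) = Q \<tau> p"
      by (simp add: lsum_sum Q_def)
    moreover have "has_cderiv (\<lambda>\<tau>. lsum k p (c \<tau>) (u \<tau>)) (lsum k p (\<lambda>is. \<Sum>i<k. y i * c \<tau> (i # is)) (u \<tau>)
        + fscale (real p) (\<Sum>i<k. (v i - w i) * lsum k (p - 1) (\<lambda>is. c \<tau> (i # is)) (u \<tau>))) \<tau>"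
      by (rule has_cderiv_lsum[OF c[OF _ that] u sym[OF _ that]])
    ultimately show ?thesis by simp
  qed
  have h: "has_cderiv h (h' \<tau>) \<tau>" for \<tau>
  proof -
    have "has_cderiv h (\<Sum>p<Suc n. fscale (1 / fact p) (Q \<tau> p + fscale (real p) (S \<tau> (p - 1) - Q \<tau> (p - 1)))) \<tau>"
      unfolding h_def taylor_def c_def[symmetric]
      by (intro has_cderiv_sum has_cderiv_fscale) (use L in \<open>simp add: c_def\<close>)
    also have "(\<Sum>p<Suc n. fscale (1 / fact p) (Q \<tau> p + fscale (real p) (S \<tau> (p - 1) - Q \<tau> (p - 1))))
       = (\<Sum>p<Suc n. fscale (1 / fact p) (Q \<tau> p)) + (\<Sum>p<Suc n. fscale (real p / fact p) (S \<tau> (p - 1) - Q \<tau> (p - 1)))"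
      by (simp add: fscale_distribs sum.distrib)
    \<comment> \<open>p / p! = 1 / (p - 1)! aligns these terms with the \<open>Q\<close> of one
      order less.\<close>
    also have "(\<Sum>p<Suc n. fscale (real p / fact p) (S \<tau> (p - 1) - Q \<tau> (p - 1))) = (\<Sum>p<n. fscale (1 / fact p) (S \<tau> p - Q \<tau> p))"
      unfolding sum.lessThan_Suc_shift by (simp add: field_simps del: of_nat_Suc)
    finally show ?thesis by (simp add: h'_def fscale_distribs sum_subtractf add_ac)
  qed
  have K: "nrm l (h' \<tau>) \<le> A * real k * B * q * (real k * B * m) ^ n + 2 * A * real k * B * r" if \<tau>: "0 < \<tau>" "\<tau> < 1" for \<tau>
  proof -
    have um: "nrm l (u \<tau> i) \<le> m" if "i < k" for i
    proof -
      have "u \<tau> i = fscale (1 - \<tau>) (w i) + fscale \<tau> (v i)" by (simp add: u_def fscale_distribs)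
      then have "nrm l (u \<tau> i) \<le> nrm l (fscale (1 - \<tau>) (w i)) + nrm l (fscale \<tau> (v i))"
        using nrm_triangle[OF pos(1)] by metis
      also have "\<dots> \<le> (1 - \<tau>) * m + \<tau> * m"
        unfolding nrm_fscale using \<tau> vw that by (intro add_mono mult_mono) (auto intro: nrm_nonneg pos)
      finally show ?thesis by (simp add: algebra_simps)
    qed
    have lm: "nrm l (lsum k p (\<lambda>is. c \<tau> (i # is)) (u \<tau>)) \<le> A * B * (real k * B * m) ^ p" if "i < k" "p \<le> n" for i p
    proof -
      have "nrm l (lsum k p (\<lambda>is. c \<tau> (i # is)) (u \<tau>)) \<le> A * B ^ Suc p * (real k * m) ^ p"
      proof (rule nrm_lsum[OF pos(1) um])
        fix "is" assume "is \<in> idx k p"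
        then show "\<bar>c \<tau> (i # is)\<bar> \<le> A * B ^ Suc p"
          using bnd[OF \<tau>, of "Suc p" "i # is"] that by (simp add: c_def z_def y_def)
      qed (use pos in auto)
      then show ?thesis by (simp add: power_mult_distrib mult_ac)
    qed
    have Qm: "nrm l (Q \<tau> n) \<le> real k * (q * (A * B * (real k * B * m) ^ n))"
    proof -
      have "nrm l (fscale (y i) (lsum k n (\<lambda>is. c \<tau> (i # is)) (u \<tau>))) \<le> q * (A * B * (real k * B * m) ^ n)" if "i < k" for i
        unfolding nrm_fscale using q lm that pos by (intro mult_mono) (auto simp: y_def intro: nrm_nonneg)
      then show ?thesis unfolding Q_def by (rule nrm_sum_lessThan[OF pos(1)])
    qed
    have Sm: "nrm l (S \<tau> p) \<le> real k * r * (A * B * (real k * B * m) ^ p)" if "p < n" for p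
      unfolding S_def using r lm that pos by (intro nrm_sum_mult_le) (auto simp: R_def y_def)
    have inv: "0 \<le> 1 / (fact p :: real)" "1 / (fact p :: real) \<le> 1" for p by auto
    have "nrm l (h' \<tau>) \<le> nrm l (fscale (1 / fact n) (Q \<tau> n)) + (\<Sum>p<n. nrm l (fscale (1 / fact p) (S \<tau> p)))"
      unfolding h'_def by (intro order_trans[OF nrm_triangle] add_mono nrm_sum order_refl pos)
    also have "\<dots> \<le> nrm l (Q \<tau> n) + (\<Sum>p<n. nrm l (S \<tau> p))"
      unfolding nrm_fscale using inv pos
      by (intro add_mono sum_mono mult_left_le_one_le) (auto intro: nrm_nonneg)
    also have "\<dots> \<le> real k * (q * (A * B * (real k * B * m) ^ n)) + (\<Sum>p<n. real k * r * (A * B * (real k * B * m) ^ p))"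
      using Qm Sm by (intro add_mono sum_mono) auto
    also have "(\<Sum>p<n. real k * r * (A * B * (real k * B * m) ^ p)) = real k * r * (A * B) * (\<Sum>p<n. (real k * B * m) ^ p)"
      by (simp add: sum_distrib_left mult_ac)
    also have "\<dots> \<le> real k * r * (A * B) * 2"
      using pos by (intro mult_left_mono geometric_half_le) auto
    finally show ?thesis by (simp add: mult_ac)
  qed
  have "z 1 = x'" "z 0 = x" "u 1 = v" "u 0 = w" by (auto simp: z_def y_def u_def)
  then show ?thesis using nrm_MVT[OF h K pos(1)] by (simp add: h_def)
qed

section \<open>Composition as a truncated Taylor polynomial\<close>

lemma sum_lists_Suc:
  fixes F :: "'a list \<Rightarrow> 'b::comm_monoid_add"
  shows "(\<Sum>xs\<in>{xs. length xs = Suc p \<and> set xs \<subseteq> T}. F xs) = (\<Sum>x\<in>T. \<Sum>xs\<in>{xs. length xs = p \<and> set xs \<subseteq> T}. F (x # xs))"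
proof -
  have "{xs. length xs = Suc p \<and> set xs \<subseteq> T} = (\<lambda>(x, xs). x # xs) ` (T \<times> {xs. length xs = p \<and> set xs \<subseteq> T})"
    by (auto simp: length_Suc_conv image_iff)
  moreover have "inj_on (\<lambda>(x, xs). x # xs) (T \<times> {xs. length xs = p \<and> set xs \<subseteq> T})"
    by (auto simp: inj_on_def)
  ultimately show ?thesis
    by (simp add: sum.reindex sum.cartesian_product case_prod_unfold comp_def)
qed

text \<open>Multinomial expansion over tuples of trees, in the shape of the inner sum of
  \<open>compose\<close>.\<close>

lemma lsum_expand:
  assumes "\<And>i. i < k \<Longrightarrow> v i = (\<Sum>h\<in>T. fscale (e h i) (basis {#h#}))"
  shows "lsum k p c v = (\<Sum>hs\<in>{hs. length hs = p \<and> set hs \<subseteq> T}.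
     fscale (\<Sum>is\<in>{is. length is = p \<and> set is \<subseteq> {..<k}}. c is * (\<Prod>j<p. e (hs ! j) (is ! j))) (basis (mset hs)))"
proof (induction p arbitrary: c)
  case 0
  have "{is. is = [] \<and> set is \<subseteq> {..<k}} = {[]}" "{hs. hs = [] \<and> set hs \<subseteq> T} = {[]}" by auto
  then show ?case by (simp add: basis_empty)
next
  case (Suc p)
  let ?H = "{hs. length hs = p \<and> set hs \<subseteq> T}" and ?I = "{is. length is = p \<and> set is \<subseteq> {..<k}}"
  have "lsum k (Suc p) c v = (\<Sum>i<k. \<Sum>h\<in>T. \<Sum>hs\<in>?H. fscale (e h i * (\<Sum>is\<in>?I. c (i # is) * (\<Prod>j<p. e (hs ! j) (is ! j)))) (basis (mset (h # hs))))"
    unfolding lsum.simps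
  proof (intro sum.cong refl)
    fix i assume "i \<in> {..<k}"
    then have "v i * lsum k p (\<lambda>is. c (i # is)) v = (\<Sum>h\<in>T. fscale (e h i) (basis {#h#})) *
      (\<Sum>hs\<in>?H. fscale (\<Sum>is\<in>?I. c (i # is) * (\<Prod>j<p. e (hs ! j) (is ! j))) (basis (mset hs)))"
      using assms Suc.IH by simp
    also have "\<dots> = (\<Sum>h\<in>T. \<Sum>hs\<in>?H. fscale (e h i * (\<Sum>is\<in>?I. c (i # is) * (\<Prod>j<p. e (hs ! j) (is ! j)))) (basis (mset (h # hs))))"
      by (simp add: sum_product fscale_mult_left fscale_mult_right basis_mult mult.commute)
    finally show "v i * lsum k p (\<lambda>is. c (i # is)) v = \<dots>" .
  qed
  also have "\<dots> = (\<Sum>h\<in>T. \<Sum>hs\<in>?H. fscale (\<Sum>i<k. e h i * (\<Sum>is\<in>?I. c (i # is) * (\<Prod>j<p. e (hs ! j) (is ! j)))) (basis (mset (h # hs))))"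
    unfolding fscale_sum_left by (subst sum.swap, intro sum.cong refl, subst sum.swap, rule refl)
  also have "\<dots> = (\<Sum>hs\<in>{hs. length hs = Suc p \<and> set hs \<subseteq> T}.
     fscale (\<Sum>is\<in>{is. length is = Suc p \<and> set is \<subseteq> {..<k}}. c is * (\<Prod>j<Suc p. e (hs ! j) (is ! j))) (basis (mset hs)))"
    unfolding sum_lists_Suc prod.lessThan_Suc_shift by (simp add: sum_distrib_left mult_ac)
  finally show ?case .
qed

text \<open>The tuples of trees in \<open>compose\<close> come from expanding one Taylor polynomial
  of g in the single algebra-valued direction Y - y 1. The condition 1 \<le> N secures its term of
  order 0.\<close>

lemma compose_conv_taylor:
  assumes Y: "tree_path d N k Y" and s: "s \<in> {0..1}" and N: "1 \<le> N"
  shows "compose d N k g Y s i = trunc (N - 1)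
     (taylor k N (\<lambda>x. g x i) (fcoeff {#} (Y s)) (\<lambda>i. Y s i - fscale (fcoeff {#} (Y s) i) 1))"
proof -
  let ?y = "fcoeff {#} (Y s)" and ?T = "trees d (N - 1)"
  let ?v = "\<lambda>i. Y s i - fscale (?y i) 1"
  have v: "?v i = (\<Sum>h\<in>?T. fscale (fcoeff {#h#} (Y s) i) (basis {#h#}))" if "i < k" for i
  proof (rule poly_mapping_eqI)
    fix x
    have keys: "Poly_Mapping.keys (Y s i) \<subseteq> trees1 d (N - 1)"
      using Y s that by (auto simp: tree_path_def is_path_def fspace_def)
    have rhs: "Poly_Mapping.lookup (\<Sum>h\<in>?T. fscale (fcoeff {#h#} (Y s) i) (basis {#h#})) x
       = (\<Sum>h\<in>?T. if {#h#} = x then Poly_Mapping.lookup (Y s i) x else 0)"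
      unfolding lookup_sum by (intro sum.cong) (auto simp: lookup_basis fcoeff_def)
    show "Poly_Mapping.lookup (?v i) x = Poly_Mapping.lookup (\<Sum>h\<in>?T. fscale (fcoeff {#h#} (Y s) i) (basis {#h#})) x"
    proof (cases "\<exists>h\<in>?T. x = {#h#}")
      case True
      then obtain h where h: "h \<in> ?T" "x = {#h#}" by auto
      then show ?thesis unfolding rhs by (simp add: lookup_minus lookup_one finite_trees when_def)
    next
      case False
      then have "(\<Sum>h\<in>?T. if {#h#} = x then Poly_Mapping.lookup (Y s i) x else 0) = 0"
        by (intro sum.neutral) auto
      moreover have "Poly_Mapping.lookup (?v i) x = 0"
      proof (cases "x = {#}")
        case False
        then have "x \<notin> Poly_Mapping.keys (Y s i)" using keys \<open>\<not> (\<exists>h\<in>?T. x = {#h#})\<close> by (auto simp: trees1_def)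
        then show ?thesis using False by (simp add: in_keys_iff lookup_minus lookup_one)
      qed (simp add: lookup_minus fcoeff_def lookup_one)
      ultimately show ?thesis unfolding rhs by simp
    qed
  qed
  have L: "(\<Sum>hs\<in>{hs. length hs = p \<and> set hs \<subseteq> ?T}.
            fscale (multi_deriv k (\<lambda>x. g x i) ?y (map (\<lambda>h. fcoeff {#h#} (Y s)) hs)) (basis (mset hs)))
     = lsum k p (\<lambda>is. foldr partial is (\<lambda>x. g x i) ?y) ?v" for p
  proof -
    have "lsum k p (\<lambda>is. foldr partial is (\<lambda>x. g x i) ?y) ?v = (\<Sum>hs\<in>{hs. length hs = p \<and> set hs \<subseteq> ?T}.
      fscale (\<Sum>is\<in>{is. length is = p \<and> set is \<subseteq> {..<k}}. foldr partial is (\<lambda>x. g x i) ?y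
        * (\<Prod>j<p. fcoeff {#hs ! j#} (Y s) (is ! j))) (basis (mset hs)))"
      by (rule lsum_expand) (rule v)
    also have "\<dots> = (\<Sum>hs\<in>{hs. length hs = p \<and> set hs \<subseteq> ?T}.
            fscale (multi_deriv k (\<lambda>x. g x i) ?y (map (\<lambda>h. fcoeff {#h#} (Y s)) hs)) (basis (mset hs)))"
      unfolding multi_deriv_def by (intro sum.cong refl arg_cong2[where f = fscale]) auto
    finally show ?thesis by simp
  qed
  have "taylor k N (\<lambda>x. g x i) ?y ?v = fscale (g ?y i) 1 + (\<Sum>p=1..N - 1. fscale (1 / fact p) (lsum k p (\<lambda>is. foldr partial is (\<lambda>x. g x i) ?y) ?v))"
  proof -
    obtain n where n: "N = Suc n" using N by (cases N) auto
    have "{..<Suc n} = insert 0 {1..n}" by auto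
    then show ?thesis unfolding taylor_def n by simp
  qed
  moreover have "trunc (N - 1) (fscale c 1 + p) = fscale c 1 + trunc (N - 1) p" for c p
    by (rule poly_mapping_eqI) (simp add: trunc_conv_restr lookup_restr lookup_add lookup_one when_def)
  ultimately show ?thesis
    unfolding compose_def L by simp
qed

lemma keys_compose:
  assumes "x \<in> Poly_Mapping.keys (compose d N k g Y s i)"
  shows "x \<in> forests d N" "fverts x \<le> N - 1"
proof -
  let ?p = "\<Sum>p=1..N - 1. fscale (1 / fact p)
         (\<Sum>hs\<in>{hs. length hs = p \<and> set hs \<subseteq> trees d (N - 1)}.
            fscale (multi_deriv k (\<lambda>x. g x i) (fcoeff {#} (Y s)) (map (\<lambda>h. fcoeff {#h#} (Y s)) hs)) (basis (mset hs)))"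
  have "x \<in> Poly_Mapping.keys (1 :: fspan) \<or> x \<in> Poly_Mapping.keys (trunc (N - 1) ?p)"
    using assms unfolding compose_def by (auto dest!: subsetD[OF keys_add] subsetD[OF keys_fscale])
  moreover have "x \<in> forests d N" if p: "x \<in> Poly_Mapping.keys ?p"
  proof -
    obtain hs where "set hs \<subseteq> trees d (N - 1)" "x = mset hs"
      using p by (fastforce dest!: subsetD[OF keys_sum] subsetD[OF keys_fscale])
    moreover have "trees d (N - 1) \<subseteq> trees d N" by (auto simp: trees_def)
    ultimately show ?thesis by (auto simp: forests_def)
  qed
  ultimately show "x \<in> forests d N" "fverts x \<le> N - 1"
    by (auto simp: trunc_conv_restr keys_restr)
qed

section \<open>Bootstrapping and sewing\<close>

text \<open>At the first point where \<phi> reaches c', the bound by c' holds up to there, and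
  \<open>step\<close> then contradicts c < c'. The variable will be the weight in one use and the
  time in another.\<close>

lemma bootstrap:
  fixes \<phi> :: "real \<Rightarrow> real"
  assumes cont: "continuous_on {0..T} \<phi>" and 0: "\<phi> 0 \<le> c" and c: "c < c'"
    and step: "\<And>x. x \<in> {0..T} \<Longrightarrow> (\<And>y. y \<in> {0..x} \<Longrightarrow> \<phi> y \<le> c') \<Longrightarrow> \<phi> x \<le> c"
    and x: "x \<in> {0..T}"
  shows "\<phi> x \<le> c"
proof (rule step[OF x])
  fix y assume y: "y \<in> {0..x}"
  show "\<phi> y \<le> c'"
  proof (rule ccontr)
    assume "\<not> \<phi> y \<le> c'"
    define S where "S = {0..T} \<inter> \<phi> -` {c'..}"
    have "y \<in> S" using y x \<open>\<not> \<phi> y \<le> c'\<close> by (auto simp: S_def)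
    moreover have "closed S"
      unfolding S_def by (rule continuous_closed_preimage[OF cont]) auto
    moreover have "S = {0..T} \<inter> S" by (auto simp: S_def)
    ultimately have "compact S" "S \<noteq> {}" by (metis compact_Icc compact_Int_closed, blast)
    then obtain z where z: "z \<in> S" "\<And>y. y \<in> S \<Longrightarrow> z \<le> y" using compact_attains_inf by meson
    have zT: "z \<in> {0..T}" "c' \<le> \<phi> z" using z(1) by (auto simp: S_def)
    have "continuous_on {0..z} \<phi>" using cont zT by (auto intro: continuous_on_subset)
    then obtain w where w: "0 \<le> w" "w \<le> z" "\<phi> w = c'"
      using IVT'[of \<phi> 0 c' z] 0 c zT by auto
    then have "w = z" using z(2)[of w] zT by (auto simp: S_def)
    have "\<phi> y \<le> c'" if "y \<in> {0..z}" for y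
      using that z(2)[of y] zT w \<open>w = z\<close> by (cases "y = z") (force simp: S_def)+
    then have "\<phi> z \<le> c" by (rule step[OF zT(1)])
    then show False using zT(2) c by simp
  qed
qed

text \<open>The supremum S satisfies S \<le> c + S / 2, and being finite it is at most 2 c.\<close>

lemma Sup_absorb:
  fixes A :: "real set"
  assumes "bdd_above A" "x \<in> A" "\<And>S x. (\<And>y. y \<in> A \<Longrightarrow> y \<le> S) \<Longrightarrow> x \<in> A \<Longrightarrow> x \<le> c + S / 2"
  shows "x \<le> 2 * c"
proof -
  have "\<And>y. y \<in> A \<Longrightarrow> y \<le> Sup A" using assms(1) by (rule cSup_upper[rotated])
  then have "\<And>x. x \<in> A \<Longrightarrow> x \<le> c + Sup A / 2" by (rule assms(3))
  then have "Sup A \<le> c + Sup A / 2" using assms(2) by (intro cSup_least) auto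
  then show ?thesis using \<open>\<And>y. y \<in> A \<Longrightarrow> y \<le> Sup A\<close>[OF assms(2)] by simp
qed

section \<open>Limits over partitions and the sewing estimate\<close>

definition partition_limit :: "(real \<Rightarrow> real \<Rightarrow> real) \<Rightarrow> real \<Rightarrow> real \<Rightarrow> real \<Rightarrow> bool" where
  "partition_limit \<Xi> a b J \<longleftrightarrow>
     (\<forall>e>0. \<exists>\<delta>>0. \<forall>n p.
        p 0 = a \<and> p n = b \<and> (\<forall>j<n. p j < p (Suc j) \<and> p (Suc j) - p j < \<delta>) \<longrightarrow>
        \<bar>(\<Sum>j<n. \<Xi> (p j) (p (Suc j))) - J\<bar> < e)"

text \<open>The partition with n = 0 is admissible for every mesh, and its sum is empty.\<close>

lemma partition_limit_empty:
  assumes "partition_limit \<Xi> a a J"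
  shows "J = 0"
proof (rule ccontr)
  assume "J \<noteq> 0"
  then have "0 < \<bar>J\<bar>" by simp
  from assms[unfolded partition_limit_def, rule_format, OF this]
  obtain \<delta> where "\<forall>n p. p 0 = a \<and> p n = a \<and> (\<forall>j<n. p j < p (Suc j) \<and> p (Suc j) - p j < \<delta>) \<longrightarrow>
        \<bar>(\<Sum>j<n. \<Xi> (p j) (p (Suc j))) - J\<bar> < \<bar>J\<bar>" by blast
  from this[rule_format, of "\<lambda>_. a" 0] show False by simp
qed

lemma exists_fine_partition:
  assumes "0 \<le> s" "0 < \<delta>"
  obtains n and p :: "nat \<Rightarrow> real" where "p 0 = 0" "p n = s" "\<forall>j<n. p j < p (Suc j) \<and> p (Suc j) - p j < \<delta>"
proof (cases "s = 0")
  case True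
  show ?thesis by (rule that[of "\<lambda>_. 0" 0]) (use True in auto)
next
  case False
  obtain n where n: "s / \<delta> < real n" using reals_Archimedean2 by blast
  then have n0: "0 < real n" using assms by (smt (verit) divide_nonneg_pos)
  have d: "s * real (Suc j) / real n - s * real j / real n = s / real n" for j
    using n0 by (simp add: field_simps)
  have "s / real n < \<delta>" "0 < s / real n" using n n0 assms False by (auto simp: field_simps)
  then have "s * real j / real n < s * real (Suc j) / real n \<and> s * real (Suc j) / real n - s * real j / real n < \<delta>" for j
    using d[of j] by linarith
  then show ?thesis using n0
    by (intro that[of "\<lambda>j. s * real j / real n" n]) (auto simp del: of_nat_Suc)
qed

text \<open>Halving all intervals of generation n costs at most 2 ^ n K h ^ \<zeta> with h = (t - s)
  / 2 ^ n, that is K (t - s) ^ \<zeta> q ^ n with q = 2 ^ (1 - \<zeta>) < 1: a geometric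
  series.\<close>

lemma dyadic_sum_le:
  fixes \<Xi> :: "real \<Rightarrow> real \<Rightarrow> real"
  assumes st: "s < t" and \<zeta>: "1 < \<zeta>" and K: "0 \<le> K"
    and defect: "\<And>a b. s \<le> a \<Longrightarrow> a < b \<Longrightarrow> b \<le> t \<Longrightarrow>
       \<bar>\<Xi> a b - \<Xi> a ((a + b) / 2) - \<Xi> ((a + b) / 2) b\<bar> \<le> K * (b - a) powr \<zeta>"
  shows "\<bar>(\<Sum>j<2 ^ n. \<Xi> (s + real j * ((t - s) / 2 ^ n)) (s + real (Suc j) * ((t - s) / 2 ^ n))) - \<Xi> s t\<bar>
     \<le> K / (1 - 2 powr (1 - \<zeta>)) * (t - s) powr \<zeta>"
proof -
  define q :: real where "q = 2 powr (1 - \<zeta>)"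
  have q: "0 < q" "q < 1" using \<zeta> by (auto simp: q_def powr_less_one)
  define h where "h n = (t - s) / 2 ^ n" for n :: nat
  define D where "D n = (\<Sum>j<2 ^ n. \<Xi> (s + real j * h n) (s + real (Suc j) * h n))" for n
  have split: "(\<Sum>j<2 * m. f j) = (\<Sum>j<m. f (2 * j) + f (Suc (2 * j)))" for m and f :: "nat \<Rightarrow> real"
    by (induction m) auto
  have step: "\<bar>D (Suc n) - D n\<bar> \<le> K * (t - s) powr \<zeta> * q ^ n" for n
  proof -
    have hn: "h (Suc n) = h n / 2" "0 < h n" using st by (auto simp: h_def)
    have "\<bar>D (Suc n) - D n\<bar> = \<bar>\<Sum>j<2 ^ n. \<Xi> (s + real j * h n) (s + real (Suc j) * h n)
       - \<Xi> (s + real j * h n) (s + (real j + 1 / 2) * h n) - \<Xi> (s + (real j + 1 / 2) * h n) (s + real (Suc j) * h n)\<bar>"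
    proof -
      have "D (Suc n) = (\<Sum>j<2 ^ n. \<Xi> (s + real j * h n) (s + (real j + 1 / 2) * h n) + \<Xi> (s + (real j + 1 / 2) * h n) (s + real (Suc j) * h n))"
        unfolding D_def power_Suc split hn
        by (intro sum.cong refl arg_cong2[where f = "(+)"] arg_cong2[where f = \<Xi>]) (auto simp: field_simps)
      then show ?thesis
        unfolding D_def by (subst abs_minus_commute) (simp add: sum_subtractf sum.distrib algebra_simps)
    qed
    also have "\<dots> \<le> (\<Sum>j<(2::nat) ^ n. K * h n powr \<zeta>)"
    proof (rule order_trans[OF sum_abs sum_mono])
      fix j assume j: "j \<in> {..<(2::nat) ^ n}"
      then have "real (Suc j) \<le> 2 ^ n" by (metis Suc_leI lessThan_iff of_nat_le_iff of_nat_numeral of_nat_power)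
      then have "real (Suc j) * h n \<le> 2 ^ n * h n" using hn by (intro mult_right_mono) auto
      then have le: "s + real (Suc j) * h n \<le> t" by (simp add: h_def)
      have mid: "(s + real j * h n + (s + real (Suc j) * h n)) / 2 = s + (real j + 1 / 2) * h n"
        by (simp add: field_simps)
      have "s \<le> s + real j * h n" "s + real j * h n < s + real (Suc j) * h n"
        using hn(2) by (auto simp: distrib_right)
      from defect[OF this le] show "\<bar>\<Xi> (s + real j * h n) (s + real (Suc j) * h n)
       - \<Xi> (s + real j * h n) (s + (real j + 1 / 2) * h n) - \<Xi> (s + (real j + 1 / 2) * h n) (s + real (Suc j) * h n)\<bar> \<le> K * h n powr \<zeta>"
        unfolding mid by (simp add: distrib_right)
    qed
    also have "\<dots> = K * (t - s) powr \<zeta> * q ^ n"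
    proof -
      have "h n powr \<zeta> = (t - s) powr \<zeta> * (2 ^ n) powr (- \<zeta>)"
        using st by (simp add: h_def powr_divide powr_minus_divide)
      moreover have "2 ^ n * (2 ^ n) powr (- \<zeta>) = q ^ n"
      proof -
        have "2 ^ n * (2 ^ n) powr (- \<zeta>) = ((2::real) ^ n) powr (1 - \<zeta>)"
          using powr_add[of "(2::real) ^ n" 1 "- \<zeta>"] by simp
        also have "\<dots> = q ^ n" by (simp add: q_def powr_powr powr_power mult.commute flip: powr_realpow)
        finally show ?thesis .
      qed
      ultimately show ?thesis by simp
    qed
    finally show ?thesis .
  qed
  have "\<bar>D n - D 0\<bar> \<le> (\<Sum>i<n. K * (t - s) powr \<zeta> * q ^ i)"
  proof (induction n)
    case (Suc n)
    then show ?case using step[of n] by simp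
  qed simp
  also have "\<dots> \<le> K * (t - s) powr \<zeta> * (1 / (1 - q))"
  proof -
    have "(\<Sum>i<n. q ^ i) \<le> 1 / (1 - q)"
      using q by (simp add: sum_gp_strict divide_right_mono)
    then show ?thesis unfolding sum_distrib_left[symmetric] using K by (intro mult_left_mono) auto
  qed
  finally show ?thesis by (simp add: D_def h_def q_def)
qed

text \<open>The integrals exist by assumption, so only the estimate is at stake and dyadic
  subdivision of [s, t] suffices. In place of additivity of the integral, one fine partition of
  [0, s] is used for \<open>Js\<close> and, continued by the dyadic points of [s, t], for
  \<open>Jt\<close>.\<close>

lemma sewing:
  assumes 0: "0 \<le> s" "s < t" and \<zeta>: "1 < \<zeta>" and K: "0 \<le> K"
    and Js: "partition_limit \<Xi> 0 s Js" and Jt: "partition_limit \<Xi> 0 t Jt"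
    and defect: "\<And>a b. s \<le> a \<Longrightarrow> a < b \<Longrightarrow> b \<le> t \<Longrightarrow>
       \<bar>\<Xi> a b - \<Xi> a ((a + b) / 2) - \<Xi> ((a + b) / 2) b\<bar> \<le> K * (b - a) powr \<zeta>"
  shows "\<bar>Jt - Js - \<Xi> s t\<bar> \<le> K / (1 - 2 powr (1 - \<zeta>)) * (t - s) powr \<zeta>" (is "_ \<le> ?R")
proof (rule field_le_epsilon)
  fix e :: real assume e: "0 < e"
  then have e2: "0 < e / 2" by simp
  obtain \<delta>s where \<delta>s: "\<delta>s > 0" "\<And>n p. p 0 = 0 \<and> p n = s \<and> (\<forall>j<n. p j < p (Suc j) \<and> p (Suc j) - p j < \<delta>s) \<Longrightarrow>
        \<bar>(\<Sum>j<n. \<Xi> (p j) (p (Suc j))) - Js\<bar> < e / 2"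
    using Js e2 unfolding partition_limit_def by meson
  obtain \<delta>t where \<delta>t: "\<delta>t > 0" "\<And>n p. p 0 = 0 \<and> p n = t \<and> (\<forall>j<n. p j < p (Suc j) \<and> p (Suc j) - p j < \<delta>t) \<Longrightarrow>
        \<bar>(\<Sum>j<n. \<Xi> (p j) (p (Suc j))) - Jt\<bar> < e / 2"
    using Jt e2 unfolding partition_limit_def by meson
  define \<delta> where "\<delta> = min \<delta>s \<delta>t"
  have \<delta>: "0 < \<delta>" "\<delta> \<le> \<delta>s" "\<delta> \<le> \<delta>t" using \<delta>s(1) \<delta>t(1) by (auto simp: \<delta>_def)
  obtain m p where p: "p 0 = 0" "p m = s" "\<forall>j<m. p j < p (Suc j) \<and> p (Suc j) - p j < \<delta>"
    using exists_fine_partition[OF 0(1) \<delta>(1)] by blast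
  obtain n where n: "(t - s) / \<delta> < 2 ^ n" using real_arch_pow[of 2 "(t - s) / \<delta>"] by auto
  define h where "h = (t - s) / 2 ^ n"
  have h: "0 < h" "h < \<delta>" using n 0 \<delta> by (auto simp: h_def field_simps)
  define r where "r j = (if j < m then p j else s + real (j - m) * h)" for j
  have r1: "r j = p j" if "j \<le> m" for j using that p by (cases "j = m") (auto simp: r_def)
  have r2: "r (m + j) = s + real j * h" for j by (simp add: r_def)
  have rr: "r 0 = 0" "r (m + 2 ^ n) = t" using r1[of 0] p r2[of "2 ^ n"] by (auto simp: h_def)
  have rmesh: "\<forall>j<m + 2 ^ n. r j < r (Suc j) \<and> r (Suc j) - r j < \<delta>"
  proof (intro allI impI)
    fix j assume "j < m + 2 ^ n"
    show "r j < r (Suc j) \<and> r (Suc j) - r j < \<delta>"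
    proof (cases "j < m")
      case True
      then show ?thesis using p(3) r1[of j] r1[of "Suc j"] by simp
    next
      case False
      then obtain i where "j = m + i" by (metis le_add_diff_inverse linorder_not_less)
      then show ?thesis using r2[of i] r2[of "Suc i"] h by (simp add: distrib_right)
    qed
  qed
  let ?D = "\<Sum>j<2 ^ n. \<Xi> (s + real j * h) (s + real (Suc j) * h)"
  have "(\<Sum>j<m + l. \<Xi> (r j) (r (Suc j))) = (\<Sum>j<m. \<Xi> (r j) (r (Suc j))) + (\<Sum>j<l. \<Xi> (r (m + j)) (r (Suc (m + j))))" for l
    by (induction l) auto
  moreover have "(\<Sum>j<m. \<Xi> (r j) (r (Suc j))) = (\<Sum>j<m. \<Xi> (p j) (p (Suc j)))"
    by (intro sum.cong) (auto simp: r1)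
  moreover have "(\<Sum>j<2 ^ n. \<Xi> (r (m + j)) (r (Suc (m + j)))) = ?D"
    using r2 by (intro sum.cong refl) (metis add_Suc_right)
  ultimately have sum: "(\<Sum>j<m + 2 ^ n. \<Xi> (r j) (r (Suc j))) = (\<Sum>j<m. \<Xi> (p j) (p (Suc j))) + ?D" by simp
  have "\<bar>(\<Sum>j<m. \<Xi> (p j) (p (Suc j))) - Js\<bar> < e / 2"
    using p \<delta> by (intro \<delta>s(2)) force
  moreover have "\<bar>(\<Sum>j<m + 2 ^ n. \<Xi> (r j) (r (Suc j))) - Jt\<bar> < e / 2"
    using rr rmesh \<delta> by (intro \<delta>t(2)) force
  moreover have "\<bar>?D - \<Xi> s t\<bar> \<le> ?R"
    unfolding h_def by (rule dyadic_sum_le[OF 0(2) \<zeta> K defect])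
  ultimately show "\<bar>Jt - Js - \<Xi> s t\<bar> \<le> ?R + e" unfolding sum by linarith
qed

section \<open>Remainders of a solution\<close>

lemma linext_superset:
  assumes "finite S" "Poly_Mapping.keys a \<subseteq> S"
  shows "linext F a = (\<Sum>x\<in>S. fscale (Poly_Mapping.lookup a x) (F x))"
  unfolding linext_def using assms
  by (intro sum.mono_neutral_left) (auto simp: in_keys_iff)

lemma has_rough_integral_conv_partition_limit:
  "has_rough_integral d N X U \<mu> s t J \<longleftrightarrow> partition_limit (germ d N X U \<mu>) s t J"
  by (simp add: has_rough_integral_def partition_limit_def)

lemma vnorm_component_le: "i < k \<Longrightarrow> \<bar>x i\<bar> \<le> vnorm k x"
  unfolding vnorm_def L2_set_def
  by (rule real_le_rsqrt) (use member_le_sum[of i "{..<k}" "\<lambda>i. (x i)\<^sup>2"] in auto)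

lemma fverts_eq_0_iff: "fverts f = 0 \<longleftrightarrow> f = {#}"
  using size_le_fverts[of f] by auto

locale rough_solution =
  fixes m \<alpha> :: real and N d k :: nat and X :: "real \<Rightarrow> real \<Rightarrow> fspan \<Rightarrow> real"
    and \<sigma> :: "nat \<Rightarrow> (nat \<Rightarrow> real) \<Rightarrow> nat \<Rightarrow> real" and y0 :: "nat \<Rightarrow> real"
    and Y :: "real \<Rightarrow> nat \<Rightarrow> fspan" and J :: "nat \<Rightarrow> real \<Rightarrow> nat \<Rightarrow> real"
  assumes N: "1 \<le> N" and d: "1 \<le> d" and k: "1 \<le> k"
    and \<alpha>: "0 < \<alpha>" "real N * \<alpha> \<le> 1" "1 < (real N + 1) * \<alpha>"
    and X: "rough_path \<alpha> d N X" and \<sigma>: "coeff_C d k N \<sigma>" and y0: "y0 \<in> Rn k"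
    and tree: "tree_path d N k Y" and ctrl: "controlled \<alpha> d N k X Y"
    and rough_int: "\<And>s \<mu> i. s \<in> {0..1} \<Longrightarrow> \<mu> \<in> {1..d} \<Longrightarrow> i < k \<Longrightarrow>
      has_rough_integral d N X (\<lambda>r. compose d N k (\<sigma> \<mu>) Y r i) \<mu> 0 s (J \<mu> s i)"
    and eqn: "\<And>s i. s \<in> {0..1} \<Longrightarrow> i < k \<Longrightarrow>
             Y s i =
               fscale (y0 i) 1
               - fscale (integral {0..s} (\<lambda>r. vnorm k (fcoeff {#} (Y r)) powr (m - 1)
                                               * fcoeff {#} (Y r) i)) 1
               + ((\<Sum>\<mu>\<in>{1..d}. fscale (J \<mu> s i) 1)
                  + (\<Sum>\<mu>\<in>{1..d}. \<Sum>f\<in>{f \<in> forests d N. fverts f + 2 \<le> N}.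
                       fscale (fcoeff f (compose d N k (\<sigma> \<mu>) Y s) i) (basis {#Node \<mu> f#})))"
begin

definition y :: "real \<Rightarrow> nat \<Rightarrow> real" where
  "y s = fcoeff {#} (Y s)"

definition v :: "real \<Rightarrow> nat \<Rightarrow> fspan" where
  "v s i = Y s i - fscale (y s i) 1"

definition U :: "nat \<Rightarrow> real \<Rightarrow> nat \<Rightarrow> fspan" where
  "U \<mu> s i = compose d N k (\<sigma> \<mu>) Y s i"

text \<open>The composition before truncation; \<open>gamma\<close> turns it into the Taylor
  polynomial with transformed direction.\<close>

definition G :: "nat \<Rightarrow> real \<Rightarrow> nat \<Rightarrow> fspan" where
  "G \<mu> s i = taylor k N (\<lambda>x. \<sigma> \<mu> x i) (y s) (v s)"

definition b :: "real \<Rightarrow> nat \<Rightarrow> real" where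
  "b s i = integral {0..s} (\<lambda>r. vnorm k (y r) powr (m - 1) * y r i)"

text \<open>The part of U that reappears in Y: after grafting it has at most N - 1 vertices.\<close>

definition PU :: "nat \<Rightarrow> real \<Rightarrow> nat \<Rightarrow> fspan" where
  "PU \<mu> s i = restr (\<lambda>f. fverts f + 2 \<le> N) (U \<mu> s i)"

text \<open>Applied to U at time s, this is the germ of the rough integral; see
  \<open>germ_conv\<close>.\<close>

definition ev :: "nat \<Rightarrow> real \<Rightarrow> real \<Rightarrow> fspan \<Rightarrow> real" where
  "ev \<mu> s t = pairing (\<lambda>f. charf d N (X s t) {#Node \<mu> f#})"

lemma keys_U: "f \<in> Poly_Mapping.keys (U \<mu> s i) \<Longrightarrow> f \<in> forests d N \<and> Suc (fverts f) \<le> N"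
  unfolding U_def using keys_compose[of f] N by fastforce

lemma Y_conv: "Y s i = fscale (y s i) 1 + v s i"
  by (simp add: v_def)

lemma lookup_v_empty [simp]: "Poly_Mapping.lookup (v s i) {#} = 0"
  by (simp add: v_def lookup_minus lookup_one y_def fcoeff_def flip: zero_multiset_def)

lemma y_Rn: "s \<in> {0..1} \<Longrightarrow> y s \<in> Rn k"
  using tree by (auto simp: Rn_iff y_def fcoeff_def tree_path_def is_path_def)

text \<open>A grafted forest is never empty, so the coefficient of the empty forest separates the
  scalar equation from the tree coefficients.\<close>

lemma Y_decomp:
  assumes "s \<in> {0..1}" "i < k"
  shows "y s i = y0 i - b s i + (\<Sum>\<mu>\<in>{1..d}. J \<mu> s i)" and "v s i = (\<Sum>\<mu>\<in>{1..d}. graft \<mu> (PU \<mu> s i))"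
proof -
  let ?S = "{f \<in> forests d N. fverts f + 2 \<le> N}"
  have fin: "finite ?S"
    by (rule finite_subset[OF _ finite_forests_le[of d N N]]) (auto simp: forests_le_def)
  have gr: "(\<Sum>f\<in>?S. fscale (fcoeff f (compose d N k (\<sigma> \<mu>) Y s) i) (basis {#Node \<mu> f#})) = graft \<mu> (PU \<mu> s i)" for \<mu>
  proof -
    have "graft \<mu> (PU \<mu> s i) = (\<Sum>f\<in>?S. fscale (Poly_Mapping.lookup (PU \<mu> s i) f) (basis {#Node \<mu> f#}))"
      unfolding graft_def by (rule linext_superset[OF fin]) (auto simp: PU_def keys_restr dest: keys_U)
    also have "\<dots> = (\<Sum>f\<in>?S. fscale (fcoeff f (compose d N k (\<sigma> \<mu>) Y s) i) (basis {#Node \<mu> f#}))"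
      by (intro sum.cong) (auto simp: PU_def lookup_restr fcoeff_def U_def)
    finally show ?thesis by simp
  qed
  define c where "c = y0 i - b s i + (\<Sum>\<mu>\<in>{1..d}. J \<mu> s i)"
  have Y: "Y s i = fscale c 1 + (\<Sum>\<mu>\<in>{1..d}. graft \<mu> (PU \<mu> s i))"
    unfolding eqn[OF assms] gr by (simp add: c_def b_def y_def fscale_distribs fscale_sum_left)
  then have "y s i = c"
    by (simp add: y_def fcoeff_def lookup_add lookup_sum lookup_one flip: zero_multiset_def)
  then show "y s i = y0 i - b s i + (\<Sum>\<mu>\<in>{1..d}. J \<mu> s i)" "v s i = (\<Sum>\<mu>\<in>{1..d}. graft \<mu> (PU \<mu> s i))"
    using Y by (auto simp: c_def v_def)
qed

lemma U_conv: "s \<in> {0..1} \<Longrightarrow> U \<mu> s i = restr (\<lambda>f. fverts f \<le> N - 1) (G \<mu> s i)"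
  unfolding U_def G_def compose_conv_taylor[OF tree _ N]
  by (simp add: trunc_conv_restr v_def[abs_def] y_def[symmetric])

lemma germ_conv:
  assumes "\<mu> \<in> {1..d}"
  shows "germ d N X (\<lambda>r. compose d N k (\<sigma> \<mu>) Y r i) \<mu> s t = ev \<mu> s t (U \<mu> s i)"
proof -
  have "ev \<mu> s t (U \<mu> s i) = (\<Sum>f\<in>forests_le d N (N - 1). Poly_Mapping.lookup (U \<mu> s i) f * charf d N (X s t) {#Node \<mu> f#})"
    unfolding ev_def by (rule pairing_superset[OF finite_forests_le]) (use keys_U in \<open>fastforce simp: forests_le_def\<close>)
  also have "\<dots> = germ d N X (\<lambda>r. compose d N k (\<sigma> \<mu>) Y r i) \<mu> s t"
    unfolding germ_def using assms N
    by (intro sum.cong) (auto simp: U_def forests_le_def Node_in_trees charf_tree)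
  finally show ?thesis by simp
qed

lemma gamma_v:
  assumes "s \<in> {0..1}" "i < k"
  shows "gamma (charf d N (X s u)) (v s i) = fscale (\<Sum>\<mu>\<in>{1..d}. ev \<mu> s u (PU \<mu> s i)) 1
      + (\<Sum>\<mu>\<in>{1..d}. graft \<mu> (gamma (charf d N (X s u)) (PU \<mu> s i)))"
  unfolding Y_decomp(2)[OF assms] gamma_sum gamma_graft ev_def
  by (simp add: sum.distrib fscale_sum_left)

text \<open>Since \<open>gamma\<close> fixes the unit, this is Y u - gamma (Y s), written in the
  form in which \<open>nrm_taylor_diff\<close> takes its hypothesis on r.\<close>

definition R :: "real \<Rightarrow> real \<Rightarrow> nat \<Rightarrow> fspan" where
  "R s u i = v u i - gamma (charf d N (X s u)) (v s i) + fscale (y u i - y s i) 1"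

text \<open>The tree coefficients of R are grafted comparisons of \<open>PU\<close>. So R is
  governed by its scalar part and by comparisons that carry an additional weight, which lets
  \<open>R_le\<close> close.\<close>

lemma R_conv:
  assumes "s \<in> {0..1}" "u \<in> {0..1}" "i < k"
  shows "R s u i = fscale (remainder X Y {#} s u i) 1
      + (\<Sum>\<mu>\<in>{1..d}. graft \<mu> (PU \<mu> u i - gamma (charf d N (X s u)) (PU \<mu> s i)))"
    and "remainder X Y {#} s u i = y u i - y s i - (\<Sum>\<mu>\<in>{1..d}. ev \<mu> s u (PU \<mu> s i))"
proof -
  have ch: "is_char d N (X s u)" using X assms by (auto simp: rough_path_def)
  have "trees1 d (N - 1) \<subseteq> trees1 d N" by (auto simp: trees1_def trees_def)
  then have Ys: "Y s i \<in> fspace (trees1 d N)"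
    using tree assms by (fastforce simp: tree_path_def is_path_def fspace_def)
  have "remainder X Y {#} s u i = y u i - Poly_Mapping.lookup (gamma (charf d N (X s u)) (Y s i)) {#}"
    unfolding remainder_def tensor_pair_char(1)[OF ch Ys] lookup_conv_pairing[symmetric] by (simp add: y_def)
  also have "Poly_Mapping.lookup (gamma (charf d N (X s u)) (Y s i)) {#} = y s i + (\<Sum>\<mu>\<in>{1..d}. ev \<mu> s u (PU \<mu> s i))"
    unfolding Y_conv[of s i] gamma_add gamma_fscale gamma_v[OF assms(1,3)]
    by (simp add: lookup_add lookup_sum lookup_one flip: zero_multiset_def)
  finally show r: "remainder X Y {#} s u i = y u i - y s i - (\<Sum>\<mu>\<in>{1..d}. ev \<mu> s u (PU \<mu> s i))" by simp
  show "R s u i = fscale (remainder X Y {#} s u i) 1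
      + (\<Sum>\<mu>\<in>{1..d}. graft \<mu> (PU \<mu> u i - gamma (charf d N (X s u)) (PU \<mu> s i)))"
    unfolding R_def gamma_v[OF assms(1,3)] Y_decomp(2)[OF assms(2,3)] r graft_diff sum_subtractf fscale_distribs
    by (simp add: algebra_simps)
qed

text \<open>By Chen's relation the defect of the germ is a comparison of U at the times s and u,
  evaluated on the increment of X over [u, t].\<close>

lemma chen_germ:
  assumes "s \<in> {0..1}" "u \<in> {0..1}" "t \<in> {0..1}" "\<mu> \<in> {1..d}"
  shows "ev \<mu> s t (U \<mu> s i) - ev \<mu> s u (U \<mu> s i) - ev \<mu> u t (U \<mu> u i)
     = - ev \<mu> u t (U \<mu> u i - gamma (charf d N (X s u)) (U \<mu> s i))"
proof -
  have "Poly_Mapping.keys (U \<mu> s i) \<subseteq> {f \<in> forests d N. Suc (fverts f) \<le> N}" using keys_U by auto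
  from chen[OF X assms this] show ?thesis by (simp add: ev_def pairing_diff)
qed

end

section \<open>Local estimates in a weight\<close>

lemma restr_restr: "restr P (restr Q a) = restr (\<lambda>x. P x \<and> Q x) a"
  by (rule poly_mapping_eqI) (simp add: lookup_restr)

lemma nrm_sum_Icc:
  "0 \<le> w \<Longrightarrow> (\<And>\<mu>. \<mu> \<in> {1..d} \<Longrightarrow> nrm w (p \<mu>) \<le> K) \<Longrightarrow> nrm w (\<Sum>\<mu>\<in>{1..d}. p \<mu>) \<le> real d * K"
  for d :: nat
  using nrm_sum_le[of w "{1..d}" p K] by simp

text \<open>Value of the geometric series in \<open>dyadic_sum_le\<close>.\<close>

definition sew_const :: "real \<Rightarrow> real" where
  "sew_const \<zeta> = 1 / (1 - 2 powr (1 - \<zeta>))"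

lemma sew_const_ge_1: "1 < \<zeta> \<Longrightarrow> 1 \<le> sew_const \<zeta>"
  by (simp add: sew_const_def powr_less_one)

text \<open>Everything is normalised to [0, \<tau>], where \<theta> measures X and \<beta> the
  drift. W is convex because \<open>nrm_taylor_diff\<close> bounds derivatives along segments. The
  factor 100 in \<open>small\<close> leaves room for all absorptions.\<close>

locale local_bound = rough_solution +
  fixes \<tau> A B \<theta> \<beta> :: real and W :: "(nat \<Rightarrow> real) set"
  assumes \<tau>: "0 < \<tau>" "\<tau> \<le> 1" and nonneg: "0 \<le> A" "0 < B" "0 \<le> \<theta>" "0 \<le> \<beta>"
    and X_tree: "\<And>s t h. s \<in> {0..\<tau>} \<Longrightarrow> t \<in> {0..\<tau>} \<Longrightarrow> s \<noteq> t \<Longrightarrow> h \<in> trees d N \<Longrightarrow>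
        \<bar>X s t (basis {#h#})\<bar> \<le> (\<theta> * (\<bar>t - s\<bar> / \<tau>) powr \<alpha>) ^ verts h"
    and W_convex: "\<And>x x' l. x \<in> W \<Longrightarrow> x' \<in> W \<Longrightarrow> 0 < l \<Longrightarrow> l < 1 \<Longrightarrow> (\<lambda>i. x i + l * (x' i - x i)) \<in> W"
    and y_in_W: "\<And>s. s \<in> {0..\<tau>} \<Longrightarrow> y s \<in> W"
    and deriv_le: "\<And>x \<mu> i p is. x \<in> W \<Longrightarrow> \<mu> \<in> {1..d} \<Longrightarrow> i < k \<Longrightarrow> p \<le> N \<Longrightarrow> is \<in> idx k p \<Longrightarrow>
        \<bar>foldr partial is (\<lambda>x. \<sigma> \<mu> x i) x\<bar> \<le> A * B ^ p"
    and drift_le: "\<And>s u i. s \<in> {0..\<tau>} \<Longrightarrow> u \<in> {0..\<tau>} \<Longrightarrow> i < k \<Longrightarrow> \<bar>b u i - b s i\<bar> \<le> \<beta> * (\<bar>u - s\<bar> / \<tau>)"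
    and small: "100 * (real k)\<^sup>2 * real d * sew_const ((real N + 1) * \<alpha>) * (A * B * \<theta>) \<le> 1"
begin

abbreviation Cs :: real where "Cs \<equiv> sew_const ((real N + 1) * \<alpha>)"

lemma Cs: "1 \<le> Cs"
  using \<alpha>(3) by (rule sew_const_ge_1)

lemma ABt_nonneg: "0 \<le> A * B * \<theta>"
  using nonneg by simp

lemma small_le:
  assumes "0 \<le> c" "c \<le> (real k)\<^sup>2 * real d * Cs"
  shows "c * (A * B * \<theta>) \<le> 1 / 100"
  using mult_right_mono[OF assms(2) ABt_nonneg] small by simp

lemma kd_ge_1: "1 \<le> real k" "1 \<le> real d"
  using k d by auto

lemma small1: "(real k)\<^sup>2 * real d * (A * B * \<theta>) \<le> 1 / 100"
  using mult_left_mono[OF Cs, of "(real k)\<^sup>2 * real d"] by (intro small_le) auto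

lemma small2: "real k * real d * Cs * (A * B * \<theta>) \<le> 1 / 100"
proof (rule small_le)
  have "real k * (real d * Cs) \<le> (real k)\<^sup>2 * (real d * Cs)"
    using kd_ge_1 Cs by (intro mult_right_mono) (auto simp: power2_eq_square)
  then show "real k * real d * Cs \<le> (real k)\<^sup>2 * real d * Cs" by (simp add: mult_ac)
qed (use Cs in auto)

lemma small3: "real k * real d * (A * B * \<theta>) \<le> 1 / 100"
proof -
  have "real k * real d * 1 * (A * B * \<theta>) \<le> real k * real d * Cs * (A * B * \<theta>)"
    using Cs ABt_nonneg by (intro mult_right_mono mult_left_mono) auto
  then show ?thesis using small2 by simp
qed

lemma in_unit: "s \<in> {0..\<tau>} \<Longrightarrow> s \<in> {0..1}"
  using \<tau> by auto

lemma PU_conv: "s \<in> {0..1} \<Longrightarrow> PU \<mu> s i = restr (\<lambda>f. fverts f + 2 \<le> N) (G \<mu> s i)"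
  unfolding PU_def U_conv restr_restr by (rule arg_cong2[where f = restr]) auto

lemma GU_le:
  assumes "s \<in> {0..\<tau>}" "\<mu> \<in> {1..d}" "i < k" "0 \<le> x" "0 \<le> c" "real k * B * c \<le> 1 / 2"
    and "\<And>i. i < k \<Longrightarrow> nrm x (v s i) \<le> c"
  shows "nrm x (G \<mu> s i) \<le> 2 * A"
  unfolding G_def
  using assms nonneg deriv_le[OF y_in_W[OF assms(1)] assms(2,3)]
  by (intro nrm_taylor[of x A B c]) auto

text \<open>A crude bound c is enough to sum the Taylor series behind \<open>PU\<close>; grafting
  then gains a factor x.\<close>

lemma v_le_aux:
  assumes "s \<in> {0..\<tau>}" "i < k" "0 \<le> x" "0 \<le> c" "real k * B * c \<le> 1 / 2"
    and "\<And>i. i < k \<Longrightarrow> nrm x (v s i) \<le> c"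
  shows "nrm x (v s i) \<le> real d * (x * (2 * A))"
proof -
  have "nrm x (graft \<mu> (PU \<mu> s i)) \<le> x * (2 * A)" if "\<mu> \<in> {1..d}" for \<mu>
    using assms that
    by (intro order_trans[OF nrm_graft] mult_left_mono)
      (auto simp: PU_conv[OF in_unit] intro: order_trans[OF nrm_restr GU_le])
  then show ?thesis
    unfolding Y_decomp(2)[OF in_unit[OF assms(1)] assms(2)]
    by (rule nrm_sum_Icc[OF assms(3)])
qed

(* Continuity in the weight: at weight 0 the norm of v vanishes, and v_le_aux improves a rough
   bound to a better one, so the bound persists up to weight 2 * theta. *)
lemma v_le:
  assumes s: "s \<in> {0..\<tau>}" and i: "i < k"
  shows "nrm (2 * \<theta>) (v s i) \<le> 4 * real d * A * \<theta>"
proof -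
  define \<phi> where "\<phi> x = (\<Sum>i<k. nrm x (v s i))" for x
  define c' where "c' = 1 / (2 * real k * B)"
  define c where "c = real k * (4 * real d * A * \<theta>)"
  have c': "0 < c'" "real k * B * c' = 1 / 2" using kd_ge_1 nonneg by (auto simp: c'_def)
  have "8 * ((real k)\<^sup>2 * real d * (A * B * \<theta>)) < 1" using small1 by simp
  then have cc': "c < c'" using kd_ge_1 nonneg
    by (simp add: c_def c'_def pos_less_divide_eq power2_eq_square mult_ac)
  have le_\<phi>: "nrm x (v s i) \<le> \<phi> x" if "0 \<le> x" "i < k" for x i
    unfolding \<phi>_def using that by (intro member_le_sum) (auto intro: nrm_nonneg)
  have step: "nrm x (v s i) \<le> real d * (x * (2 * A))" if "0 \<le> x" "\<phi> x \<le> c'" "i < k" for x i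
    by (rule v_le_aux[OF s, of i x c']) (use that c' le_\<phi> in \<open>auto intro: order_trans\<close>)
  have dx: "real d * (x * (2 * A)) \<le> 4 * real d * A * \<theta>" if "x \<le> 2 * \<theta>" for x
  proof -
    have "x * (2 * A) \<le> 2 * \<theta> * (2 * A)" using that nonneg by (intro mult_right_mono) auto
    then have "real d * (x * (2 * A)) \<le> real d * (2 * \<theta> * (2 * A))" by (intro mult_left_mono) auto
    then show ?thesis by (simp add: mult_ac)
  qed
  have "\<phi> (2 * \<theta>) \<le> c"
  proof (rule bootstrap[of "2 * \<theta>" \<phi> c c'])
    show "continuous_on {0..2 * \<theta>} \<phi>"
      unfolding \<phi>_def nrm_def by (intro continuous_intros)
    have "nrm 0 (v s i) = 0" for i
      unfolding nrm_def
    proof (intro sum.neutral ballI)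
      fix f assume "f \<in> Poly_Mapping.keys (v s i)"
      then have "f \<noteq> {#}" by (auto simp: in_keys_iff)
      then show "\<bar>Poly_Mapping.lookup (v s i) f\<bar> * 0 ^ fverts f = 0" by (simp flip: fverts_eq_0_iff)
    qed
    then show "\<phi> 0 \<le> c" using nonneg by (simp add: \<phi>_def c_def)
    show "c < c'" by (rule cc')
    fix x assume x: "x \<in> {0..2 * \<theta>}" "\<And>z. z \<in> {0..x} \<Longrightarrow> \<phi> z \<le> c'"
    have "nrm x (v s i) \<le> 4 * real d * A * \<theta>" if "i < k" for i
      using order_trans[OF step[OF _ x(2)[of x] that] dx[of x]] x(1) by auto
    then have "\<phi> x \<le> (\<Sum>i<k. 4 * real d * A * \<theta>)" unfolding \<phi>_def by (intro sum_mono) auto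
    then show "\<phi> x \<le> c" by (simp add: c_def)
  qed (use nonneg in auto)
  then have "\<phi> (2 * \<theta>) \<le> c'" using cc' by simp
  then show ?thesis using order_trans[OF step[of "2 * \<theta>" i] dx[of "2 * \<theta>"]] nonneg i by auto
qed

lemma M0: "real k * B * (4 * real d * A * \<theta>) \<le> 1 / 2"
  using small3 by (simp add: mult_ac)

lemma G_le:
  assumes "s \<in> {0..\<tau>}" "\<mu> \<in> {1..d}" "i < k"
  shows "nrm (2 * \<theta>) (G \<mu> s i) \<le> 2 * A"
  by (rule GU_le[OF assms _ _ M0 v_le[OF assms(1)]]) (use nonneg in auto)

text \<open>Stated for both weights because \<open>gamma\<close> leads from 2 \<theta> l to \<theta>
  l.\<close>

lemma nrm_small_weight:
  assumes "0 \<le> l" "l \<le> 1" "\<And>f. f \<in> Poly_Mapping.keys a \<Longrightarrow> n \<le> fverts f" "nrm (2 * \<theta>) a \<le> K"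
  shows "nrm (2 * (\<theta> * l)) a \<le> l ^ n * K" "nrm (\<theta> * l) a \<le> l ^ n * K"
proof -
  have "nrm (l * (2 * \<theta>)) a \<le> l ^ n * nrm (2 * \<theta>) a"
    using assms nonneg by (intro nrm_scale) auto
  also have "\<dots> \<le> l ^ n * K" using assms by (intro mult_left_mono) auto
  finally show 1: "nrm (2 * (\<theta> * l)) a \<le> l ^ n * K" by (simp add: mult_ac)
  have "nrm (\<theta> * l) a \<le> nrm (2 * (\<theta> * l)) a" using assms nonneg by (intro nrm_mono) auto
  then show "nrm (\<theta> * l) a \<le> l ^ n * K" using 1 by simp
qed

definition ell :: "real \<Rightarrow> real \<Rightarrow> real" where
  "ell s u = (\<bar>u - s\<bar> / \<tau>) powr \<alpha>"

lemma ell_nonneg: "0 \<le> ell s u"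
  by (simp add: ell_def)

lemma ell_le_1: "s \<in> {0..\<tau>} \<Longrightarrow> u \<in> {0..\<tau>} \<Longrightarrow> ell s u \<le> 1"
  unfolding ell_def using \<tau> \<alpha> by (intro powr_le1) (auto simp: field_simps)

lemma ell_mono: "\<bar>u - s\<bar> \<le> \<bar>t - r\<bar> \<Longrightarrow> ell s u \<le> ell r t"
  unfolding ell_def using \<tau> \<alpha> by (intro powr_mono2 divide_right_mono) auto

lemma ell_power: "s \<noteq> u \<Longrightarrow> ell s u ^ n = (\<bar>u - s\<bar> / \<tau>) powr (real n * \<alpha>)"
  unfolding ell_def using \<tau> by (simp add: powr_powr mult.commute flip: powr_realpow)

text \<open>Here N \<alpha> \<le> 1 enters: a Lipschitz term is of the order of the remainder, so
  the drift does not disturb the expansion.\<close>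

lemma length_le_ell: "s \<in> {0..\<tau>} \<Longrightarrow> u \<in> {0..\<tau>} \<Longrightarrow> \<bar>u - s\<bar> / \<tau> \<le> ell s u ^ N"
proof (cases "s = u")
  case False
  assume *: "s \<in> {0..\<tau>}" "u \<in> {0..\<tau>}"
  have "(\<bar>u - s\<bar> / \<tau>) powr 1 \<le> (\<bar>u - s\<bar> / \<tau>) powr (real N * \<alpha>)"
    using * \<tau> \<alpha> False by (intro powr_mono') (auto simp: field_simps)
  then show ?thesis using False \<tau> by (simp add: ell_power)
qed (use ell_nonneg in simp)

text \<open>l only has to dominate \<open>ell s u\<close>, so that \<open>germ_defect_le\<close> can
  measure both halves of an interval by the length of the whole.\<close>

context
  fixes s u l :: real
  assumes su: "s \<in> {0..\<tau>}" "u \<in> {0..\<tau>}" and l: "ell s u \<le> l" "l \<le> 1"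
    and neq: "s \<noteq> u"
begin

lemma l_nonneg: "0 \<le> l"
  using l(1) ell_nonneg[of s u] by simp

lemma weight_nonneg: "0 \<le> \<theta> * l"
  using l_nonneg nonneg by simp

lemma charf_le: "\<bar>charf d N (X s u) f\<bar> \<le> (\<theta> * l) ^ fverts f"
proof (rule charf_bound[OF weight_nonneg])
  fix h assume "h \<in> trees d N"
  then have "\<bar>X s u (basis {#h#})\<bar> \<le> (\<theta> * ell s u) ^ verts h"
    unfolding ell_def by (rule X_tree[OF su neq])
  also have "\<dots> \<le> (\<theta> * l) ^ verts h"
    using l nonneg ell_nonneg by (intro power_mono mult_left_mono) auto
  finally show "\<bar>X s u (basis {#h#})\<bar> \<le> (\<theta> * l) ^ verts h" .
qed

lemma gamma_le: "nrm (\<theta> * l) (gamma (charf d N (X s u)) a) \<le> nrm (2 * (\<theta> * l)) a"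
  by (rule nrm_gamma[OF weight_nonneg charf_le])

lemma ev_le: "\<bar>ev \<mu> s u a\<bar> \<le> \<theta> * l * nrm (\<theta> * l) a"
  unfolding ev_def using charf_le[of "{#Node \<mu> x#}" for x] by (intro pairing_le) simp

text \<open>By multiplicativity, \<open>gamma\<close> applied to G at time s is the Taylor
  polynomial at y s in the direction gamma (v s), so that \<open>nrm_taylor_diff\<close> applies
  with base points y s and y u.\<close>

lemma comparison:
  assumes \<mu>: "\<mu> \<in> {1..d}" and i: "i < k" and r: "\<And>i. i < k \<Longrightarrow> nrm (\<theta> * l) (R s u i) \<le> r"
  shows "nrm (\<theta> * l) (G \<mu> u i - gamma (charf d N (X s u)) (G \<mu> s i)) \<le> A * l ^ N + 3 * A * real k * B * r"
proof -
  obtain n where n: "N = Suc n" using N by (cases N) auto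
  define M where "M = 4 * real d * A * \<theta>"
  let ?\<Gamma> = "gamma (charf d N (X s u))"
  have M: "0 \<le> M" "real k * B * M \<le> 1 / 2" using M0 nonneg by (auto simp: M_def)
  have vkeys: "1 \<le> fverts f" if "f \<in> Poly_Mapping.keys (v t j)" for t j f
  proof -
    have "f \<noteq> {#}" using that by (auto simp: in_keys_iff)
    then have "fverts f \<noteq> 0" by (simp add: fverts_eq_0_iff)
    then show ?thesis by simp
  qed
  have v1: "nrm (\<theta> * l) (v u j) \<le> l * M" "nrm (\<theta> * l) (?\<Gamma> (v s j)) \<le> l * M" if "j < k" for j
  proof -
    have "nrm (\<theta> * l) (v u j) \<le> l ^ 1 * M"
      unfolding M_def by (rule nrm_small_weight(2)[OF l_nonneg l(2) vkeys v_le[OF su(2) that]])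
    moreover have "nrm (2 * (\<theta> * l)) (v s j) \<le> l ^ 1 * M"
      unfolding M_def by (rule nrm_small_weight(1)[OF l_nonneg l(2) vkeys v_le[OF su(1) that]])
    ultimately show "nrm (\<theta> * l) (v u j) \<le> l * M" "nrm (\<theta> * l) (?\<Gamma> (v s j)) \<le> l * M"
      using gamma_le[of "v s j"] by simp_all
  qed
  have r0: "0 \<le> r" using r[OF i] nrm_nonneg[OF weight_nonneg] by (meson order_trans)
  \<comment> \<open>Read off at the empty forest, where v u has no coefficient: y u - y s is the
    scalar part of R plus that of gamma (v s).\<close>
  have q: "\<bar>y u j - y s j\<bar> \<le> r + l * M" if "j < k" for j
  proof -
    have "y u j - y s j = Poly_Mapping.lookup (R s u j) {#} + Poly_Mapping.lookup (?\<Gamma> (v s j)) {#}"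
      by (simp add: R_def lookup_add lookup_minus lookup_one flip: zero_multiset_def)
    then show ?thesis
      using lookup_le_nrm[OF weight_nonneg, of "R s u j"] lookup_le_nrm[OF weight_nonneg, of "?\<Gamma> (v s j)"] r v1(2) that
      by fastforce
  qed
  have "nrm (\<theta> * l) (taylor k (Suc n) (\<lambda>x. \<sigma> \<mu> x i) (y u) (v u) - taylor k (Suc n) (\<lambda>x. \<sigma> \<mu> x i) (y s) (\<lambda>j. ?\<Gamma> (v s j)))
     \<le> A * real k * B * (r + l * M) * (real k * B * (l * M)) ^ n + 2 * A * real k * B * r"
  proof (rule nrm_taylor_diff)
    show "C_diff k (Suc n) (\<lambda>x. \<sigma> \<mu> x i)" using \<sigma> \<mu> i n by (simp add: coeff_C_def)
    show "y s \<in> Rn k" "y u \<in> Rn k" using y_Rn[OF in_unit[OF su(1)]] y_Rn[OF in_unit[OF su(2)]] .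
    show "\<bar>foldr partial is (\<lambda>x. \<sigma> \<mu> x i) (\<lambda>j. y s j + t * (y u j - y s j))\<bar> \<le> A * B ^ p"
      if "0 < t" "t < 1" "p \<le> Suc n" "is \<in> idx k p" for t p "is"
      using that W_convex[OF y_in_W[OF su(1)] y_in_W[OF su(2)]] \<mu> i n by (intro deriv_le) auto
    show "real k * B * (l * M) \<le> 1 / 2"
    proof -
      have "l * (real k * B * M) \<le> 1 * (real k * B * M)" using l M nonneg by (intro mult_right_mono) auto
      then show ?thesis using M by (simp add: mult_ac)
    qed
  qed (use v1 q r l_nonneg M nonneg r0 weight_nonneg in \<open>auto simp: R_def\<close>)
  \<comment> \<open>The top-order term splits along q = r + l M. Its r part joins the two linear
    terms, whence the 3; its M part is A (k B M l) ^ N.\<close>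
  also have "\<dots> \<le> A * l ^ N + 3 * A * real k * B * r"
  proof -
    define z where "z = real k * B * M"
    have z: "0 \<le> z" "z \<le> 1" using M nonneg by (auto simp: z_def)
    have zl: "0 \<le> z * l" "z * l \<le> 1" "z * l \<le> l" using z l l_nonneg by (auto simp: mult_le_one mult_left_le_one_le)
    have "A * real k * B * (r + l * M) * (real k * B * (l * M)) ^ n
      = A * real k * B * r * (z * l) ^ n + A * (z * l) ^ N"
      by (simp add: n z_def algebra_simps)
    moreover have "A * real k * B * r * (z * l) ^ n \<le> A * real k * B * r"
      using zl nonneg r0 by (intro mult_right_le_one_le) (auto simp: power_le_one)
    moreover have "A * (z * l) ^ N \<le> A * l ^ N" using zl nonneg by (intro mult_left_mono power_mono) auto
    moreover have "2 * A * real k * B * r = 2 * (A * real k * B * r)" "3 * A * real k * B * r = 3 * (A * real k * B * r)"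
      by simp_all
    ultimately show ?thesis by linarith
  qed
  finally show ?thesis by (simp only: G_def gamma_taylor flip: n)
qed

text \<open>The discarded forests have at least N - 1 vertices; the missing power of l will come
  from grafting.\<close>

lemma G_minus_PU_le:
  assumes "t \<in> {0..\<tau>}" "\<mu> \<in> {1..d}" "i < k"
  shows "nrm (2 * (\<theta> * l)) (G \<mu> t i - PU \<mu> t i) \<le> l ^ (N - 1) * (2 * A)"
    "nrm (\<theta> * l) (G \<mu> t i - PU \<mu> t i) \<le> l ^ (N - 1) * (2 * A)"
proof -
  have "nrm (2 * \<theta>) (G \<mu> t i - PU \<mu> t i) \<le> 2 * A"
    unfolding PU_conv[OF in_unit[OF assms(1)]] using nonneg by (intro order_trans[OF nrm_diff_restr G_le[OF assms]]) auto
  moreover have "N - 1 \<le> fverts f" if "f \<in> Poly_Mapping.keys (G \<mu> t i - PU \<mu> t i)" for f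
    using that by (auto simp: PU_conv[OF in_unit[OF assms(1)]] in_keys_iff lookup_minus lookup_restr split: if_splits)
  ultimately show "nrm (2 * (\<theta> * l)) (G \<mu> t i - PU \<mu> t i) \<le> l ^ (N - 1) * (2 * A)"
    "nrm (\<theta> * l) (G \<mu> t i - PU \<mu> t i) \<le> l ^ (N - 1) * (2 * A)"
    using nrm_small_weight[OF l_nonneg l(2)] by blast+
qed

lemma G_minus_U_le:
  assumes "t \<in> {0..\<tau>}" "\<mu> \<in> {1..d}" "i < k"
  shows "nrm (2 * (\<theta> * l)) (G \<mu> t i - U \<mu> t i) \<le> l ^ N * (2 * A)"
    "nrm (\<theta> * l) (G \<mu> t i - U \<mu> t i) \<le> l ^ N * (2 * A)"
proof -
  have "nrm (2 * \<theta>) (G \<mu> t i - U \<mu> t i) \<le> 2 * A"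
    unfolding U_conv[OF in_unit[OF assms(1)]] using nonneg by (intro order_trans[OF nrm_diff_restr G_le[OF assms]]) auto
  moreover have "N \<le> fverts f" if "f \<in> Poly_Mapping.keys (G \<mu> t i - U \<mu> t i)" for f
    using that by (auto simp: U_conv[OF in_unit[OF assms(1)]] in_keys_iff lookup_minus lookup_restr split: if_splits)
  ultimately show "nrm (2 * (\<theta> * l)) (G \<mu> t i - U \<mu> t i) \<le> l ^ N * (2 * A)"
    "nrm (\<theta> * l) (G \<mu> t i - U \<mu> t i) \<le> l ^ N * (2 * A)"
    using nrm_small_weight[OF l_nonneg l(2)] by blast+
qed

text \<open>Passes from untruncated to truncated elements at the price of both truncation errors;
  the one at time s goes through \<open>gamma\<close> and is therefore measured in the doubled
  weight.\<close>

lemma truncated_comparison: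
  assumes "nrm (\<theta> * l) (g - gamma (charf d N (X s u)) h) \<le> K"
    and "nrm (\<theta> * l) (g - p) \<le> L" "nrm (2 * (\<theta> * l)) (h - q) \<le> L"
  shows "nrm (\<theta> * l) (p - gamma (charf d N (X s u)) q) \<le> K + 2 * L"
proof -
  let ?\<Gamma> = "gamma (charf d N (X s u))"
  have "p - ?\<Gamma> q = ((g - ?\<Gamma> h) - (g - p)) + ?\<Gamma> (h - q)" by (simp add: gamma_diff)
  then have "nrm (\<theta> * l) (p - ?\<Gamma> q) \<le> nrm (\<theta> * l) ((g - ?\<Gamma> h) - (g - p)) + nrm (\<theta> * l) (?\<Gamma> (h - q))"
    using nrm_triangle[OF weight_nonneg] by (simp only:)
  also have "\<dots> \<le> (nrm (\<theta> * l) (g - ?\<Gamma> h) + nrm (\<theta> * l) (g - p)) + nrm (\<theta> * l) (?\<Gamma> (h - q))"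
    by (intro add_right_mono nrm_diff weight_nonneg)
  finally show ?thesis using assms gamma_le[of "h - q"] by linarith
qed

text \<open>The tree part of R carries \<theta> l times comparisons that are linear in R, with total
  factor 3 k d A B \<theta> \<le> 1 / 2, and is absorbed. The same l restores the power lost in
  \<open>G_minus_PU_le\<close>.\<close>

lemma R_le:
  assumes \<rho>: "\<And>i. i < k \<Longrightarrow> \<bar>remainder X Y {#} s u i\<bar> \<le> \<rho>" and i: "i < k"
  shows "nrm (\<theta> * l) (R s u i) \<le> 2 * \<rho> + 10 * real d * A * \<theta> * l ^ N"
proof -
  let ?\<Gamma> = "gamma (charf d N (X s u))"
  \<comment> \<open>A maximum over finitely many components, hence finite without any a priori
    bound.\<close>
  define r where "r = Max ((\<lambda>i. nrm (\<theta> * l) (R s u i)) ` {..<k})"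
  have r: "nrm (\<theta> * l) (R s u i) \<le> r" if "i < k" for i
    unfolding r_def using that by (intro Max_ge) auto
  have r0: "0 \<le> r" using r[OF i] nrm_nonneg[OF weight_nonneg] by (meson order_trans)
  have lN: "l * l ^ (N - 1) = l ^ N" using N by (cases N) auto
  have "nrm (\<theta> * l) (R s u j) \<le> \<rho> + 5 * real d * A * \<theta> * l ^ N + r / 2" if j: "j < k" for j
  proof -
    have "nrm (\<theta> * l) (graft \<mu> (PU \<mu> u j - ?\<Gamma> (PU \<mu> s j))) \<le> \<theta> * l * (A * l ^ N + 3 * A * real k * B * r + 2 * (l ^ (N - 1) * (2 * A)))"
      if \<mu>: "\<mu> \<in> {1..d}" for \<mu>
      by (intro order_trans[OF nrm_graft] mult_left_mono truncated_comparison[OF comparison[OF \<mu> j r]]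
           G_minus_PU_le \<mu> j su weight_nonneg)
    then have "nrm (\<theta> * l) (\<Sum>\<mu>\<in>{1..d}. graft \<mu> (PU \<mu> u j - ?\<Gamma> (PU \<mu> s j)))
      \<le> real d * (\<theta> * l * (A * l ^ N + 3 * A * real k * B * r + 2 * (l ^ (N - 1) * (2 * A))))"
      by (rule nrm_sum_Icc[OF weight_nonneg])
    also have "\<dots> = real d * A * \<theta> * (l * l ^ N) + l * (3 * (real k * real d * (A * B * \<theta>)) * r) + 4 * (real d * A * \<theta> * (l * l ^ (N - 1)))"
      by (simp add: algebra_simps)
    also have "\<dots> \<le> real d * A * \<theta> * l ^ N + 3 * (real k * real d * (A * B * \<theta>)) * r + 4 * (real d * A * \<theta> * l ^ N)"
      unfolding lN using l l_nonneg nonneg r0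
      by (intro add_mono mult_left_mono mult_left_le_one_le order_refl) auto
    also have "3 * (real k * real d * (A * B * \<theta>)) * r \<le> 1 / 2 * r"
      using small3 r0 by (intro mult_right_mono) auto
    finally have 1: "nrm (\<theta> * l) (\<Sum>\<mu>\<in>{1..d}. graft \<mu> (PU \<mu> u j - ?\<Gamma> (PU \<mu> s j))) \<le> 5 * real d * A * \<theta> * l ^ N + r / 2"
      by (simp add: mult_ac)
    have "nrm (\<theta> * l) (R s u j) \<le> \<bar>remainder X Y {#} s u j\<bar> + nrm (\<theta> * l) (\<Sum>\<mu>\<in>{1..d}. graft \<mu> (PU \<mu> u j - ?\<Gamma> (PU \<mu> s j)))"
      unfolding R_conv(1)[OF in_unit[OF su(1)] in_unit[OF su(2)] j]
      by (rule order_trans[OF nrm_triangle[OF weight_nonneg]]) (simp add: nrm_fscale)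
    then show ?thesis using 1 \<rho>[OF j] by linarith
  qed
  then have "r \<le> \<rho> + 5 * real d * A * \<theta> * l ^ N + r / 2"
    unfolding r_def using i by (intro Max.boundedI) auto
  then show ?thesis using r[OF i] by simp
qed

lemma U_comparison:
  assumes \<mu>: "\<mu> \<in> {1..d}" and i: "i < k" and \<rho>: "\<And>i. i < k \<Longrightarrow> \<bar>remainder X Y {#} s u i\<bar> \<le> \<rho>"
  shows "nrm (\<theta> * l) (U \<mu> u i - gamma (charf d N (X s u)) (U \<mu> s i))
     \<le> 5 * A * l ^ N + 3 * A * real k * B * (2 * \<rho> + 10 * real d * A * \<theta> * l ^ N)"
proof -
  have "nrm (\<theta> * l) (U \<mu> u i - gamma (charf d N (X s u)) (U \<mu> s i))
     \<le> A * l ^ N + 3 * A * real k * B * (2 * \<rho> + 10 * real d * A * \<theta> * l ^ N) + 2 * (l ^ N * (2 * A))"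
    by (intro truncated_comparison[OF comparison[OF \<mu> i R_le[OF \<rho>]]] G_minus_U_le \<mu> i su)
  then show ?thesis by simp
qed

text \<open>Forests with N - 1 vertices occur in the germ but are not grafted in Y; the root added
  by \<open>ev\<close> makes their contribution of order l ^ N.\<close>

lemma ev_top_le:
  assumes "\<mu> \<in> {1..d}" "i < k"
  shows "\<bar>ev \<mu> s u (U \<mu> s i) - ev \<mu> s u (PU \<mu> s i)\<bar> \<le> 2 * A * \<theta> * l ^ N"
proof -
  have U2: "nrm (2 * \<theta>) (U \<mu> s i) \<le> 2 * A"
    unfolding U_conv[OF in_unit[OF su(1)]] using nonneg by (intro order_trans[OF nrm_restr G_le[OF su(1) assms]]) auto
  have "nrm (2 * \<theta>) (U \<mu> s i - PU \<mu> s i) \<le> 2 * A"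
    unfolding PU_def using nonneg by (intro order_trans[OF nrm_diff_restr U2]) auto
  moreover have "N - 1 \<le> fverts f" if "f \<in> Poly_Mapping.keys (U \<mu> s i - PU \<mu> s i)" for f
    using that by (auto simp: PU_def in_keys_iff lookup_minus lookup_restr split: if_splits)
  ultimately have "nrm (\<theta> * l) (U \<mu> s i - PU \<mu> s i) \<le> l ^ (N - 1) * (2 * A)"
    using nrm_small_weight[OF l_nonneg l(2)] by blast
  then have "\<theta> * l * nrm (\<theta> * l) (U \<mu> s i - PU \<mu> s i) \<le> \<theta> * l * (l ^ (N - 1) * (2 * A))"
    using weight_nonneg by (intro mult_left_mono)
  also have "\<dots> = 2 * A * \<theta> * l ^ N" using N by (cases N) auto
  finally show ?thesis
    using ev_le[of \<mu> "U \<mu> s i - PU \<mu> s i"] by (simp add: ev_def pairing_diff)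
qed

lemma ev_U_le:
  assumes "\<mu> \<in> {1..d}" "i < k"
  shows "\<bar>ev \<mu> s u (U \<mu> s i)\<bar> \<le> 2 * A * \<theta>"
proof -
  have "nrm (2 * \<theta>) (U \<mu> s i) \<le> 2 * A"
    unfolding U_conv[OF in_unit[OF su(1)]] using nonneg by (intro order_trans[OF nrm_restr G_le[OF su(1) assms]]) auto
  then have "nrm (\<theta> * l) (U \<mu> s i) \<le> l ^ 0 * (2 * A)"
    by (intro nrm_small_weight[OF l_nonneg l(2)]) auto
  then have "\<theta> * l * nrm (\<theta> * l) (U \<mu> s i) \<le> \<theta> * 1 * (2 * A)"
    using weight_nonneg l l_nonneg nonneg nrm_nonneg[OF weight_nonneg] by (intro mult_mono) auto
  then show ?thesis using ev_le[of \<mu> "U \<mu> s i"] by (simp add: mult_ac)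
qed

end

end

section \<open>The sewing error and the bound on the rough integral\<close>

context local_bound begin

definition rough_error :: "real \<Rightarrow> real \<Rightarrow> nat \<Rightarrow> real" where
  "rough_error s u i = (\<Sum>\<mu>\<in>{1..d}. J \<mu> u i - J \<mu> s i - ev \<mu> s u (U \<mu> s i))"

text \<open>The integral over [s, u] is the germ plus the sewing error, whereas the remainder
  subtracts only the \<open>PU\<close> part of the germ; the top-order terms are left over.\<close>

lemma remainder_conv:
  assumes "s \<in> {0..1}" "u \<in> {0..1}" "i < k"
  shows "remainder X Y {#} s u i = - (b u i - b s i) + rough_error s u i
     + (\<Sum>\<mu>\<in>{1..d}. ev \<mu> s u (U \<mu> s i) - ev \<mu> s u (PU \<mu> s i))"
  unfolding R_conv(2)[OF assms] Y_decomp(1)[OF assms(1,3)] Y_decomp(1)[OF assms(2,3)] rough_error_def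
  by (simp add: sum_subtractf)

lemma ev_top_sum_le:
  assumes "s \<in> {0..\<tau>}" "u \<in> {0..\<tau>}" "i < k" "s \<noteq> u"
  shows "\<bar>\<Sum>\<mu>\<in>{1..d}. ev \<mu> s u (U \<mu> s i) - ev \<mu> s u (PU \<mu> s i)\<bar> \<le> 2 * real d * A * \<theta> * ell s u ^ N"
proof -
  have "\<bar>\<Sum>\<mu>\<in>{1..d}. ev \<mu> s u (U \<mu> s i) - ev \<mu> s u (PU \<mu> s i)\<bar> \<le> (\<Sum>\<mu>\<in>{1..d}. 2 * A * \<theta> * ell s u ^ N)"
    using assms ev_top_le[OF assms(1,2) order_refl ell_le_1[OF assms(1,2)] assms(4)]
    by (intro order_trans[OF sum_abs] sum_mono) auto
  then show ?thesis by (simp add: mult_ac)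
qed

lemma drift_ell:
  assumes "s \<in> {0..\<tau>}" "u \<in> {0..\<tau>}" "i < k"
  shows "\<bar>b u i - b s i\<bar> \<le> \<beta> * ell s u ^ N"
  using drift_le[OF assms] mult_left_mono[OF length_le_ell[OF assms(1,2)] nonneg(4)] by simp

lemma remainder_le:
  assumes "s \<in> {0..\<tau>}" "u \<in> {0..\<tau>}" "i < k" "s \<noteq> u" "\<bar>rough_error s u i\<bar> \<le> S * ell s u ^ N"
  shows "\<bar>remainder X Y {#} s u i\<bar> \<le> (\<beta> + S + 2 * real d * A * \<theta>) * ell s u ^ N"
proof -
  have "\<bar>remainder X Y {#} s u i\<bar> \<le> \<beta> * ell s u ^ N + S * ell s u ^ N + 2 * real d * A * \<theta> * ell s u ^ N"
    unfolding remainder_conv[OF in_unit[OF assms(1)] in_unit[OF assms(2)] assms(3)]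
    using assms(5) drift_ell[OF assms(1-3)] ev_top_sum_le[OF assms(1-4)] by linarith
  then show ?thesis by (simp add: distrib_right)
qed

(* The control condition says nothing about increments of length 1, so they are excluded from the
   supremum; the sewing argument only uses midpoint subdivisions, which are shorter. *)
definition short_pairs :: "(real \<times> real) set" where
  "short_pairs = {(s, u). 0 \<le> s \<and> s < u \<and> u \<le> \<tau> \<and> u - s < 1}"

text \<open>\<open>ev\<close> gains \<theta> l over the comparison of U. This lifts the exponent
  from N to N + 1 and, as (N + 1) \<alpha> > 1, makes sewing possible. The unknown S enters
  linearly, through the remainder over [s, u].\<close>

lemma germ_defect_le:
  assumes S: "\<And>s u i. (s, u) \<in> short_pairs \<Longrightarrow> i < k \<Longrightarrow> \<bar>rough_error s u i\<bar> \<le> S * ell s u ^ N" "0 \<le> S"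
    and st: "0 \<le> s" "s < t" "t \<le> \<tau>" and \<mu>: "\<mu> \<in> {1..d}" and i: "i < k" and u: "u = (s + t) / 2"
  shows "\<bar>ev \<mu> s t (U \<mu> s i) - ev \<mu> s u (U \<mu> s i) - ev \<mu> u t (U \<mu> u i)\<bar>
     \<le> A * \<theta> * (6 + 6 * (real k * B * \<beta>) + 6 * (real k * B * S)) * ell s t ^ Suc N"
proof -
  define l where "l = ell s t"
  define \<rho> where "\<rho> = (\<beta> + S + 2 * real d * A * \<theta>) * l ^ N"
  have m: "s \<in> {0..\<tau>}" "u \<in> {0..\<tau>}" "t \<in> {0..\<tau>}" "s < u" "u < t" using st u by auto
  have su: "(s, u) \<in> short_pairs" using st u \<tau> by (auto simp: short_pairs_def)
  have l: "0 \<le> l" "l \<le> 1" "ell s u \<le> l" "ell u t \<le> l"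
    using ell_le_1[OF m(1,3)] m ell_nonneg by (auto simp: l_def intro: ell_mono)
  have \<rho>: "\<bar>remainder X Y {#} s u j\<bar> \<le> \<rho>" if "j < k" for j
  proof -
    have "\<bar>remainder X Y {#} s u j\<bar> \<le> (\<beta> + S + 2 * real d * A * \<theta>) * ell s u ^ N"
      by (rule remainder_le[OF m(1,2) that _ S(1)[OF su that]]) (use m in simp)
    also have "\<dots> \<le> \<rho>"
      unfolding \<rho>_def using l ell_nonneg nonneg S(2) by (intro mult_left_mono power_mono) auto
    finally show ?thesis .
  qed
  have "\<bar>ev \<mu> s t (U \<mu> s i) - ev \<mu> s u (U \<mu> s i) - ev \<mu> u t (U \<mu> u i)\<bar>
     = \<bar>ev \<mu> u t (U \<mu> u i - gamma (charf d N (X s u)) (U \<mu> s i))\<bar>"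
    using chen_germ[OF in_unit[OF m(1)] in_unit[OF m(2)] in_unit[OF m(3)] \<mu>] by simp
  also have "\<dots> \<le> \<theta> * l * nrm (\<theta> * l) (U \<mu> u i - gamma (charf d N (X s u)) (U \<mu> s i))"
    by (rule ev_le[OF m(2,3) l(4,2)]) (use m in simp)
  also have "\<dots> \<le> \<theta> * l * (5 * A * l ^ N + 3 * A * real k * B * (2 * \<rho> + 10 * real d * A * \<theta> * l ^ N))"
    using U_comparison[OF m(1,2) l(3,2) _ \<mu> i \<rho>] m l nonneg by (intro mult_left_mono) auto
  \<comment> \<open>42 = 12 + 30, from the top-order terms in \<rho> and from
    \<open>U_comparison\<close>; \<open>small3\<close> bounds this contribution by 42 / 100, which
    turns 5 into 6.\<close>
  also have "\<dots> = A * \<theta> * (5 + 6 * (real k * B * \<beta>) + 6 * (real k * B * S) + 42 * (real k * real d * (A * B * \<theta>))) * l ^ Suc N"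
    by (simp add: \<rho>_def algebra_simps)
  also have "\<dots> \<le> A * \<theta> * (6 + 6 * (real k * B * \<beta>) + 6 * (real k * B * S)) * l ^ Suc N"
    using small3 nonneg l by (intro mult_right_mono mult_left_mono) auto
  finally show ?thesis by (simp add: l_def)
qed

text \<open>One round of the absorption: the part of the sewing bound linear in S has the factor 6 k
  d Cs A B \<theta> \<le> 1 / 2. Pairs at distance 1 are covered in the conclusion, since the bound
  S is applied to half intervals.\<close>

lemma rough_error_le:
  assumes S: "\<And>s u i. (s, u) \<in> short_pairs \<Longrightarrow> i < k \<Longrightarrow> \<bar>rough_error s u i\<bar> \<le> S * ell s u ^ N" "0 \<le> S"
    and st: "0 \<le> s" "s < t" "t \<le> \<tau>" and i: "i < k"
  shows "\<bar>rough_error s t i\<bar> \<le> (6 * real d * Cs * (A * \<theta>) * (1 + real k * B * \<beta>) + S / 2) * ell s t ^ N"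
proof -
  define \<zeta> where "\<zeta> = (real N + 1) * \<alpha>"
  define K where "K = A * \<theta> * (6 + 6 * (real k * B * \<beta>) + 6 * (real k * B * S))"
  have K: "0 \<le> K" unfolding K_def using nonneg S(2) by (intro mult_nonneg_nonneg add_nonneg_nonneg) auto
  have m: "s \<in> {0..\<tau>}" "t \<in> {0..\<tau>}" using st by auto
  have pw: "ell a c ^ Suc N = (c - a) powr \<zeta> / \<tau> powr \<zeta>" if "a < c" for a c
    unfolding \<zeta>_def using that \<tau> by (subst ell_power) (auto simp: powr_divide add.commute)
  have one: "\<bar>J \<mu> t i - J \<mu> s i - ev \<mu> s t (U \<mu> s i)\<bar> \<le> Cs * K * ell s t ^ N" if \<mu>: "\<mu> \<in> {1..d}" for \<mu>
  proof -
    let ?\<Xi> = "germ d N X (\<lambda>r. compose d N k (\<sigma> \<mu>) Y r i) \<mu>"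
    have "\<bar>J \<mu> t i - J \<mu> s i - ?\<Xi> s t\<bar> \<le> K / \<tau> powr \<zeta> / (1 - 2 powr (1 - \<zeta>)) * (t - s) powr \<zeta>"
    proof (rule sewing)
      show "1 < \<zeta>" using \<alpha> by (simp add: \<zeta>_def)
      show "partition_limit ?\<Xi> 0 s (J \<mu> s i)" "partition_limit ?\<Xi> 0 t (J \<mu> t i)"
        using rough_int[OF in_unit[OF m(1)] \<mu> i] rough_int[OF in_unit[OF m(2)] \<mu> i]
        by (simp_all add: has_rough_integral_conv_partition_limit)
      fix a c assume ac: "s \<le> a" "a < c" "c \<le> t"
      have "\<bar>?\<Xi> a c - ?\<Xi> a ((a + c) / 2) - ?\<Xi> ((a + c) / 2) c\<bar> \<le> K * ell a c ^ Suc N"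
        unfolding germ_conv[OF \<mu>] K_def using ac st by (intro germ_defect_le[OF S _ _ _ \<mu> i]) auto
      also have "\<dots> = K / \<tau> powr \<zeta> * (c - a) powr \<zeta>" using pw[OF ac(2)] by simp
      finally show "\<bar>?\<Xi> a c - ?\<Xi> a ((a + c) / 2) - ?\<Xi> ((a + c) / 2) c\<bar> \<le> K / \<tau> powr \<zeta> * (c - a) powr \<zeta>" .
    qed (use st K in auto)
    also have "\<dots> = Cs * K * ell s t ^ Suc N"
      unfolding pw[OF st(2)] sew_const_def by (simp add: \<zeta>_def)
    \<comment> \<open>The spare power of \<open>ell\<close> is given up in order to return to the
      form of the hypothesis on S.\<close>
    also have "\<dots> \<le> Cs * K * ell s t ^ N"
      using Cs K ell_le_1[OF m] ell_nonneg by (intro mult_left_mono power_decreasing) auto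
    finally show ?thesis by (simp add: germ_conv[OF \<mu>])
  qed
  have "\<bar>rough_error s t i\<bar> \<le> (\<Sum>\<mu>\<in>{1..d}. Cs * K * ell s t ^ N)"
    unfolding rough_error_def by (intro order_trans[OF sum_abs] sum_mono one)
  also have "\<dots> = (6 * real d * Cs * (A * \<theta>) * (1 + real k * B * \<beta>) + 6 * (real k * real d * Cs * (A * B * \<theta>)) * S) * ell s t ^ N"
    by (simp add: K_def algebra_simps)
  also have "\<dots> \<le> (6 * real d * Cs * (A * \<theta>) * (1 + real k * B * \<beta>) + 1 / 2 * S) * ell s t ^ N"
    using small2 S(2) ell_nonneg by (intro mult_right_mono add_left_mono) auto
  finally show ?thesis by simp
qed

text \<open>The bound depends on the solution, through the constant L of the control condition; its
  finiteness is what starts the absorption.\<close>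

lemma rough_error_bdd:
  "bdd_above ((\<lambda>((s, u), i). \<bar>rough_error s u i\<bar> / ell s u ^ N) ` (short_pairs \<times> {..<k}))"
proof -
  let ?P = "{(s, t). s \<in> {0..1} \<and> t \<in> {0..1} \<and> 0 < \<bar>s - t\<bar> \<and> \<bar>s - t\<bar> < (1::real)}"
  have "{#} \<in> forests_le d N (N - 1)" by (simp add: forests_le_def)
  from bspec[OF ctrl[unfolded controlled_def] this] have "bdd_above ((\<lambda>(s, t). vnorm k (remainder X Y {#} s t) / \<bar>t - s\<bar> powr ((real N - real (fverts ({#} :: forest))) * \<alpha>)) ` ?P)"
    .
  then obtain L where L: "\<And>z. z \<in> ?P \<Longrightarrow> (\<lambda>(s, t). vnorm k (remainder X Y {#} s t) / \<bar>t - s\<bar> powr ((real N - real (fverts ({#} :: forest))) * \<alpha>)) z \<le> L"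
    unfolding bdd_above_def by blast
  define K where "K = \<bar>L\<bar> + \<beta> + 2 * real d * A * \<theta>"
  have "\<bar>rough_error s u i\<bar> / ell s u ^ N \<le> K" if su: "(s, u) \<in> short_pairs" and i: "i < k" for s u i
  proof -
    have m: "s \<in> {0..\<tau>}" "u \<in> {0..\<tau>}" "s < u" "u - s < 1" using su by (auto simp: short_pairs_def)
    have pos: "0 < ell s u ^ N" using m \<tau> by (simp add: ell_def)
    have "(s, u) \<in> ?P" using m \<tau> by auto
    from L[OF this] have "vnorm k (remainder X Y {#} s u) / (u - s) powr (real N * \<alpha>) \<le> L" using m by simp
    then have "vnorm k (remainder X Y {#} s u) \<le> L * (u - s) powr (real N * \<alpha>)"
      using m by (simp add: pos_divide_le_eq)
    then have "\<bar>remainder X Y {#} s u i\<bar> \<le> \<bar>L\<bar> * (u - s) powr (real N * \<alpha>)"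
      using vnorm_component_le[OF i, of "remainder X Y {#} s u"] mult_right_mono[OF abs_ge_self[of L], of "(u - s) powr (real N * \<alpha>)"]
      by simp
    also have "\<dots> \<le> \<bar>L\<bar> * ell s u ^ N"
    proof (intro mult_left_mono)
      have "u - s \<le> (u - s) / \<tau>" using m \<tau> by (simp add: pos_le_divide_eq mult_left_le)
      then have "(u - s) powr (real N * \<alpha>) \<le> ((u - s) / \<tau>) powr (real N * \<alpha>)"
        using m \<alpha> by (intro powr_mono2) auto
      then show "(u - s) powr (real N * \<alpha>) \<le> ell s u ^ N" using m by (simp add: ell_power)
    qed auto
    finally have "\<bar>rough_error s u i\<bar> \<le> \<bar>L\<bar> * ell s u ^ N + \<beta> * ell s u ^ N + 2 * real d * A * \<theta> * ell s u ^ N"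
      using remainder_conv[OF in_unit[OF m(1)] in_unit[OF m(2)] i] drift_ell[OF m(1,2) i] ev_top_sum_le[OF m(1,2) i] m(3)
      by linarith
    also have "\<dots> = K * ell s u ^ N" by (simp add: K_def distrib_right)
    finally show ?thesis using pos by (simp add: pos_divide_le_eq)
  qed
  then show ?thesis by (intro bdd_aboveI[of _ K]) auto
qed

lemma rough_error_bound:
  assumes "0 \<le> s" "s < t" "t \<le> \<tau>" "i < k"
  shows "\<bar>rough_error s t i\<bar> \<le> 12 * real d * Cs * (A * \<theta>) * (1 + real k * B * \<beta>)"
proof -
  define c where "c = 6 * real d * Cs * (A * \<theta>) * (1 + real k * B * \<beta>)"
  let ?A = "(\<lambda>((s, u), i). \<bar>rough_error s u i\<bar> / ell s u ^ N) ` (short_pairs \<times> {..<k})"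
  have c: "0 \<le> c" unfolding c_def using nonneg Cs by (intro mult_nonneg_nonneg add_nonneg_nonneg) auto
  have pos: "0 < ell s u ^ N" if "(s, u) \<in> short_pairs" for s u
    using that \<tau> by (auto simp: short_pairs_def ell_def)
  have "z \<le> 2 * c" if z: "z \<in> ?A" for z
  proof (rule Sup_absorb[OF rough_error_bdd z])
    fix S x assume S: "\<And>y. y \<in> ?A \<Longrightarrow> y \<le> S" and x: "x \<in> ?A"
    have S1: "\<bar>rough_error s u i\<bar> \<le> S * ell s u ^ N" if "(s, u) \<in> short_pairs" "i < k" for s u i
    proof -
      have "\<bar>rough_error s u i\<bar> / ell s u ^ N \<le> S" using that by (intro S) force
      then show ?thesis using pos[OF that(1)] by (simp add: pos_divide_le_eq)
    qed
    obtain s u i where sui: "(s, u) \<in> short_pairs" "i < k" "x = \<bar>rough_error s u i\<bar> / ell s u ^ N" using x by auto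
    have "0 \<le> x" using sui pos[OF sui(1)] by simp
    then have "0 \<le> S" using S[OF x] by simp
    from rough_error_le[OF S1 this, of s u i] sui(1,2)
    have "\<bar>rough_error s u i\<bar> \<le> (c + S / 2) * ell s u ^ N" by (auto simp: short_pairs_def c_def)
    then show "x \<le> c + S / 2" using pos[OF sui(1)] sui(3) by (simp add: pos_divide_le_eq)
  qed
  then have "\<bar>rough_error s u i\<bar> / ell s u ^ N \<le> 2 * c" if "(s, u) \<in> short_pairs" "i < k" for s u i
    using that by force
  then have "\<bar>rough_error s u i\<bar> \<le> 2 * c * ell s u ^ N" if "(s, u) \<in> short_pairs" "i < k" for s u i
    using pos that by (simp add: pos_divide_le_eq)
  \<comment> \<open>A last round of \<open>rough_error_le\<close> extends the bound from short pairs
    to a pair at distance 1.\<close>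
  then have "\<bar>rough_error s t i\<bar> \<le> (c + 2 * c / 2) * ell s t ^ N"
    unfolding c_def using c[unfolded c_def] by (intro rough_error_le assms) auto
  also have "\<dots> \<le> 2 * c * 1"
    using assms c ell_nonneg ell_le_1[of s t] by (intro mult_mono power_le_one) auto
  finally show ?thesis by (simp add: c_def)
qed

text \<open>The integral over [0, t] is the sewing error plus the germ at time 0, which is of order
  A \<theta>; these account for 12 and 2 in the constant 14.\<close>

theorem rough_integral_bound:
  assumes t: "t \<in> {0..\<tau>}" and i: "i < k"
  shows "\<bar>\<Sum>\<mu>\<in>{1..d}. J \<mu> t i\<bar> \<le> 14 * real d * real k * Cs * (A * \<theta>) * (1 + B * \<beta>)"
proof -
  have J0: "J \<mu> 0 i = 0" if "\<mu> \<in> {1..d}" for \<mu>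
    using rough_int[of 0 \<mu> i] that i partition_limit_empty by (auto simp: has_rough_integral_conv_partition_limit)
  have Bb: "0 \<le> B * \<beta>" using nonneg by simp
  have At: "0 \<le> A * \<theta>" using nonneg by simp
  show ?thesis
  proof (cases "t = 0")
    case True
    then show ?thesis using J0 Bb At Cs by simp
  next
    case False
    have m: "0 \<in> {0..\<tau>}" "0 < t" using t False by auto
    have "(\<Sum>\<mu>\<in>{1..d}. J \<mu> t i) = rough_error 0 t i + (\<Sum>\<mu>\<in>{1..d}. ev \<mu> 0 t (U \<mu> 0 i))"
      unfolding rough_error_def sum.distrib[symmetric] by (intro sum.cong) (auto simp: J0)
    moreover have "\<bar>\<Sum>\<mu>\<in>{1..d}. ev \<mu> 0 t (U \<mu> 0 i)\<bar> \<le> (\<Sum>\<mu>\<in>{1..d}. 2 * A * \<theta>)"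
      using ev_U_le[OF m(1) t order_refl ell_le_1[OF m(1) t]] m i
      by (intro order_trans[OF sum_abs] sum_mono) auto
    ultimately have "\<bar>\<Sum>\<mu>\<in>{1..d}. J \<mu> t i\<bar> \<le> 12 * real d * Cs * (A * \<theta>) * (1 + real k * B * \<beta>) + 2 * real d * (A * \<theta>)"
      using rough_error_bound[OF _ m(2) _ i] t by (simp add: mult_ac)
    also have "\<dots> \<le> 12 * real d * Cs * (A * \<theta>) * (real k * (1 + B * \<beta>)) + 2 * real d * (A * \<theta>) * (Cs * real k * (1 + B * \<beta>))"
    proof (intro add_mono mult_left_mono)
      show "1 + real k * B * \<beta> \<le> real k * (1 + B * \<beta>)" using kd_ge_1 by (simp add: distrib_left mult.assoc)
      have "1 * 1 * 1 \<le> Cs * real k * (1 + B * \<beta>)" using Cs kd_ge_1 Bb by (intro mult_mono) auto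
      then have "2 * real d * (A * \<theta>) * 1 \<le> 2 * real d * (A * \<theta>) * (Cs * real k * (1 + B * \<beta>))"
        using At by (intro mult_left_mono) auto
      then show "2 * real d * (A * \<theta>) \<le> 2 * real d * (A * \<theta>) * (Cs * real k * (1 + B * \<beta>))" by simp
    qed (use Cs At in auto)
    also have "\<dots> = 14 * real d * real k * Cs * (A * \<theta>) * (1 + B * \<beta>)" by (simp add: algebra_simps)
    finally show ?thesis .
  qed
qed

end

section \<open>Growth of solutions\<close>

lemma vnorm_nonneg [simp]: "0 \<le> vnorm k x"
  by (simp add: vnorm_def)

lemma vnorm_add_le: "vnorm k (\<lambda>i. x i + z i) \<le> vnorm k x + vnorm k z"
  unfolding vnorm_def by (rule L2_set_triangle_ineq)

lemma vnorm_cong: "(\<And>i. i < k \<Longrightarrow> x i = z i) \<Longrightarrow> vnorm k x = vnorm k z"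
  unfolding vnorm_def by (intro L2_set_cong) auto

lemma vnorm_minus: "vnorm k (\<lambda>i. - x i) = vnorm k x"
  by (simp add: vnorm_def L2_set_def)

lemma vnorm_scale: "vnorm k (\<lambda>i. c * x i) = \<bar>c\<bar> * vnorm k x"
  by (simp add: vnorm_def L2_set_def power_mult_distrib real_sqrt_mult flip: sum_distrib_left)

lemma vnorm_le_card: "(\<And>i. i < k \<Longrightarrow> \<bar>x i\<bar> \<le> c) \<Longrightarrow> vnorm k x \<le> real k * c"
  unfolding vnorm_def
  by (rule order_trans[OF L2_set_le_sum_abs]) (use sum_bounded_above[of "{..<k}" "\<lambda>i. \<bar>x i\<bar>" c] in auto)

lemma bracket_ge_1: "1 \<le> bracket k x"
  by (simp add: bracket_def)

lemma vnorm_le_bracket: "vnorm k x \<le> bracket k x"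
  unfolding bracket_def by (rule real_le_rsqrt) simp

text \<open>The bracket is the Euclidean norm of (1, x), so this is the triangle inequality for (1,
  x) + (0, z).\<close>

lemma bracket_add_le: "bracket k (\<lambda>i. x i + z i) \<le> bracket k x + vnorm k z"
proof -
  have "bracket k (\<lambda>i. x i + z i) \<le> sqrt ((1 + 0)\<^sup>2 + (vnorm k x + vnorm k z)\<^sup>2)"
    unfolding bracket_def using vnorm_add_le[of k x z] by (intro real_sqrt_le_mono add_mono power_mono) auto
  also have "\<dots> \<le> sqrt (1\<^sup>2 + (vnorm k x)\<^sup>2) + sqrt (0\<^sup>2 + (vnorm k z)\<^sup>2)"
    by (rule real_sqrt_sum_squares_triangle_ineq)
  finally show ?thesis by (simp add: bracket_def)
qed

lemma bracket_diff_le: "bracket k x \<le> bracket k z + vnorm k (\<lambda>i. x i - z i)"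
  using bracket_add_le[of k z "\<lambda>i. x i - z i"] by simp

lemma hoelder_bound:
  assumes X: "rough_path \<alpha> d N X" and h: "h \<in> trees d N" and st: "s \<in> {0..1}" "t \<in> {0..1}" "s \<noteq> t"
  shows "\<bar>X s t (basis {#h#})\<bar> \<le> enn2real (hoelder \<alpha> X {#h#}) * \<bar>t - s\<bar> powr (\<alpha> * real (verts h))"
proof -
  let ?q = "\<bar>X s t (basis {#h#})\<bar> / \<bar>s - t\<bar> powr (\<alpha> * real (fverts {#h#}))"
  have "ennreal ?q \<le> hoelder \<alpha> X {#h#}"
    unfolding hoelder_def using st by (intro SUP_upper2[of "(s, t)"]) auto
  moreover have "hoelder \<alpha> X {#h#} < top" using X h by (auto simp: rough_path_def top.not_eq_extremum)
  ultimately have "enn2real (ennreal ?q) \<le> enn2real (hoelder \<alpha> X {#h#})" by (rule enn2real_mono)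
  then have "?q \<le> enn2real (hoelder \<alpha> X {#h#})" by simp
  then show ?thesis using st by (simp add: pos_divide_le_eq abs_minus_commute)
qed

lemma tendsto_abs_powr_0:
  fixes s c :: real
  assumes "0 < c"
  shows "((\<lambda>t. \<bar>t - s\<bar> powr c) \<longlongrightarrow> 0) (at s within A)"
proof -
  have "((\<lambda>t. \<bar>t - s\<bar> powr c) \<longlongrightarrow> \<bar>s - s\<bar> powr c) (at s within A)"
    using assms by (intro tendsto_powr' tendsto_intros) auto
  then show ?thesis by simp
qed

section \<open>Continuity of the underlying path and size of the drift\<close>

context rough_solution begin

lemma tendsto_charf_tree:
  assumes s: "s \<in> {0..1}"
  shows "((\<lambda>t. charf d N (X s t) {#h#}) \<longlongrightarrow> 0) (at s within {0..1})"
proof (cases "h \<in> trees d N")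
  case True
  let ?H = "enn2real (hoelder \<alpha> X {#h#})"
  have "0 < verts h" by (cases h) simp
  then have "((\<lambda>t. \<bar>t - s\<bar> powr (\<alpha> * real (verts h))) \<longlongrightarrow> 0) (at s within {0..1})"
    using \<alpha> by (intro tendsto_abs_powr_0) simp
  then have lim: "((\<lambda>t. ?H * \<bar>t - s\<bar> powr (\<alpha> * real (verts h))) \<longlongrightarrow> 0) (at s within {0..1})"
    by (rule tendsto_mult_right_zero)
  have "norm (charf d N (X s t) {#h#}) \<le> ?H * \<bar>t - s\<bar> powr (\<alpha> * real (verts h))" if "t \<in> {0..1}" "t \<noteq> s" for t
    using hoelder_bound[OF X True s that(1) that(2)[symmetric]] charf_tree[OF True] by simp
  then have "\<forall>\<^sub>F t in at s within {0..1}. norm (charf d N (X s t) {#h#}) \<le> ?H * \<bar>t - s\<bar> powr (\<alpha> * real (verts h))"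
    by (simp add: eventually_at_filter)
  then show ?thesis using lim by (rule Lim_null_comparison)
qed (simp add: charf_not_tree)

text \<open>By \<open>R_conv\<close>, y t - y s is the increment of X over [s, t] paired with
  elements fixed at time s, plus the controlled remainder; both tend to 0.\<close>

lemma y_continuous:
  assumes i: "i < k"
  shows "continuous_on {0..1} (\<lambda>t. y t i)"
  unfolding continuous_on_def
proof
  fix s :: real assume s: "s \<in> {0..1}"
  let ?F = "at s within {0..1}"
  have ev: "((\<lambda>t. ev \<mu> s t a) \<longlongrightarrow> 0) ?F" for \<mu> a
    unfolding ev_def pairing_def by (intro tendsto_null_sum tendsto_mult_right_zero tendsto_charf_tree s)
  let ?P = "{(s, t). s \<in> {0..1} \<and> t \<in> {0..1} \<and> 0 < \<bar>s - t\<bar> \<and> \<bar>s - t\<bar> < (1::real)}"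
  have "{#} \<in> forests_le d N (N - 1)" by (simp add: forests_le_def)
  from bspec[OF ctrl[unfolded controlled_def] this]
  obtain L where L: "\<And>z. z \<in> ?P \<Longrightarrow> (\<lambda>(s, t). vnorm k (remainder X Y {#} s t) / \<bar>t - s\<bar> powr ((real N - real (fverts ({#} :: forest))) * \<alpha>)) z \<le> L"
    unfolding bdd_above_def by blast
  have R: "((\<lambda>t. remainder X Y {#} s t i) \<longlongrightarrow> 0) ?F"
  proof (rule Lim_null_comparison)
    have "((\<lambda>t. L * \<bar>t - s\<bar> powr (real N * \<alpha>)) \<longlongrightarrow> L * 0) ?F"
      using N \<alpha> by (intro tendsto_mult tendsto_const tendsto_abs_powr_0) auto
    then show "((\<lambda>t. L * \<bar>t - s\<bar> powr (real N * \<alpha>)) \<longlongrightarrow> 0) ?F" by simp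
    have "\<forall>\<^sub>F t in ?F. dist t s < 1" unfolding eventually_at by (intro exI[of _ 1]) auto
    moreover have "\<forall>\<^sub>F t in ?F. t \<in> {0..1} \<and> t \<noteq> s" by (simp add: eventually_at_filter)
    ultimately show "\<forall>\<^sub>F t in ?F. norm (remainder X Y {#} s t i) \<le> L * \<bar>t - s\<bar> powr (real N * \<alpha>)"
    proof eventually_elim
      case (elim t)
      have "(s, t) \<in> ?P" using elim s by (auto simp: dist_real_def)
      from L[OF this] have "vnorm k (remainder X Y {#} s t) \<le> L * \<bar>t - s\<bar> powr (real N * \<alpha>)"
        using elim by (simp add: pos_divide_le_eq)
      then show ?case using vnorm_component_le[OF i, of "remainder X Y {#} s t"] by simp
    qed
  qed
  have "((\<lambda>t. y s i + (\<Sum>\<mu>\<in>{1..d}. ev \<mu> s t (PU \<mu> s i)) + remainder X Y {#} s t i) \<longlongrightarrow> y s i + 0 + 0) ?F"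
    by (intro tendsto_add tendsto_const tendsto_null_sum ev R)
  moreover have "\<forall>\<^sub>F t in ?F. y s i + (\<Sum>\<mu>\<in>{1..d}. ev \<mu> s t (PU \<mu> s i)) + remainder X Y {#} s t i = y t i"
    unfolding eventually_at_filter using R_conv(2)[OF s _ i] by (intro always_eventually) auto
  ultimately show "((\<lambda>t. y t i) \<longlongrightarrow> y s i) ?F"
    by (simp add: tendsto_cong)
qed

lemma vnorm_continuous:
  "continuous_on {0..1} (\<lambda>t. vnorm k (\<lambda>i. y t i - c i))"
  unfolding vnorm_def L2_set_def by (intro continuous_intros y_continuous) auto

abbreviation drift_field :: "nat \<Rightarrow> real \<Rightarrow> real" where
  "drift_field i r \<equiv> vnorm k (y r) powr (m - 1) * y r i"

lemma drift_field_continuous: "1 < m \<Longrightarrow> i < k \<Longrightarrow> continuous_on {0..1} (drift_field i)"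
  using vnorm_continuous[of "\<lambda>_. 0"] by (intro continuous_on_mult continuous_on_powr' continuous_on_const y_continuous) auto

lemma drift_field_integrable:
  "1 < m \<Longrightarrow> i < k \<Longrightarrow> 0 \<le> s \<Longrightarrow> t \<le> 1 \<Longrightarrow> drift_field i integrable_on {s..t}"
  by (rule integrable_continuous_real, rule continuous_on_subset[OF drift_field_continuous]) auto

lemma y_0: "i < k \<Longrightarrow> y 0 i = y0 i"
proof -
  assume i: "i < k"
  have "J \<mu> 0 i = 0" if "\<mu> \<in> {1..d}" for \<mu>
    using rough_int[of 0 \<mu> i] that i partition_limit_empty by (auto simp: has_rough_integral_conv_partition_limit)
  then show ?thesis using Y_decomp(1)[of 0 i] i by (simp add: b_def)
qed

context
  fixes \<tau> K :: real
  assumes m: "1 < m" and \<tau>: "0 \<le> \<tau>" "\<tau> \<le> 1" and K: "\<And>r. r \<in> {0..\<tau>} \<Longrightarrow> vnorm k (y r) \<le> K"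
begin

lemma K_nonneg: "0 \<le> K"
  using order_trans[OF vnorm_nonneg K[of 0]] \<tau> by simp

lemma drift_field_le: "r \<in> {0..\<tau>} \<Longrightarrow> vnorm k (y r) powr (m - 1) * vnorm k (y r) \<le> K powr (m - 1) * K"
  using K m by (intro mult_mono powr_mono2) auto

lemma drift_increment_le:
  assumes "s \<in> {0..\<tau>}" "u \<in> {0..\<tau>}" "i < k"
  shows "\<bar>b u i - b s i\<bar> \<le> K powr (m - 1) * K * \<bar>u - s\<bar>"
proof -
  have *: "\<bar>b u i - b s i\<bar> \<le> K powr (m - 1) * K * (u - s)" if su: "0 \<le> s" "s \<le> u" "u \<le> \<tau>" for s u
  proof -
    have "b u i = b s i + integral {s..u} (drift_field i)"
      unfolding b_def by (rule Henstock_Kurzweil_Integration.integral_combine[symmetric, OF _ _ drift_field_integrable[OF m assms(3)]]) (use su \<tau> in auto)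
    moreover have "norm (integral {s..u} (drift_field i)) \<le> K powr (m - 1) * K * (u - s)"
    proof (rule integral_bound[OF su(2)])
      show "continuous_on {s..u} (drift_field i)"
        using su \<tau> by (intro continuous_on_subset[OF drift_field_continuous[OF m assms(3)]]) auto
      fix r assume r: "r \<in> {s..u}"
      have "norm (drift_field i r) \<le> vnorm k (y r) powr (m - 1) * vnorm k (y r)"
        using vnorm_component_le[OF assms(3), of "y r"] by (simp add: abs_mult mult_left_mono)
      also have "\<dots> \<le> K powr (m - 1) * K" using r su by (intro drift_field_le) auto
      finally show "norm (drift_field i r) \<le> K powr (m - 1) * K" .
    qed
    ultimately show ?thesis by simp
  qed
  show ?thesis using *[of s u] *[of u s] assms by (cases "s \<le> u") (auto simp: abs_minus_commute)
qed

text \<open>Duality: testing the integral with its own value and applying Cauchy-Schwarz bounds the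
  Euclidean norm without a dimensional constant, so that the threshold for \<epsilon>1 can depend on
  m alone.\<close>

lemma drift_vnorm_le: "vnorm k (b \<tau>) \<le> K powr (m - 1) * K * \<tau>"
proof -
  let ?D = "K powr (m - 1) * K" and ?v = "vnorm k (b \<tau>)"
  let ?f = "\<lambda>r. \<Sum>i<k. b \<tau> i * drift_field i r"
  have cont: "continuous_on {0..\<tau>} ?f"
    using \<tau> by (intro continuous_on_sum continuous_on_mult continuous_on_const continuous_on_subset[OF drift_field_continuous[OF m]]) auto
  have "integral {0..\<tau>} ?f = (\<Sum>i<k. integral {0..\<tau>} (\<lambda>r. b \<tau> i * drift_field i r))"
    using \<tau> m by (intro integral_sum) (auto intro!: integrable_on_mult_right drift_field_integrable)
  also have "\<dots> = (\<Sum>i<k. b \<tau> i * b \<tau> i)" by (simp add: b_def)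
  also have "\<dots> = ?v * ?v"
    by (simp add: vnorm_def L2_set_def power2_eq_square sum_nonneg)
  finally have eq: "integral {0..\<tau>} ?f = ?v * ?v" .
  have "norm (integral {0..\<tau>} ?f) \<le> (?v * ?D) * (\<tau> - 0)"
  proof (rule integral_bound[OF \<tau>(1) cont])
    fix r assume r: "r \<in> {0..\<tau>}"
    have "norm (?f r) \<le> (\<Sum>i<k. \<bar>b \<tau> i\<bar> * \<bar>drift_field i r\<bar>)"
      by (simp add: sum_abs abs_mult flip: abs_mult)
    also have "\<dots> \<le> ?v * vnorm k (\<lambda>i. drift_field i r)"
      unfolding vnorm_def by (rule L2_set_mult_ineq)
    also have "vnorm k (\<lambda>i. drift_field i r) = vnorm k (y r) powr (m - 1) * vnorm k (y r)"
      by (simp add: vnorm_scale)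
    also have "?v * \<dots> \<le> ?v * ?D" by (intro mult_left_mono drift_field_le r) simp
    finally show "norm (?f r) \<le> ?v * ?D" .
  qed
  then have "?v * ?v \<le> ?v * (?D * \<tau>)" unfolding eq by (simp add: mult.assoc)
  moreover have "0 \<le> ?D * \<tau>" using K_nonneg \<tau> by simp
  ultimately show ?thesis
    by (cases "?v = 0") (auto simp: mult_le_cancel_left)
qed

end

text \<open>Continuity in time for the distance from y0. \<open>1 \<le> M * B\<close> is what both
  cases share: it turns the factor 1 + B \<beta> of the rough part into a multiple of M B, and
  smallness of A B \<theta> then leaves a fraction of M.\<close>

theorem bracket_growth:
  fixes T A B \<theta> M :: real
  defines "M \<equiv> bracket k y0"
  assumes m: "1 < m" and T: "0 \<le> T" "T \<le> 1" and T1: "T * M powr (m - 1) \<le> 1 / (8 * 2 powr m)"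
    and AB: "0 \<le> A" "0 < B" "1 \<le> M * B" and \<theta>: "0 \<le> \<theta>"
    and XT: "\<And>\<tau> s t h. 0 < \<tau> \<Longrightarrow> \<tau> \<le> T \<Longrightarrow> s \<in> {0..\<tau>} \<Longrightarrow> t \<in> {0..\<tau>} \<Longrightarrow> s \<noteq> t \<Longrightarrow> h \<in> trees d N \<Longrightarrow>
        \<bar>X s t (basis {#h#})\<bar> \<le> (\<theta> * (\<bar>t - s\<bar> / \<tau>) powr \<alpha>) ^ verts h"
    and deriv: "\<And>x \<mu> i p is. x \<in> Rn k \<Longrightarrow> vnorm k (\<lambda>i. x i - y0 i) \<le> M / 2 \<Longrightarrow> \<mu> \<in> {1..d} \<Longrightarrow> i < k \<Longrightarrow> p \<le> N \<Longrightarrow> is \<in> idx k p \<Longrightarrow>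
        \<bar>foldr partial is (\<lambda>x. \<sigma> \<mu> x i) x\<bar> \<le> A * B ^ p"
    and small: "100 * (real k)\<^sup>2 * real d * sew_const ((real N + 1) * \<alpha>) * (A * B * \<theta>) \<le> 1"
  shows "bracket k (y T) \<le> 2 * M"
proof -
  have M: "1 \<le> M" by (simp add: M_def bracket_ge_1)
  define \<phi> where "\<phi> t = vnorm k (\<lambda>i. y t i - y0 i)" for t
  have "\<phi> 0 = vnorm k (\<lambda>_. 0)" unfolding \<phi>_def by (rule vnorm_cong) (simp add: y_0)
  then have \<phi>0: "\<phi> 0 = 0" using vnorm_scale[of k 0 "\<lambda>_. 0"] by simp
  \<comment> \<open>41 / 100 exceeds the sum of 28 / 100 for the rough integral and 1 / 8 for the
    drift, and stays below the 1 / 2 that is assumed.\<close>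
  have "\<phi> T \<le> 41 / 100 * M"
  proof (rule bootstrap[of T \<phi> _ "M / 2"])
    show "continuous_on {0..T} \<phi>"
      unfolding \<phi>_def using T by (intro continuous_on_subset[OF vnorm_continuous]) auto
    fix \<tau> assume \<tau>: "\<tau> \<in> {0..T}" and le: "\<And>r. r \<in> {0..\<tau>} \<Longrightarrow> \<phi> r \<le> M / 2"
    show "\<phi> \<tau> \<le> 41 / 100 * M"
    proof (cases "\<tau> = 0")
      case True
      then show ?thesis using \<phi>0 M by simp
    next
      case False
      then have \<tau>0: "0 < \<tau>" "0 \<le> \<tau>" "\<tau> \<le> T" "\<tau> \<le> 1" using \<tau> T by auto
      have K: "vnorm k (y r) \<le> 2 * M" if "r \<in> {0..\<tau>}" for r
        using vnorm_add_le[of k y0 "\<lambda>i. y r i - y0 i"] le[OF that] vnorm_le_bracket[of k y0] M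
        by (simp add: \<phi>_def M_def)
      define \<beta> where "\<beta> = (2 * M) powr (m - 1) * (2 * M) * \<tau>"
      \<comment> \<open>The constant in the bound on T is chosen for this: with norms at most 2 M,
        the drift over [0, \<tau>] is at most 2 ^ m M ^ m \<tau>.\<close>
      have \<beta>: "0 \<le> \<beta>" "\<beta> \<le> M / 8"
      proof -
        show "0 \<le> \<beta>" using M \<tau>0 by (simp add: \<beta>_def)
        have "\<beta> = 2 powr m * M * (\<tau> * M powr (m - 1))"
          using M by (simp add: \<beta>_def powr_mult powr_diff)
        also have "\<dots> \<le> 2 powr m * M * (T * M powr (m - 1))"
          using M \<tau>0 by (intro mult_left_mono mult_right_mono) auto
        also have "\<dots> \<le> 2 powr m * M * (1 / (8 * 2 powr m))" using T1 M by (intro mult_left_mono) auto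
        finally show "\<beta> \<le> M / 8" by simp
      qed
      define W where "W = {x \<in> Rn k. vnorm k (\<lambda>i. x i - y0 i) \<le> M / 2}"
      \<comment> \<open>The region is known to contain the path only up to \<tau>, hence a separate
        interpretation, normalised to [0, \<tau>], for each \<tau>.\<close>
      interpret lb: local_bound m \<alpha> N d k X \<sigma> y0 Y J \<tau> A B \<theta> \<beta> W
      proof unfold_locales
        show "(\<lambda>i. x i + l * (x' i - x i)) \<in> W" if "x \<in> W" "x' \<in> W" "0 < l" "l < 1" for x x' l
        proof -
          have "vnorm k (\<lambda>i. x i + l * (x' i - x i) - y0 i) = vnorm k (\<lambda>i. (1 - l) * (x i - y0 i) + l * (x' i - y0 i))"
            by (rule vnorm_cong) (simp add: algebra_simps)
          also have "\<dots> \<le> (1 - l) * vnorm k (\<lambda>i. x i - y0 i) + l * vnorm k (\<lambda>i. x' i - y0 i)"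
            using that by (intro order_trans[OF vnorm_add_le]) (simp add: vnorm_scale)
          also have "\<dots> \<le> (1 - l) * (M / 2) + l * (M / 2)"
            using that by (intro add_mono mult_left_mono) (auto simp: W_def)
          also have "\<dots> = M / 2" by (simp add: field_simps)
          finally show ?thesis using that by (simp add: W_def Rn_iff)
        qed
        show "y s \<in> W" if "s \<in> {0..\<tau>}" for s
          using y_Rn[of s] le[OF that] that \<tau>0 by (simp add: W_def \<phi>_def)
        show "\<bar>b u i - b s i\<bar> \<le> \<beta> * (\<bar>u - s\<bar> / \<tau>)" if "s \<in> {0..\<tau>}" "u \<in> {0..\<tau>}" "i < k" for s u i
          using drift_increment_le[OF m \<tau>0(2,4) K that] \<tau>0 by (simp add: \<beta>_def)
      qed (use \<tau>0 AB \<theta> \<beta> XT deriv small in \<open>auto simp: W_def\<close>)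
      let ?Z = "\<lambda>i. \<Sum>\<mu>\<in>{1..d}. J \<mu> \<tau> i"
      have "vnorm k ?Z \<le> real k * (14 * real d * real k * sew_const ((real N + 1) * \<alpha>) * (A * \<theta>) * (1 + B * \<beta>))"
        using lb.rough_integral_bound[of \<tau>] \<tau>0 by (intro vnorm_le_card) auto
      also have "\<dots> \<le> real k * (14 * real d * real k * sew_const ((real N + 1) * \<alpha>) * (A * \<theta>) * (2 * (M * B)))"
      proof (intro mult_left_mono)
        have "B * \<beta> \<le> B * (M / 8)" using \<beta> AB by (intro mult_left_mono) auto
        then show "1 + B * \<beta> \<le> 2 * (M * B)" using AB(3) by (simp add: mult.commute)
      qed (use AB \<theta> lb.Cs in auto)
      also have "\<dots> = 28 / 100 * M * (100 * (real k)\<^sup>2 * real d * sew_const ((real N + 1) * \<alpha>) * (A * B * \<theta>))"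
        by (simp add: power2_eq_square)
      also have "\<dots> \<le> 28 / 100 * M * 1" using small M by (intro mult_left_mono) auto
      finally have Z: "vnorm k ?Z \<le> 28 / 100 * M" by simp
      have "\<phi> \<tau> = vnorm k (\<lambda>i. - b \<tau> i + ?Z i)"
        unfolding \<phi>_def using Y_decomp(1)[of \<tau>] \<tau>0 by (intro vnorm_cong) auto
      also have "\<dots> \<le> vnorm k (b \<tau>) + vnorm k ?Z"
        using vnorm_add_le[of k "\<lambda>i. - b \<tau> i" ?Z] by (simp add: vnorm_minus)
      also have "vnorm k (b \<tau>) \<le> \<beta>"
        unfolding \<beta>_def by (rule drift_vnorm_le[OF m \<tau>0(2,4) K])
      finally show ?thesis using Z \<beta>(2) M by simp
    qed
  qed (use \<phi>0 M T in auto)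
  then show ?thesis
    using bracket_diff_le[of k "y T" y0] M by (simp add: \<phi>_def M_def)
qed

end

text \<open>With P = [X:h] ^ (1 / (|h| \<alpha>)) the bound on T says P T \<le> \<epsilon>, and
  [X:h] |t - s| ^ (|h| \<alpha>) = (P |t - s|) ^ (|h| \<alpha>). This is the origin of \<theta> =
  \<epsilon> ^ \<alpha>, valid for every \<tau> \<le> T.\<close>

lemma X_tree_le_of_time:
  assumes X: "rough_path \<alpha> d N X" and \<alpha>: "0 < \<alpha>" and \<epsilon>: "0 < \<epsilon>" and T: "0 \<le> T" "T \<le> 1"
    and le: "ennreal T \<le> ennreal \<epsilon> * min_inv_hoelder \<alpha> d N X"
    and \<tau>: "0 < \<tau>" "\<tau> \<le> T" "s \<in> {0..\<tau>}" "t \<in> {0..\<tau>}" "s \<noteq> t" and h: "h \<in> trees d N"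
  shows "\<bar>X s t (basis {#h#})\<bar> \<le> (\<epsilon> powr \<alpha> * (\<bar>t - s\<bar> / \<tau>) powr \<alpha>) ^ verts h"
proof -
  define n where "n = real (verts h)"
  define H where "H = enn2real (hoelder \<alpha> X {#h#})"
  define P where "P = H powr (1 / (n * \<alpha>))"
  define r where "r = \<bar>t - s\<bar> / \<tau>"
  have n: "0 < n" by (cases h) (simp add: n_def)
  have H: "0 \<le> H" by (simp add: H_def)
  have P0: "0 \<le> P" by (simp add: P_def)
  have r: "0 < r" "\<bar>t - s\<bar> = \<tau> * r" using \<tau> by (auto simp: r_def)
  \<comment> \<open>If P = 0 the reciprocal is infinite and gives no information on T, but the claim
    is trivial.\<close>
  have "P * T \<le> \<epsilon>"
  proof (cases "P = 0")
    case False
    then have P: "0 < P" using P0 by simp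
    have "min_inv_hoelder \<alpha> d N X \<le> 1 / ennreal P"
      unfolding min_inv_hoelder_def P_def H_def n_def using h by (intro Min_le) (auto simp: finite_trees)
    then have "ennreal \<epsilon> * min_inv_hoelder \<alpha> d N X \<le> ennreal \<epsilon> * (1 / ennreal P)"
      by (rule mult_left_mono) simp
    with le have "ennreal T \<le> ennreal \<epsilon> * (1 / ennreal P)" by (rule order_trans)
    also have "\<dots> = ennreal (\<epsilon> / P)"
      using P \<epsilon> divide_ennreal[of 1 P] by (simp flip: ennreal_mult')
    finally have "T \<le> \<epsilon> / P" using \<epsilon> P by simp
    then show ?thesis using P by (simp add: pos_le_divide_eq mult.commute)
  qed (use \<epsilon> in simp)
  then have P\<tau>: "P * \<tau> \<le> \<epsilon>" using mult_left_mono[OF \<tau>(2) P0] by simp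
  have "H = P powr (n * \<alpha>)" using n \<alpha> H by (simp add: P_def powr_powr)
  then have "H * \<bar>t - s\<bar> powr (\<alpha> * n) = (P * \<tau>) powr (n * \<alpha>) * r powr (n * \<alpha>)"
    using P0 r \<tau> by (simp add: powr_mult mult.commute)
  also have "\<dots> \<le> \<epsilon> powr (n * \<alpha>) * r powr (n * \<alpha>)"
    using P\<tau> P0 \<tau> n \<alpha> by (intro mult_right_mono powr_mono2) auto
  also have "\<dots> = (\<epsilon> powr \<alpha> * r powr \<alpha>) ^ verts h"
    using \<epsilon> r by (simp add: n_def power_mult_distrib powr_powr mult.commute flip: powr_realpow)
  finally have "H * \<bar>t - s\<bar> powr (\<alpha> * n) \<le> (\<epsilon> powr \<alpha> * r powr \<alpha>) ^ verts h" .
  moreover have "\<bar>X s t (basis {#h#})\<bar> \<le> H * \<bar>t - s\<bar> powr (\<alpha> * n)"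
    unfolding H_def n_def using \<tau> T by (intro hoelder_bound[OF X h]) auto
  ultimately show ?thesis by (simp add: r_def)
qed

text \<open>The factor of \<theta> in \<open>small\<close> for A = |C| + 1 and B = 1. The thresholds
  are chosen before N, which is recovered from \<alpha> as the floor of 1 / \<alpha>.\<close>

definition coeff_const :: "real \<Rightarrow> nat \<Rightarrow> nat \<Rightarrow> real \<Rightarrow> real" where
  "coeff_const \<alpha> d k C = 100 * (real k)\<^sup>2 * real d * sew_const ((real (nat \<lfloor>1 / \<alpha>\<rfloor>) + 1) * \<alpha>) * (\<bar>C\<bar> + 1)"

text \<open>A threshold for \<epsilon> that enforces q \<theta> \<le> 1 for \<theta> = \<epsilon> ^
  \<alpha>; 1 + |q| keeps it positive for all arguments.\<close>

definition small_time :: "real \<Rightarrow> real \<Rightarrow> real" where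
  "small_time \<alpha> q = (1 / (1 + \<bar>q\<bar>)) powr (1 / \<alpha>)"

lemma small_time_pos: "0 < small_time \<alpha> q"
  by (simp add: small_time_def)

lemma small_time_powr:
  assumes "0 < \<alpha>" "0 < \<epsilon>" "\<epsilon> \<le> small_time \<alpha> q"
  shows "q * \<epsilon> powr \<alpha> \<le> 1"
proof -
  have "\<epsilon> powr \<alpha> \<le> small_time \<alpha> q powr \<alpha>" using assms by (intro powr_mono2) auto
  also have "\<dots> = 1 / (1 + \<bar>q\<bar>)" using assms by (simp add: small_time_def powr_powr)
  finally have "\<bar>q\<bar> * \<epsilon> powr \<alpha> \<le> \<bar>q\<bar> * (1 / (1 + \<bar>q\<bar>))" by (intro mult_left_mono) auto
  also have "\<dots> \<le> 1" by simp
  finally show ?thesis using mult_right_mono[OF abs_ge_self[of q], of "\<epsilon> powr \<alpha>"] by simp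
qed

lemma floor_inverse_eq:
  assumes "0 < \<alpha>" "real N * \<alpha> \<le> 1" "1 < (real N + 1) * \<alpha>"
  shows "nat \<lfloor>1 / \<alpha>\<rfloor> = N"
proof -
  have "\<lfloor>1 / \<alpha>\<rfloor> = int N"
    using assms by (intro floor_unique) (auto simp: field_simps)
  then show ?thesis by simp
qed

text \<open>The exponent will be \<gamma> - p, which may have either sign, so a and b are compared
  in both directions.\<close>

lemma powr_ratio_le:
  fixes a b c :: real
  assumes "0 < b" "b / 2 \<le> a" "a \<le> 2 * b"
  shows "a powr c \<le> 2 powr \<bar>c\<bar> * b powr c"
proof (cases "0 \<le> c")
  case True
  have "a powr c \<le> (2 * b) powr c" using assms True by (intro powr_mono2) auto
  then show ?thesis using assms True by (simp add: powr_mult)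
next
  case False
  have "a powr c \<le> (b / 2) powr c" using assms False by (intro powr_mono2') auto
  then show ?thesis using assms False by (simp add: powr_divide powr_minus_divide)
qed

context rough_solution begin

lemma bounded_case:
  assumes m: "1 < m" and bc: "bounded_coeff d k N \<sigma> C" and T: "T \<in> {0..1}"
    and \<epsilon>1: "\<epsilon>1 \<le> 1 / (8 * 2 powr m)" and \<epsilon>2: "0 < \<epsilon>2" "\<epsilon>2 \<le> small_time \<alpha> (coeff_const \<alpha> d k C)"
    and T1: "T \<le> \<epsilon>1 * bracket k y0 powr (- (m - 1))"
    and T2: "ennreal T \<le> ennreal \<epsilon>2 * min_inv_hoelder \<alpha> d N X"
  shows "bracket k (y T) \<le> 2 * bracket k y0"
proof (rule bracket_growth[of T "\<bar>C\<bar> + 1" 1 "\<epsilon>2 powr \<alpha>"])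
  let ?M = "bracket k y0"
  have M: "1 \<le> ?M" by (rule bracket_ge_1)
  have "T * ?M powr (m - 1) \<le> \<epsilon>1 * ?M powr (- (m - 1)) * ?M powr (m - 1)"
    using T1 by (intro mult_right_mono) auto
  also have "\<dots> = \<epsilon>1" using M by (simp add: mult.assoc flip: powr_add)
  finally show "T * ?M powr (m - 1) \<le> 1 / (8 * 2 powr m)" using \<epsilon>1 by simp
  show "1 \<le> ?M * 1" using M by simp
  show "\<bar>X s t (basis {#h#})\<bar> \<le> (\<epsilon>2 powr \<alpha> * (\<bar>t - s\<bar> / \<tau>) powr \<alpha>) ^ verts h"
    if "0 < \<tau>" "\<tau> \<le> T" "s \<in> {0..\<tau>}" "t \<in> {0..\<tau>}" "s \<noteq> t" "h \<in> trees d N" for \<tau> s t h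
    using T that by (intro X_tree_le_of_time[OF X \<alpha>(1) \<epsilon>2(1) _ _ T2]) auto
  show "\<bar>foldr partial is (\<lambda>x. \<sigma> \<mu> x i) x\<bar> \<le> (\<bar>C\<bar> + 1) * 1 ^ p"
    if x: "x \<in> Rn k" "\<mu> \<in> {1..d}" "i < k" "p \<le> N" "is \<in> idx k p" for x \<mu> i p "is"
  proof -
    obtain \<beta> where "mi_order k \<beta> = length is" "\<bar>foldr partial is (\<lambda>x. \<sigma> \<mu> x i) x\<bar> \<le> coeff_deriv_norm d k \<sigma> \<beta> x"
      by (rule coeff_deriv_foldr_le[of k N \<sigma> \<mu> i d "is" x]) (use x \<sigma> in \<open>auto simp: coeff_C_def idx_def\<close>)
    moreover from this have "coeff_deriv_norm d k \<sigma> \<beta> x \<le> C"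
      using bc x by (auto simp: bounded_coeff_def idx_def)
    ultimately show ?thesis by simp
  qed
  show "100 * (real k)\<^sup>2 * real d * sew_const ((real N + 1) * \<alpha>) * ((\<bar>C\<bar> + 1) * 1 * \<epsilon>2 powr \<alpha>) \<le> 1"
    using small_time_powr[OF \<alpha>(1) \<epsilon>2] unfolding coeff_const_def floor_inverse_eq[OF \<alpha>] by (simp only: mult_ac mult_1_left mult_1_right)
qed (use m T in auto)

text \<open>On the region around y0 the bracket lies between M / 2 and 2 M, so each derivative of
  \<sigma> gains a factor of order 1 / M: the growth assumption becomes the bound A B ^ p with B = 1
  / M.\<close>

lemma growth_case:
  assumes m: "1 < m" and pg: "poly_growth d k N \<sigma> \<gamma> C" and \<gamma>: "1 \<le> \<gamma>" and T: "T \<in> {0..1}"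
    and \<epsilon>1: "\<epsilon>1 \<le> 1 / (8 * 2 powr m)"
    and \<epsilon>2: "0 < \<epsilon>2" "\<epsilon>2 \<le> small_time \<alpha> (coeff_const \<alpha> d k C * 2 powr (\<gamma> + real (nat \<lfloor>1 / \<alpha>\<rfloor>)))"
    and T1: "T \<le> \<epsilon>1 * bracket k y0 powr (- (m - 1))"
    and T2: "ennreal T \<le> ennreal (\<epsilon>2 * (1 / bracket k y0) powr ((\<gamma> - 1) / \<alpha>)) * min_inv_hoelder \<alpha> d N X"
  shows "bracket k (y T) \<le> 2 * bracket k y0"
proof -
  define M where "M = bracket k y0"
  \<comment> \<open>2 ^ (\<gamma> + N) covers the factor 2 ^ |\<gamma> - p| from
    \<open>powr_ratio_le\<close> for all p \<le> N.\<close>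
  define A where "A = (\<bar>C\<bar> + 1) * 2 powr (\<gamma> + real N) * M powr \<gamma>"
  define \<epsilon> where "\<epsilon> = \<epsilon>2 * (1 / M) powr ((\<gamma> - 1) / \<alpha>)"
  have M: "1 \<le> M" unfolding M_def by (rule bracket_ge_1)
  have \<epsilon>: "0 < \<epsilon>" using M \<epsilon>2 by (simp add: \<epsilon>_def)
  have "bracket k (y T) \<le> 2 * M"
  proof (rule bracket_growth[of T A "1 / M" "\<epsilon> powr \<alpha>", folded M_def])
    have "T * M powr (m - 1) \<le> \<epsilon>1 * M powr (- (m - 1)) * M powr (m - 1)"
      using T1 by (intro mult_right_mono) (auto simp: M_def)
    also have "\<dots> = \<epsilon>1" using M by (simp add: mult.assoc flip: powr_add)
    finally show "T * M powr (m - 1) \<le> 1 / (8 * 2 powr m)" using \<epsilon>1 by simp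
    show "\<bar>X s t (basis {#h#})\<bar> \<le> (\<epsilon> powr \<alpha> * (\<bar>t - s\<bar> / \<tau>) powr \<alpha>) ^ verts h"
      if "0 < \<tau>" "\<tau> \<le> T" "s \<in> {0..\<tau>}" "t \<in> {0..\<tau>}" "s \<noteq> t" "h \<in> trees d N" for \<tau> s t h
      using T that by (intro X_tree_le_of_time[OF X \<alpha>(1) \<epsilon> _ _ T2[folded M_def, folded \<epsilon>_def]]) auto
    show "\<bar>foldr partial is (\<lambda>x. \<sigma> \<mu> x i) x\<bar> \<le> A * (1 / M) ^ p"
      if x: "x \<in> Rn k" "vnorm k (\<lambda>i. x i - y0 i) \<le> M / 2" and \<mu>: "\<mu> \<in> {1..d}" "i < k" and p: "p \<le> N" "is \<in> idx k p"
      for x \<mu> i p "is"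
    proof -
      obtain \<beta> where \<beta>: "mi_order k \<beta> = length is" "\<bar>foldr partial is (\<lambda>x. \<sigma> \<mu> x i) x\<bar> \<le> coeff_deriv_norm d k \<sigma> \<beta> x"
        by (rule coeff_deriv_foldr_le[of k N \<sigma> \<mu> i d "is" x]) (use x \<mu> p \<sigma> in \<open>auto simp: coeff_C_def idx_def\<close>)
      have len: "length is = p" using p by (simp add: idx_def)
      have "\<bar>foldr partial is (\<lambda>x. \<sigma> \<mu> x i) x\<bar> \<le> C * bracket k x powr (\<gamma> - real p)"
      proof -
        have "coeff_deriv_norm d k \<sigma> \<beta> x \<le> C * bracket k x powr (\<gamma> - real (mi_order k \<beta>))"
          using pg[unfolded poly_growth_def, rule_format, of \<beta> x] x(1) p(1) \<beta>(1) len by simp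
        then show ?thesis using \<beta> len by simp
      qed
      also have "\<dots> \<le> (\<bar>C\<bar> + 1) * (2 powr (\<gamma> + real N) * M powr (\<gamma> - real p))"
      proof (intro mult_mono)
        have "vnorm k (\<lambda>i. y0 i - x i) \<le> M / 2"
          using x(2) vnorm_minus[of k "\<lambda>i. x i - y0 i"] by simp
        then have "M / 2 \<le> bracket k x" "bracket k x \<le> 2 * M"
          using bracket_diff_le[of k x y0] bracket_diff_le[of k y0 x] x(2) M by (simp_all add: M_def)
        then have "bracket k x powr (\<gamma> - real p) \<le> 2 powr \<bar>\<gamma> - real p\<bar> * M powr (\<gamma> - real p)"
          using M by (intro powr_ratio_le) auto
        also have "\<dots> \<le> 2 powr (\<gamma> + real N) * M powr (\<gamma> - real p)"
          using \<gamma> p by (intro mult_right_mono powr_mono) auto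
        finally show "bracket k x powr (\<gamma> - real p) \<le> 2 powr (\<gamma> + real N) * M powr (\<gamma> - real p)" .
      qed auto
      also have "\<dots> = A * (1 / M) ^ p"
        using M by (simp add: A_def powr_diff powr_realpow power_one_over)
      finally show ?thesis .
    qed
    \<comment> \<open>M ^ \<gamma> from A, 1 / M from B and M ^ (1 - \<gamma>) from \<epsilon> ^
      \<alpha> multiply to 1.\<close>
    show "100 * (real k)\<^sup>2 * real d * sew_const ((real N + 1) * \<alpha>) * (A * (1 / M) * \<epsilon> powr \<alpha>) \<le> 1"
    proof -
      have "\<epsilon> powr \<alpha> = \<epsilon>2 powr \<alpha> * (1 / M) powr (\<gamma> - 1)"
        using M \<epsilon>2 \<alpha> by (simp add: \<epsilon>_def powr_mult powr_powr)
      also have "(1 / M) powr (\<gamma> - 1) = M / M powr \<gamma>"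
        using M by (simp add: powr_divide powr_diff)
      finally have "A * (1 / M) * \<epsilon> powr \<alpha> = (\<bar>C\<bar> + 1) * 2 powr (\<gamma> + real N) * \<epsilon>2 powr \<alpha>"
        using M by (simp add: A_def)
      then show ?thesis
        using small_time_powr[OF \<alpha>(1) \<epsilon>2] unfolding coeff_const_def floor_inverse_eq[OF \<alpha>]
        by (simp only: mult_ac)
    qed
  qed (use m T M in \<open>auto simp: A_def\<close>)
  then show ?thesis by (simp only: M_def)
qed

end

lemma rough_solutionE:
  assumes "0 < \<alpha>" "real N * \<alpha> \<le> 1" "1 < (real N + 1) * \<alpha>" "\<alpha> < 1" "1 \<le> d" "1 \<le> k" "rough_path \<alpha> d N X"
    "coeff_C d k N \<sigma>" "y0 \<in> Rn k" and sol: "is_solution m \<alpha> d N k X \<sigma> y0 Y"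
  obtains J where "rough_solution m \<alpha> N d k X \<sigma> y0 Y J"
proof -
  \<comment> \<open>For N = 0 the third assumption would read 1 < \<alpha>.\<close>
  have "1 \<le> N" using assms by (cases N) auto
  moreover from sol obtain J where "\<forall>s\<in>{0..1}. \<forall>\<mu>\<in>{1..d}. \<forall>i<k.
             has_rough_integral d N X (\<lambda>r. compose d N k (\<sigma> \<mu>) Y r i) \<mu> 0 s (J \<mu> s i)"
      "\<forall>s\<in>{0..1}. \<forall>i<k. Y s i =
               fscale (y0 i) 1
               - fscale (integral {0..s} (\<lambda>r. vnorm k (fcoeff {#} (Y r)) powr (m - 1)
                                               * fcoeff {#} (Y r) i)) 1
               + ((\<Sum>\<mu>\<in>{1..d}. fscale (J \<mu> s i) 1)
                  + (\<Sum>\<mu>\<in>{1..d}. \<Sum>f\<in>{f \<in> forests d N. fverts f + 2 \<le> N}.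
                       fscale (fcoeff f (compose d N k (\<sigma> \<mu>) Y s) i) (basis {#Node \<mu> f#})))"
    unfolding is_solution_def by blast
  ultimately have "rough_solution m \<alpha> N d k X \<sigma> y0 Y J"
    using assms by unfold_locales (auto simp: is_solution_def)
  then show ?thesis by (rule that)
qed

theorem theorem1p5:
  shows "\<exists>(E1 :: real \<Rightarrow> real) (E2 :: real \<Rightarrow> nat \<Rightarrow> nat \<Rightarrow> real \<Rightarrow> real)
           (E2' :: real \<Rightarrow> nat \<Rightarrow> nat \<Rightarrow> real \<Rightarrow> real \<Rightarrow> real).
    (\<forall>m>1. E1 m > 0) \<and>
    (\<forall>\<alpha> d k C. E2 \<alpha> d k C > 0) \<and>
    (\<forall>\<alpha> d k C \<gamma>. E2' \<alpha> d k C \<gamma> > 0) \<and>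
    (\<forall>(m::real) (\<alpha>::real) (N::nat) (d::nat) (k::nat) X \<sigma> y0 Y.
       m > 1 \<and> 0 < \<alpha> \<and> \<alpha> < 1 \<and> real N * \<alpha> \<le> 1 \<and> 1 < (real N + 1) * \<alpha> \<and>
       d \<ge> 1 \<and> k \<ge> 1 \<and> rough_path \<alpha> d N X \<and> coeff_C d k N \<sigma> \<and> y0 \<in> Rn k \<and>
       is_solution m \<alpha> d N k X \<sigma> y0 Y \<longrightarrow>
       (\<forall>C \<epsilon>1 \<epsilon>2 T1 T2.
          bounded_coeff d k N \<sigma> C \<and>
          0 < \<epsilon>1 \<and> \<epsilon>1 \<le> E1 m \<and> 0 < \<epsilon>2 \<and> \<epsilon>2 \<le> E2 \<alpha> d k C \<and>
          T1 = ennreal (\<epsilon>1 * (1 / bracket k y0 powr (m - 1))) \<and>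
          T2 = ennreal \<epsilon>2 * min_inv_hoelder \<alpha> d N X \<longrightarrow>
          (\<forall>t\<in>{0..1}. ennreal t \<le> min T1 T2 \<longrightarrow>
             bracket k (fcoeff {#} (Y t)) \<le> 2 * bracket k y0)) \<and>
       (\<forall>C \<gamma> \<epsilon>1 \<epsilon>2 T1 T2.
          1 \<le> \<gamma> \<and> \<gamma> < (m - 1) * \<alpha> + 1 \<and> poly_growth d k N \<sigma> \<gamma> C \<and>
          0 < \<epsilon>1 \<and> \<epsilon>1 \<le> E1 m \<and> 0 < \<epsilon>2 \<and> \<epsilon>2 \<le> E2' \<alpha> d k C \<gamma> \<and>
          T1 = ennreal (\<epsilon>1 * bracket k y0 powr (- (m - 1))) \<and>
          T2 = ennreal (\<epsilon>2 * (1 / bracket k y0) powr ((\<gamma> - 1) / \<alpha>)) * min_inv_hoelder \<alpha> d N X \<longrightarrow>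
          (\<forall>t\<in>{0..1}. ennreal t \<le> min T1 T2 \<longrightarrow>
             bracket k (fcoeff {#} (Y t)) \<le> 2 * bracket k y0)))"
\<comment> \<open>The drift fixes the first threshold, \<open>small\<close> the other two; the
  additional power of 2 in the last one is the factor in A of \<open>growth_case\<close>.\<close>
proof (intro exI[of _ "\<lambda>m. 1 / (8 * 2 powr m)"] exI[of _ "\<lambda>\<alpha> d k C. small_time \<alpha> (coeff_const \<alpha> d k C)"]
    exI[of _ "\<lambda>\<alpha> d k C \<gamma>. small_time \<alpha> (coeff_const \<alpha> d k C * 2 powr (\<gamma> + real (nat \<lfloor>1 / \<alpha>\<rfloor>)))"]
    conjI allI impI ballI; (elim conjE)?)
  fix m \<alpha> :: real and N d k :: nat and X \<sigma> y0 Y and C \<epsilon>1 \<epsilon>2 :: real and T1 T2 t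
  assume "1 < m" "0 < \<alpha>" "\<alpha> < 1" "real N * \<alpha> \<le> 1" "1 < (real N + 1) * \<alpha>" "1 \<le> d" "1 \<le> k" "rough_path \<alpha> d N X"
    "coeff_C d k N \<sigma>" "y0 \<in> Rn k" "is_solution m \<alpha> d N k X \<sigma> y0 Y"
    and part: "bounded_coeff d k N \<sigma> C" "0 < \<epsilon>1" "\<epsilon>1 \<le> 1 / (8 * 2 powr m)" "0 < \<epsilon>2"
      "\<epsilon>2 \<le> small_time \<alpha> (coeff_const \<alpha> d k C)"
    and T: "T1 = ennreal (\<epsilon>1 * (1 / bracket k y0 powr (m - 1)))" "T2 = ennreal \<epsilon>2 * min_inv_hoelder \<alpha> d N X"
      "t \<in> {0..1}" "ennreal t \<le> min T1 T2"
  then obtain J where "rough_solution m \<alpha> N d k X \<sigma> y0 Y J" using rough_solutionE by blast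
  then interpret rough_solution m \<alpha> N d k X \<sigma> y0 Y J .
  have "t \<le> \<epsilon>1 * bracket k y0 powr (- (m - 1))"
    using T part(2) unfolding powr_minus_divide by (simp add: ennreal_le_iff)
  then show "bracket k (fcoeff {#} (Y t)) \<le> 2 * bracket k y0"
    using bounded_case[OF \<open>1 < m\<close> part(1) T(3) part(3-5)] T unfolding y_def by simp
next
  fix m \<alpha> :: real and N d k :: nat and X \<sigma> y0 Y and C \<gamma> \<epsilon>1 \<epsilon>2 :: real and T1 T2 t
  assume "1 < m" "0 < \<alpha>" "\<alpha> < 1" "real N * \<alpha> \<le> 1" "1 < (real N + 1) * \<alpha>" "1 \<le> d" "1 \<le> k" "rough_path \<alpha> d N X"
    "coeff_C d k N \<sigma>" "y0 \<in> Rn k" "is_solution m \<alpha> d N k X \<sigma> y0 Y"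
    and part: "1 \<le> \<gamma>" "poly_growth d k N \<sigma> \<gamma> C" "0 < \<epsilon>1" "\<epsilon>1 \<le> 1 / (8 * 2 powr m)" "0 < \<epsilon>2"
      "\<epsilon>2 \<le> small_time \<alpha> (coeff_const \<alpha> d k C * 2 powr (\<gamma> + real (nat \<lfloor>1 / \<alpha>\<rfloor>)))"
    and T: "T1 = ennreal (\<epsilon>1 * bracket k y0 powr (- (m - 1)))"
      "T2 = ennreal (\<epsilon>2 * (1 / bracket k y0) powr ((\<gamma> - 1) / \<alpha>)) * min_inv_hoelder \<alpha> d N X"
      "t \<in> {0..1}" "ennreal t \<le> min T1 T2"
  then obtain J where "rough_solution m \<alpha> N d k X \<sigma> y0 Y J" using rough_solutionE by blast
  then interpret rough_solution m \<alpha> N d k X \<sigma> y0 Y J .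
  have "t \<le> \<epsilon>1 * bracket k y0 powr (- (m - 1))"
    using T part(3) by (simp add: ennreal_le_iff)
  then show "bracket k (fcoeff {#} (Y t)) \<le> 2 * bracket k y0"
    using growth_case[OF \<open>1 < m\<close> part(2,1) T(3) part(4-6)] T unfolding y_def by simp
qed (simp_all add: small_time_pos)

end
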